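(* Let $k$ be a natural number and let $G$ be a finite group. Then the following statements are equivalent. (1) Every maximal subgroup of $G$ is $k$-submodular in $G$. (2) $G$ is supersoluble and for every complemented chief factor $H/K$ of $G$, the group $G/C_G(H/K)$ is either trivial or cyclic of order $q^n$ for some prime $q$ and some natural number $n\le k$. (3) $G$ is soluble and for all maximal subgroups $M_1$ and $M_2$ of $G$ either $M_1=M_2$, or there are a natural number $n\le k$ and primes $q_1,q_2$ (not necessarily different) such that, for $i=1,2$, $M_1\cap M_2$ is an $n$-maximal subgroup of $M_i$ and $|M_i:M_1\cap M_2|=q_i^{n}$.
   Context: All groups are finite; natural numbers are positive integers. $\mathrm{Core}_G(H)$ denotes the intersection of all conjugates of $H$ in $G$. For a natural number $n$, a subgroup $H$ of $G$ is $n$-modularly embedded in $G$ if either $H\unlhd G$, or $G/\mathrm{Core}_G(H)$ is a non-nilpotent group of order $pq^n$ with $|G:H|=p$ for some primes $p$ and $q$. For a natural number $k$, a subgroup $H$ of $G$ is $k$-submodular in $G$ if there is a chain of subgroups $H=H_0\le H_1\le\cdots\le H_m=G$ such that for every $i=1,\dots,m$, $H_{i-1}$ is $n_i$-modularly embedded in $H_i$ for some natural number $n_i\le k$. A chief factor $H/K$ of $G$ is complemented if there is a subgroup $M$ of $G$ with $G=HM$ and $H\cap M=K$. $C_G(H/K)$ is the centralizer in $G$ of the chief factor $H/K$ under the conjugation action. $n$-maximal subgroups: $G$ is the $0$-maximal subgroup of $G$, and for $n\ge1$ a subgroup $M$ is $n$-maximal in $G$ if $M$ is a maximal subgroup of some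 $(n-1)$-maximal subgroup of $G$. *)

theory Defs
  imports "HOL-Algebra.Algebra" "HOL-Computational_Algebra.Primes"
begin

text \<open>As in HOL-Algebra, a subgroup \<open>H\<close> of \<open>G\<close> is a set; it is regarded as a group
  in its own right in the form \<open>G\<lparr>carrier := H\<rparr>\<close>.\<close>

definition subgroup_index :: "('a, 'b) monoid_scheme \<Rightarrow> 'a set \<Rightarrow> nat"
  where "subgroup_index G H = card (rcosets\<^bsub>G\<^esub> H)"

definition maximal_subgroup :: "'a set \<Rightarrow> ('a, 'b) monoid_scheme \<Rightarrow> bool"
  where "maximal_subgroup M G \<longleftrightarrow>
    subgroup M G \<and> M \<noteq> carrier G \<and>
    (\<forall>L. subgroup L G \<and> M \<subseteq> L \<longrightarrow> L = M \<or> L = carrier G)"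

primrec n_maximal_subgroup :: "nat \<Rightarrow> 'a set \<Rightarrow> ('a, 'b) monoid_scheme \<Rightarrow> bool"
  where
    "n_maximal_subgroup 0 M G \<longleftrightarrow> M = carrier G"
  | "n_maximal_subgroup (Suc n) M G \<longleftrightarrow>
       (\<exists>L. n_maximal_subgroup n L G \<and> maximal_subgroup M (G\<lparr>carrier := L\<rparr>))"

definition core :: "('a, 'b) monoid_scheme \<Rightarrow> 'a set \<Rightarrow> 'a set"
  where "core G H = (\<Inter>g\<in>carrier G. g <#\<^bsub>G\<^esub> H #>\<^bsub>G\<^esub> inv\<^bsub>G\<^esub> g)"

primrec lower_central :: "('a, 'b) monoid_scheme \<Rightarrow> nat \<Rightarrow> 'a set"
  where
    "lower_central G 0 = carrier G"
  | "lower_central G (Suc n) = generate G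
       (\<Union>x\<in>lower_central G n. \<Union>g\<in>carrier G.
          {x \<otimes>\<^bsub>G\<^esub> g \<otimes>\<^bsub>G\<^esub> inv\<^bsub>G\<^esub> x \<otimes>\<^bsub>G\<^esub> inv\<^bsub>G\<^esub> g})"

definition nilpotent_group :: "('a, 'b) monoid_scheme \<Rightarrow> bool"
  where "nilpotent_group G \<longleftrightarrow> (\<exists>n. lower_central G n = {\<one>\<^bsub>G\<^esub>})"

definition supersoluble :: "('a, 'b) monoid_scheme \<Rightarrow> bool"
  where "supersoluble G \<longleftrightarrow>
    (\<exists>N (m::nat). N 0 = {\<one>\<^bsub>G\<^esub>} \<and> N m = carrier G \<and> (\<forall>i\<le>m. N i \<lhd> G) \<and>
       (\<forall>i<m. N i \<subseteq> N (Suc i) \<and> cyclic_group (G\<lparr>carrier := N (Suc i)\<rparr> Mod N i)))"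

text \<open>The natural numbers \<open>n\<close> and \<open>k\<close> in the next two notions are positive.\<close>

definition modularly_embedded :: "nat \<Rightarrow> 'a set \<Rightarrow> ('a, 'b) monoid_scheme \<Rightarrow> bool"
  where "modularly_embedded n H G \<longleftrightarrow> subgroup H G \<and>
    (H \<lhd> G \<or>
     \<not> nilpotent_group (G Mod core G H) \<and>
     (\<exists>p q. Factorial_Ring.prime p \<and> Factorial_Ring.prime q \<and>
        Coset.order (G Mod core G H) = p * q ^ n \<and> subgroup_index G H = p))"

definition submodular :: "nat \<Rightarrow> 'a set \<Rightarrow> ('a, 'b) monoid_scheme \<Rightarrow> bool"
  where "submodular k H G \<longleftrightarrow>
    (\<exists>C (m::nat). C 0 = H \<and> C m = carrier G \<and> (\<forall>i\<le>m. subgroup (C i) G) \<and>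
       (\<forall>i<m. C i \<subseteq> C (Suc i) \<and>
          (\<exists>n. 1 \<le> n \<and> n \<le> k \<and> modularly_embedded n (C i) (G\<lparr>carrier := C (Suc i)\<rparr>))))"

text \<open>A factor \<open>H/K\<close> is represented by the pair of normal subgroups \<open>H\<close>, \<open>K\<close>.\<close>

definition chief_factor :: "('a, 'b) monoid_scheme \<Rightarrow> 'a set \<Rightarrow> 'a set \<Rightarrow> bool"
  where "chief_factor G H K \<longleftrightarrow> H \<lhd> G \<and> K \<lhd> G \<and> K \<subset> H \<and>
    (\<forall>L. L \<lhd> G \<and> K \<subseteq> L \<and> L \<subseteq> H \<longrightarrow> L = K \<or> L = H)"

definition complemented_factor :: "('a, 'b) monoid_scheme \<Rightarrow> 'a set \<Rightarrow> 'a set \<Rightarrow> bool"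
  where "complemented_factor G H K \<longleftrightarrow>
    (\<exists>M. subgroup M G \<and> carrier G = H <#>\<^bsub>G\<^esub> M \<and> H \<inter> M = K)"

definition factor_centralizer :: "('a, 'b) monoid_scheme \<Rightarrow> 'a set \<Rightarrow> 'a set \<Rightarrow> 'a set"
  where "factor_centralizer G H K =
    {g \<in> carrier G. \<forall>h\<in>H. K #>\<^bsub>G\<^esub> (g \<otimes>\<^bsub>G\<^esub> h \<otimes>\<^bsub>G\<^esub> inv\<^bsub>G\<^esub> g) = K #>\<^bsub>G\<^esub> h}"

end

theory Submission
  imports Defs "HOL-Number_Theory.Residue_Primitive_Roots"
begin

text \<open>
  Since a maximal subgroup \<open>M\<close> leaves no room for intermediate subgroups, (1) says that \<open>M\<close> is normal or
  \<open>G/core M\<close> is non-nilpotent of order \<open>p q\<^sup>n\<close> with \<open>|G:M| = p\<close>, \<open>n \<le> k\<close>. Supersolubility is used in the form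
  "all chief factors have prime order". To get it from (1), consider a minimal normal subgroup \<open>N\<close> of a
  quotient all of whose proper quotients are supersoluble. If some maximal subgroup omits \<open>N\<close>, the
  order condition gives \<open>|N|\<close> directly. Otherwise \<open>N\<close> is a \<open>p\<close>-group, and for the largest normal
  \<open>p\<close>-subgroup \<open>P\<close> the Frattini argument shows that \<open>G/P\<close> is abelian of exponent dividing \<open>p - 1\<close>; as
  \<open>P\<close> centralizes \<open>N\<close>, every element of \<open>G\<close> has an eigenvector on \<open>N\<close>, hence acts by a power map, and
  \<open>|N| = p\<close>.

  For a non-normal \<open>M\<close> with core \<open>L\<close> and a chief factor \<open>H/L\<close> of prime order, \<open>M\<close> complements \<open>H/L\<close> and \<open>H\<close> is
  its centralizer, so \<open>G/H \<cong> M/L\<close> is the cyclic group of (2). Two maximal subgroups either permute, and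
  then \<open>n = 1\<close> works in (3), or share the core \<open>L\<close> and intersect in \<open>L\<close>. Conversely, if (3) holds, comparing \<open>M\<close>
  with a maximal subgroup \<open>T \<supseteq> H\<close> forces \<open>n = 1\<close> because \<open>M \<inter> T\<close> is maximal in \<open>M\<close>, whence \<open>|H/L|\<close> is
  prime; comparing \<open>M\<close> with a conjugate yields \<open>|M/L| = q\<^sup>n\<close>.
\<close>

text \<open>The hard case on the way from (1) to (2) is a theorem of Huppert: a group that is
  supersoluble modulo its Frattini subgroup is supersoluble. A minimal normal subgroup
  \<open>N\<close> inside all maximal subgroups is invisible to (1), so its order must come from the
  action of \<open>G\<close>. Representation theory is replaced by one fact: the field with
  \<open>p\<close> elements contains all roots of unity of order dividing \<open>p - 1\<close>, so
  an operator on an elementary abelian \<open>p\<close>-group whose \<open>(p - 1)\<close>-th power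
  is the identity splits into eigenspaces. That \<open>G/P\<close> has exponent dividing
  \<open>p - 1\<close> produces such operators; that it is abelian makes every eigenspace normal in
  \<open>G\<close>, hence equal to \<open>N\<close> by minimality.

  Chief factors of prime order are preferred to a normal series because they can be tested one at a
  time and pass through quotients in both directions. The induction over quotients runs over normal
  subgroups of a fixed \<open>G\<close>, since the elements of \<open>G Mod K\<close> have a new
  type.\<close>

lemma card_eq_mult_fibres:
  assumes "finite A" and "\<And>y. y \<in> f ` A \<Longrightarrow> card {x \<in> A. f x = y} = c"
  shows "card A = card (f ` A) * c"
proof -
  have "card A = (\<Sum>x\<in>A. 1)" by simp
  also have "\<dots> = (\<Sum>y\<in>f ` A. \<Sum>x | x \<in> A \<and> f x = y. 1)"
    by (rule sum.image_gen[OF assms(1)])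
  also have "\<dots> = (\<Sum>y\<in>f ` A. c)" using assms(2) by simp
  finally show ?thesis by simp
qed

lemma prime_power_dvd_cases:
  fixes d p :: nat
  assumes "Factorial_Ring.prime p" "d dvd p ^ a" "d \<noteq> 1"
  shows "p dvd d"
proof -
  obtain i where "d = p ^ i" using assms divides_primepow_nat by blast
  with assms(3) show ?thesis by (cases i) auto
qed

section \<open>Elementary facts on finite groups, powers and product sets\<close>

context group
begin

lemma l_cancel_inv [simp]:
  assumes "x \<in> carrier G" "y \<in> carrier G"
  shows "x \<otimes> (inv x \<otimes> y) = y" "inv x \<otimes> (x \<otimes> y) = y"
  using assms by (simp_all add: m_assoc[symmetric])

lemma conj_mult:
  assumes "g \<in> carrier G" "x \<in> carrier G" "y \<in> carrier G"
  shows "g \<otimes> (x \<otimes> y) \<otimes> inv g = (g \<otimes> x \<otimes> inv g) \<otimes> (g \<otimes> y \<otimes> inv g)"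
  using assms by (simp add: m_assoc)

lemma conj_inv:
  assumes "g \<in> carrier G" "x \<in> carrier G"
  shows "g \<otimes> inv x \<otimes> inv g = inv (g \<otimes> x \<otimes> inv g)"
  using assms by (simp add: m_assoc inv_mult_group)

lemma conj_conj:
  assumes "g \<in> carrier G" "h \<in> carrier G" "x \<in> carrier G"
  shows "(g \<otimes> h) \<otimes> x \<otimes> inv (g \<otimes> h) = g \<otimes> (h \<otimes> x \<otimes> inv h) \<otimes> inv g"
  using assms by (simp add: m_assoc inv_mult_group)

lemma conj_pow:
  fixes n :: nat
  assumes "g \<in> carrier G" "x \<in> carrier G"
  shows "g \<otimes> (x [^] n) \<otimes> inv g = (g \<otimes> x \<otimes> inv g) [^] n"
  using assms by (induction n) (simp_all add: conj_mult)

lemma subgroup_pow: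
  fixes n :: nat
  assumes "subgroup H G" "x \<in> H"
  shows "x [^] n \<in> H"
  using assms by (induction n) (auto simp: subgroup.one_closed subgroup.m_closed)

lemma finite_subgroup:
  assumes "finite (carrier G)" "subgroup H G"
  shows "finite H"
  using assms finite_subset subgroup.subset by blast

lemma card_subgroup_pos:
  assumes "finite (carrier G)" "subgroup H G"
  shows "0 < card H"
  using assms finite_subgroup subgroup.one_closed by (auto simp: card_gt_0_iff)

lemma card_subgroup_dvd:
  assumes "subgroup H G" "subgroup J G" "H \<subseteq> J"
  shows "card H dvd card J"
proof -
  have "group (G\<lparr>carrier := J\<rparr>)" by (simp add: assms(2) subgroup_imp_group)
  then have "card (rcosets\<^bsub>G\<lparr>carrier := J\<rparr>\<^esub> H) * card H = order (G\<lparr>carrier := J\<rparr>)"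
    using group.lagrange subgroup_incl[OF assms(1,2,3)] by blast
  then show ?thesis by (metis dvd_triv_right order_def partial_object.simps(1) partial_object.update_convs(1) partial_object.surjective simps(1))
qed

lemma subgroup_eqI_card:
  assumes "finite (carrier G)" "subgroup J G" "H \<subseteq> J" "card J \<le> card H"
  shows "H = J"
  by (meson assms card_seteq finite_subgroup)

lemma pow_card_eq_one:
  assumes "subgroup H G" "x \<in> H"
  shows "x [^] card H = \<one>"
proof -
  interpret H: group "G\<lparr>carrier := H\<rparr>" by (simp add: assms(1) subgroup_imp_group)
  have "x [^]\<^bsub>G\<lparr>carrier := H\<rparr>\<^esub> order (G\<lparr>carrier := H\<rparr>) = \<one>\<^bsub>G\<lparr>carrier := H\<rparr>\<^esub>"
    using H.pow_order_eq_1 assms(2) by simp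
  then show ?thesis by (simp add: order_def flip: nat_pow_consistent)
qed

lemma pow_coprime_eq_one:
  fixes m n :: nat
  assumes "x \<in> carrier G" "x [^] m = \<one>" "x [^] n = \<one>" "coprime m n"
  shows "x = \<one>"
proof -
  have "ord x dvd m" "ord x dvd n" using assms pow_eq_id by auto
  then have "ord x = 1" using assms(4) by (meson coprime_common_divisor_nat nat_dvd_1_iff_1 coprime_def)
  then show ?thesis using assms(1) pow_ord_eq_1 by (metis nat_pow_eone)
qed

lemma card_eq_one_iff:
  assumes "subgroup H G"
  shows "card H = 1 \<longleftrightarrow> H = {\<one>}"
proof
  assume "card H = 1"
  then obtain x where "H = {x}" by (rule card_1_singletonE)
  then show "H = {\<one>}" using subgroup.one_closed[OF assms] by simp
qed simp

lemma Int_coprime_card: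
  assumes H: "subgroup H G" and K: "subgroup K G" and "coprime (card H) (card K)"
  shows "H \<inter> K = {\<one>}"
proof -
  have "x = \<one>" if "x \<in> H" "x \<in> K" for x
    using pow_coprime_eq_one[OF subgroup.mem_carrier[OF H that(1)]
        pow_card_eq_one[OF H that(1)] pow_card_eq_one[OF K that(2)] assms(3)] .
  then show ?thesis using subgroup.one_closed[OF H] subgroup.one_closed[OF K] by blast
qed

lemma pow_mod_eq:
  fixes m n :: nat
  assumes "x \<in> carrier G" "x [^] p = \<one>" "[m = n] (mod p)"
  shows "x [^] m = x [^] n"
proof -
  have *: "x [^] k = x [^] (k mod p)" for k :: nat
  proof -
    have "x [^] k = x [^] (p * (k div p) + k mod p)" by simp
    also have "\<dots> = (x [^] p) [^] (k div p) \<otimes> x [^] (k mod p)"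
      using assms(1) by (simp only: nat_pow_mult[symmetric] nat_pow_pow)
    also have "\<dots> = x [^] (k mod p)" using assms(1,2) by simp
    finally show ?thesis .
  qed
  show ?thesis using *[of m] *[of n] assms(3) by (simp add: cong_def)
qed

text \<open>The fibre of multiplication over \<open>h \<otimes> k\<close> consists of the pairs
  \<open>(h \<otimes> d, inv d \<otimes> k)\<close> with \<open>d\<close> in
  \<open>H \<inter> K\<close>, so all fibres have the same size.\<close>

lemma card_set_mult:
  assumes "finite (carrier G)" "subgroup H G" "subgroup K G"
  shows "card (H <#> K) * card (H \<inter> K) = card H * card K"
proof -
  interpret H: subgroup H G by fact
  interpret K: subgroup K G by fact
  let ?f = "\<lambda>(h, k). h \<otimes> k"
  have img: "?f ` (H \<times> K) = H <#> K" by (auto simp: set_mult_def)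
  have "card {x \<in> H \<times> K. ?f x = y} = card (H \<inter> K)" if "y \<in> ?f ` (H \<times> K)" for y
  proof -
    obtain z where "z \<in> H \<times> K" "y = ?f z" using \<open>y \<in> ?f ` (H \<times> K)\<close> by blast
    then obtain h k where hk: "h \<in> H" "k \<in> K" "y = h \<otimes> k" by (cases z) auto
    have "bij_betw (\<lambda>d. (h \<otimes> d, inv d \<otimes> k)) (H \<inter> K) {x \<in> H \<times> K. ?f x = y}"
    proof (rule bij_betwI[where g = "\<lambda>(a, b). inv h \<otimes> a"])
      show "(\<lambda>d. (h \<otimes> d, inv d \<otimes> k)) \<in> H \<inter> K \<rightarrow> {x \<in> H \<times> K. ?f x = y}"
        using hk by (auto simp: m_assoc)
      have "inv h \<otimes> a \<in> K" if that: "a \<in> H" "b \<in> K" "a \<otimes> b = h \<otimes> k" for a b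
      proof -
        have "a = (h \<otimes> k) \<otimes> inv b"
          using that hk inv_solve_right[of a "h \<otimes> k" b] by (metis H.mem_carrier K.mem_carrier m_closed)
        then have "inv h \<otimes> a = k \<otimes> inv b" using that hk by (simp add: m_assoc)
        then show ?thesis using that hk by simp
      qed
      then show "(\<lambda>(a, b). inv h \<otimes> a) \<in> {x \<in> H \<times> K. ?f x = y} \<rightarrow> H \<inter> K"
        using hk by auto
      show "(case (h \<otimes> d, inv d \<otimes> k) of (a, b) \<Rightarrow> inv h \<otimes> a) = d" if "d \<in> H \<inter> K" for d
        using that hk by (simp add: m_assoc)
      show "(h \<otimes> (case z of (a, b) \<Rightarrow> inv h \<otimes> a), inv (case z of (a, b) \<Rightarrow> inv h \<otimes> a) \<otimes> k) = z"
        if z: "z \<in> {x \<in> H \<times> K. ?f x = y}" for z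
      proof -
        obtain a b where ab: "z = (a, b)" "a \<in> H" "b \<in> K" "a \<otimes> b = h \<otimes> k"
          using z hk(3) by (cases z) auto
        have "inv (inv h \<otimes> a) \<otimes> k = inv a \<otimes> (h \<otimes> k)"
          using hk ab(2) by (simp add: inv_mult_group m_assoc)
        also have "\<dots> = b" using ab(2,3) by (simp flip: ab(4))
        finally show ?thesis using hk ab by simp
      qed
    qed
    then show ?thesis by (rule bij_betw_same_card[symmetric])
  qed
  moreover have "finite (H \<times> K)" using finite_subgroup assms by simp
  ultimately have "card (H \<times> K) = card (?f ` (H \<times> K)) * card (H \<inter> K)"
    by (intro card_eq_mult_fibres)
  then show ?thesis by (simp add: img card_cartesian_product)
qed

lemma set_multI: "x \<in> H \<Longrightarrow> y \<in> K \<Longrightarrow> x \<otimes> y \<in> H <#> K"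
  by (auto simp: set_mult_def)

lemma set_multE:
  assumes "x \<in> H <#> K" obtains y z where "y \<in> H" "z \<in> K" "x = y \<otimes> z"
  using assms by (auto simp: set_mult_def)

lemma subset_set_mult:
  assumes "subgroup H G" "subgroup K G"
  shows "H \<subseteq> H <#> K" "K \<subseteq> H <#> K"
proof -
  interpret H: subgroup H G by fact
  interpret K: subgroup K G by fact
  show "H \<subseteq> H <#> K"
  proof
    fix x assume "x \<in> H"
    then show "x \<in> H <#> K" using set_multI[OF _ K.one_closed, of x H] by simp
  qed
  show "K \<subseteq> H <#> K"
  proof
    fix x assume "x \<in> K"
    then show "x \<in> H <#> K" using set_multI[OF H.one_closed, of x K] by simp
  qed
qed

lemma set_mult_subset:
  assumes "subgroup L G" "H \<subseteq> L" "K \<subseteq> L"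
  shows "H <#> K \<subseteq> L"
  using assms subgroup.m_closed[OF assms(1)] by (auto simp: set_mult_def)

lemma normal_set_mult:
  assumes "N \<lhd> G" "K \<lhd> G"
  shows "N <#> K \<lhd> G"
proof (rule normal_invI)
  interpret N: normal N G by fact
  interpret K: normal K G by fact
  show "subgroup (N <#> K) G" using mult_norm_subgroup[OF assms(1) K.subgroup_axioms] .
  fix x h assume x: "x \<in> carrier G" and "h \<in> N <#> K"
  then obtain a b where ab: "a \<in> N" "b \<in> K" "h = a \<otimes> b" by (auto simp: set_mult_def)
  have "x \<otimes> h \<otimes> inv x = (x \<otimes> a \<otimes> inv x) \<otimes> (x \<otimes> b \<otimes> inv x)"
    using ab x by (simp add: conj_mult)
  then show "x \<otimes> h \<otimes> inv x \<in> N <#> K"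
    using N.inv_op_closed2[OF x ab(1)] K.inv_op_closed2[OF x ab(2)] by (auto simp: set_mult_def)
qed

end

section \<open>Surjective homomorphisms\<close>

text \<open>The correspondence theorem in usable form: \<open>pre\<close> and image are mutually
  inverse between the subgroups of \<open>H\<close> and the subgroups of \<open>G\<close> above the
  kernel, and orders change by the factor \<open>card ker\<close>. It is instantiated with the
  projections \<open>\<lambda>x. N #> x\<close>.\<close>

locale epi_hom = group_hom +
  assumes surj: "h ` carrier G = carrier H" and fin: "finite (carrier G)"
begin

definition pre where "pre S = {x \<in> carrier G. h x \<in> S}"

abbreviation "ker \<equiv> kernel G H h"

lemma finite_H: "finite (carrier H)" using surj fin by (metis finite_imageI)

lemma pre_subset: "pre S \<subseteq> carrier G" by (auto simp: pre_def)

lemma memE: assumes "y \<in> carrier H" obtains x where "x \<in> carrier G" "h x = y"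
  using assms surj by (metis imageE)

lemma image_pre: assumes "S \<subseteq> carrier H" shows "h ` pre S = S"
proof
  show "h ` pre S \<subseteq> S" by (auto simp: pre_def)
  show "S \<subseteq> h ` pre S"
  proof
    fix y assume y: "y \<in> S"
    then obtain x where "x \<in> carrier G" "h x = y" using assms memE by blast
    then show "y \<in> h ` pre S" using y by (auto simp: pre_def)
  qed
qed

lemma pre_mono: "S \<subseteq> Y \<Longrightarrow> pre S \<subseteq> pre Y" by (auto simp: pre_def)

lemma pre_carrier: "pre (carrier H) = carrier G" by (auto simp: pre_def)

lemma pre_one: "pre {\<one>\<^bsub>H\<^esub>} = ker" by (auto simp: pre_def kernel_def)

lemma subgroup_pre: assumes "subgroup S H" shows "subgroup (pre S) G"
  using assms by (intro G.subgroupI) (auto simp: pre_def subgroup_def)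

lemma ker_subset_pre: assumes "subgroup S H" shows "ker \<subseteq> pre S"
  using assms by (auto simp: pre_def kernel_def subgroup_def)

lemma normal_pre: assumes "S \<lhd> H" shows "pre S \<lhd> G"
proof (rule G.normal_invI)
  interpret S: normal S H by fact
  show "subgroup (pre S) G" by (rule subgroup_pre) (rule S.subgroup_axioms)
  show "x \<otimes> y \<otimes> inv x \<in> pre S" if "x \<in> carrier G" "y \<in> pre S" for x y
    using that S.inv_op_closed2[of "h x" "h y"] by (auto simp: pre_def)
qed

lemma normal_image: assumes "S \<lhd> G" shows "h ` S \<lhd> H"
  using normal.surj_hom_normal_subgroup[OF assms group_hom_axioms surj] .

lemma subgroup_image: assumes "subgroup S G" shows "subgroup (h ` S) H"
  using subgroup_img_is_subgroup[OF assms] .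

lemma pre_image:
  assumes "subgroup S G" "ker \<subseteq> S" shows "pre (h ` S) = S"
proof
  interpret S: subgroup S G by fact
  show "S \<subseteq> pre (h ` S)" by (auto simp: pre_def)
  show "pre (h ` S) \<subseteq> S"
  proof
    fix y assume "y \<in> pre (h ` S)"
    then obtain x where x: "x \<in> S" "h y = h x" "y \<in> carrier G" by (auto simp: pre_def)
    then have "y \<otimes> inv x \<in> ker" by (auto simp: kernel_def)
    then have "(y \<otimes> inv x) \<otimes> x \<in> S" using assms(2) x by blast
    then show "y \<in> S" using x by (simp add: G.m_assoc)
  qed
qed

lemma card_pre: assumes "subgroup S H" shows "card (pre S) = card S * card ker"
proof -
  interpret S: subgroup S H by fact
  have "card {x \<in> pre S. h x = y} = card ker" if y: "y \<in> h ` pre S" for y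
  proof -
    obtain x0 where x0: "x0 \<in> carrier G" "h x0 = y" "y \<in> S" using y by (auto simp: pre_def)
    have "bij_betw (\<lambda>k. k \<otimes> x0) ker {x \<in> pre S. h x = y}"
    proof (rule bij_betwI[where g = "\<lambda>x. x \<otimes> inv x0"])
      show "(\<lambda>k. k \<otimes> x0) \<in> ker \<rightarrow> {x \<in> pre S. h x = y}"
        using x0 by (auto simp: kernel_def pre_def)
      show "(\<lambda>x. x \<otimes> inv x0) \<in> {x \<in> pre S. h x = y} \<rightarrow> ker"
        using x0(1) by (auto simp: kernel_def pre_def simp flip: x0(2))
      show "k \<otimes> x0 \<otimes> inv x0 = k" if "k \<in> ker" for k
        using that x0(1) by (simp add: kernel_def G.m_assoc)
      show "x \<otimes> inv x0 \<otimes> x0 = x" if "x \<in> {x \<in> pre S. h x = y}" for x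
        using that x0(1) by (simp add: pre_def G.m_assoc)
    qed
    then show ?thesis by (rule bij_betw_same_card[symmetric])
  qed
  then have "card (pre S) = card (h ` pre S) * card ker"
    by (intro card_eq_mult_fibres finite_subset[OF pre_subset fin]) blast
  then show ?thesis by (simp add: image_pre S.subset)
qed

lemma card_eq_card_image: assumes "subgroup S G" "ker \<subseteq> S" shows "card S = card (h ` S) * card ker"
  using card_pre[OF subgroup_image[OF assms(1)]] unfolding pre_image[OF assms] .

lemma card_carrier: "card (carrier G) = card (carrier H) * card ker"
  using card_pre[OF H.subgroup_self] by (simp add: pre_carrier)

end

lemma (in group) epi_hom_Mod:
  assumes "N \<lhd> G" "finite (carrier G)"
  shows "epi_hom G (G Mod N) (\<lambda>x. N #> x)"
proof -
  interpret N: normal N G by fact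
  show ?thesis
    by (intro epi_hom.intro group_hom.intro group_hom_axioms.intro epi_hom_axioms.intro)
       (use assms N.factorgroup_is_group N.r_coset_hom_Mod in \<open>auto simp: carrier_FactGroup group_axioms\<close>)
qed

lemma (in group) kernel_Mod:
  assumes "N \<lhd> G"
  shows "kernel G (G Mod N) (\<lambda>x. N #> x) = N"
proof -
  interpret N: normal N G by fact
  show ?thesis
    using coset_join1[OF _ _ N.subgroup_axioms] coset_join2[OF _ N.subgroup_axioms]
    by (auto simp: kernel_def)
qed

section \<open>Actions of groups of prime power order\<close>

text \<open>The restriction to \<open>E\<close> is forced by \<open>BijGroup E\<close>, whose
  elements are extensional functions.\<close>

lemma (in group) group_actionI:
  assumes closed: "\<And>g x. g \<in> carrier G \<Longrightarrow> x \<in> E \<Longrightarrow> f g x \<in> E"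
    and mult: "\<And>g h x. g \<in> carrier G \<Longrightarrow> h \<in> carrier G \<Longrightarrow> x \<in> E \<Longrightarrow> f (g \<otimes> h) x = f g (f h x)"
    and one: "\<And>x. x \<in> E \<Longrightarrow> f \<one> x = x"
  shows "group_action G E (\<lambda>g. \<lambda>x\<in>E. f g x)"
proof -
  have inverse: "f (inv g) (f g x) = x" "f g (f (inv g) x) = x" if "g \<in> carrier G" "x \<in> E" for g x
    using that mult[of "inv g" g x] mult[of g "inv g" x] one by simp_all
  have bij: "(\<lambda>x\<in>E. f g x) \<in> Bij E" if g: "g \<in> carrier G" for g
  proof -
    have "bij_betw (\<lambda>x\<in>E. f g x) E E"
      by (rule bij_betwI[where g = "f (inv g)"]) (use g inverse closed in auto)
    then show ?thesis by (simp add: Bij_def)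
  qed
  have "(\<lambda>x\<in>E. f (g \<otimes> h) x) = compose E (\<lambda>x\<in>E. f g x) (\<lambda>x\<in>E. f h x)"
    if "g \<in> carrier G" "h \<in> carrier G" for g h
    using that mult closed by (auto simp: compose_def fun_eq_iff)
  then have "(\<lambda>g. \<lambda>x\<in>E. f g x) \<in> hom G (BijGroup E)"
    using bij by (auto simp: hom_def BijGroup_def)
  then show ?thesis
    by (intro group_action.intro group_hom.intro group_hom_axioms.intro)
       (auto simp: group_BijGroup group_axioms)
qed

text \<open>An orbit containing a fixed point is a singleton and contributes nothing; any other
  orbit has a size that divides \<open>p ^ a\<close> and is not 1. Counting the moved points avoids
  a congruence between the numbers of points and of fixed points.\<close>

lemma (in group_action) prime_dvd_card_moved_points:
  assumes "Factorial_Ring.prime p" "order G = p ^ a" "finite E"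
  shows "p dvd card {x \<in> E. \<exists>g\<in>carrier G. \<phi> g x \<noteq> x}"
proof -
  interpret group_hom G "BijGroup E" \<phi> by (rule group_hom)
  \<comment> \<open>The indicator function of the moved points, to be summed orbit by orbit.\<close>
  let ?f = "\<lambda>x. if \<exists>g\<in>carrier G. \<phi> g x \<noteq> x then 1 else 0 :: nat"
  have "p dvd (\<Sum>x\<in>orb. ?f x)" if orb: "orb \<in> orbits G E \<phi>" for orb
  proof -
    obtain y where y: "y \<in> E" "orb = orbit G \<phi> y" using orb by (auto simp: orbits_def)
    have y_orb: "y \<in> orb" using orbit_refl y by simp
    show ?thesis
    proof (cases "\<exists>x\<in>orb. \<forall>g\<in>carrier G. \<phi> g x = x")
      case True
      then obtain x where x: "x \<in> orb" "\<forall>g\<in>carrier G. \<phi> g x = x" by blast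
      have "x \<in> E" using x(1) y element_image by (auto simp: orbit_def)
      then have "y \<in> orbit G \<phi> x" using orbit_sym[of y x] x(1) y by simp
      then have "y = x" using x(2) by (auto simp: orbit_def)
      then have "orb \<subseteq> {x}" using x(2) y(2) by (auto simp: orbit_def)
      then have "orb = {x}" using x(1) by auto
      then show ?thesis using x(2) by simp
    next
      case False
      then have "(\<Sum>x\<in>orb. ?f x) = (\<Sum>x\<in>orb. 1)" by (intro sum.cong) auto
      then have *: "(\<Sum>x\<in>orb. ?f x) = card orb" by simp
      have "card orb dvd p ^ a"
        using orbit_stabilizer_theorem[OF y(1)] y(2) assms(2) by (metis dvd_triv_left)
      moreover have "card orb \<noteq> 1"
      proof
        assume "card orb = 1"
        then obtain z where "orb = {z}" by (auto simp: card_1_singleton_iff)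
        with y_orb have "orb = {y}" by simp
        then have "\<forall>g\<in>carrier G. \<phi> g y = y" using y(2) by (auto simp: orbit_def)
        then show False using False y_orb by blast
      qed
      ultimately show ?thesis using assms(1) prime_power_dvd_cases * by simp
    qed
  qed
  then have "p dvd (\<Sum>orb\<in>orbits G E \<phi>. \<Sum>x\<in>orb. ?f x)" by (rule dvd_sum)
  also have "\<dots> = (\<Sum>x\<in>E. ?f x)" by (rule disjoint_sum[OF assms(3)])
  also have "\<dots> = card {x \<in> E. \<exists>g\<in>carrier G. \<phi> g x \<noteq> x}"
    using card_as_sums[OF refl assms(3), of "\<lambda>x. \<exists>g\<in>carrier G. \<phi> g x \<noteq> x"] by simp
  finally show ?thesis .
qed

context group
begin

lemma card_fixed_rcosets:
  assumes p: "Factorial_Ring.prime p" and fin: "finite (carrier G)"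
    and A: "subgroup A G" "card A = p ^ a" and B: "subgroup B G"
  shows "p dvd card {R \<in> rcosets B. \<exists>g\<in>A. R #> g \<noteq> R}"
proof -
  interpret A: subgroup A G by fact
  interpret B: subgroup B G by fact
  interpret GA: group "G\<lparr>carrier := A\<rparr>" by (simp add: A(1) subgroup_imp_group)
  \<comment> \<open>Right multiplication acts from the right; the inverse turns it into a left
    action. Since \<open>A\<close> is closed under inverses, the moved cosets are the same.\<close>
  let ?f = "\<lambda>g R. R #> inv\<^bsub>G\<lparr>carrier := A\<rparr>\<^esub> g"
  have inv_A: "inv\<^bsub>G\<lparr>carrier := A\<rparr>\<^esub> g = inv g" if "g \<in> A" for g
    using m_inv_consistent[OF A(1) that] .
  have sub: "R \<subseteq> carrier G" if "R \<in> rcosets B" for R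
    using that B.rcosets_carrier group_axioms by blast
  have closed: "R #> g \<in> rcosets B" if R: "R \<in> rcosets B" "g \<in> A" for R g
  proof -
    obtain x where "x \<in> carrier G" "R = B #> x" using R(1) by (auto simp: RCOSETS_def)
    then show ?thesis using R(2) by (auto simp: RCOSETS_def coset_mult_assoc B.subset)
  qed
  interpret act: group_action "G\<lparr>carrier := A\<rparr>" "rcosets B" "\<lambda>g. \<lambda>R\<in>rcosets B. ?f g R"
  proof (rule GA.group_actionI)
    show "?f g R \<in> rcosets B" if "g \<in> carrier (G\<lparr>carrier := A\<rparr>)" "R \<in> rcosets B" for g R
      using that closed by (simp add: inv_A)
    show "?f (g \<otimes>\<^bsub>G\<lparr>carrier := A\<rparr>\<^esub> h) R = ?f g (?f h R)"
      if "g \<in> carrier (G\<lparr>carrier := A\<rparr>)" "h \<in> carrier (G\<lparr>carrier := A\<rparr>)" "R \<in> rcosets B" for g h R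
      using that sub by (simp add: inv_A inv_mult_group coset_mult_assoc)
    show "?f \<one>\<^bsub>G\<lparr>carrier := A\<rparr>\<^esub> R = R" if "R \<in> rcosets B" for R
      using sub[OF that] by (simp add: inv_A)
  qed
  have finE: "finite (rcosets B)" using fin by (simp add: RCOSETS_def)
  have "{R \<in> rcosets B. \<exists>g\<in>carrier (G\<lparr>carrier := A\<rparr>). (\<lambda>R\<in>rcosets B. ?f g R) R \<noteq> R}
      = {R \<in> rcosets B. \<exists>g\<in>A. R #> g \<noteq> R}"
  proof (intro Collect_cong conj_cong refl)
    fix R assume R: "R \<in> rcosets B"
    have "(\<exists>g\<in>A. R #> inv g \<noteq> R) \<longleftrightarrow> (\<exists>g\<in>A. R #> g \<noteq> R)"
      by (metis A.m_inv_closed A.mem_carrier inv_inv)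
    then show "(\<exists>g\<in>carrier (G\<lparr>carrier := A\<rparr>). (\<lambda>R\<in>rcosets B. ?f g R) R \<noteq> R) \<longleftrightarrow> (\<exists>g\<in>A. R #> g \<noteq> R)"
      using R by (simp add: inv_A)
  qed
  then show ?thesis
    using act.prime_dvd_card_moved_points[OF p _ finE, of a] A(2) by (simp add: order_def)
qed

text \<open>The link between fixed cosets and conjugation into \<open>B\<close>, on which
  \<open>sylow_conjugate\<close> and \<open>normalizer_grows\<close> rest.\<close>

lemma rcoset_fixed_iff:
  assumes "subgroup B G" "y \<in> carrier G" "g \<in> carrier G"
  shows "(B #> y) #> g = B #> y \<longleftrightarrow> y \<otimes> g \<otimes> inv y \<in> B"
proof -
  interpret B: subgroup B G by fact
  have "(B #> y) #> g = B #> (y \<otimes> g)" using assms B.subset coset_mult_assoc by simp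
  moreover have "B #> (y \<otimes> g) = B #> y \<longleftrightarrow> y \<otimes> g \<in> B #> y"
    using assms by (metis m_closed rcos_self repr_independence)
  moreover have "y \<otimes> g \<in> B #> y \<longleftrightarrow> y \<otimes> g \<otimes> inv y \<in> B"
    using assms B.rcos_module group_axioms by simp
  ultimately show ?thesis by simp
qed

text \<open>\<open>A\<close> acts on the cosets of \<open>B\<close>, whose number is prime to
  \<open>p\<close>, so some coset \<open>B #> y\<close> is fixed; its representative conjugates
  \<open>A\<close> into \<open>B\<close>.\<close>

lemma sylow_conjugate:
  assumes p: "Factorial_Ring.prime p" and fin: "finite (carrier G)"
    and A: "subgroup A G" "card A = p ^ a"
    and B: "subgroup B G" "\<not> p dvd card (carrier G) div card B"
  shows "\<exists>y\<in>carrier G. \<forall>g\<in>A. y \<otimes> g \<otimes> inv y \<in> B"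
proof -
  have "card (rcosets B) * card B = card (carrier G)"
    using lagrange[OF B(1)] by (simp add: order_def)
  then have "card (carrier G) div card B = card (rcosets B)"
    using card_subgroup_pos[OF fin B(1)] by (metis nonzero_mult_div_cancel_right less_numeral_extra(3))
  then have "{R \<in> rcosets B. \<exists>g\<in>A. R #> g \<noteq> R} \<noteq> rcosets B"
    using card_fixed_rcosets[OF p fin A B(1)] B(2) by auto
  then obtain R where R: "R \<in> rcosets B" "\<forall>g\<in>A. R #> g = R" by blast
  then obtain y where y: "y \<in> carrier G" "R = B #> y" by (auto simp: RCOSETS_def)
  have "y \<otimes> g \<otimes> inv y \<in> B" if "g \<in> A" for g
    using rcoset_fixed_iff[OF B(1) y(1), of g] R(2) y(2) that subgroup.mem_carrier[OF A(1)] by simp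
  then show ?thesis using y(1) by blast
qed

text \<open>\<open>D\<close> acts on its own cosets. The number of fixed cosets is divisible by
  \<open>p\<close>, and \<open>D\<close> itself is one of them, so there is a second one; it
  consists of elements outside \<open>D\<close> that normalize \<open>D\<close>.\<close>

lemma normalizer_grows:
  assumes p: "Factorial_Ring.prime p" and fin: "finite (carrier G)"
    and card: "card (carrier G) = p ^ a" and D: "subgroup D G" "D \<noteq> carrier G"
  shows "\<exists>y\<in>carrier G - D. \<forall>g\<in>D. y \<otimes> g \<otimes> inv y \<in> D"
proof -
  interpret D: subgroup D G by fact
  have idx: "card (rcosets D) * card D = p ^ a"
    using lagrange[OF D(1)] card by (simp add: order_def)
  have "card (rcosets D) \<noteq> 1"
  proof
    assume "card (rcosets D) = 1"
    then show False
      using idx card D(2) subgroup_eqI_card[OF fin subgroup_self D.subset] by simp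
  qed
  then have p_dvd: "p dvd card (rcosets D)"
    using prime_power_dvd_cases[OF p] idx by (metis dvd_triv_left)
  obtain d where "card D = p ^ d"
    using idx divides_primepow_nat[OF p] by (metis dvd_triv_right)
  let ?M = "{R \<in> rcosets D. \<exists>g\<in>D. R #> g \<noteq> R}"
  have "p dvd card ?M" by (rule card_fixed_rcosets[OF p fin D(1) _ D(1)]) fact
  moreover have finR: "finite (rcosets D)" using fin by (simp add: RCOSETS_def)
  then have "card (rcosets D - ?M) = card (rcosets D) - card ?M"
    by (intro card_Diff_subset) auto
  ultimately have "p dvd card (rcosets D - ?M)" using p_dvd by simp
  then have "card (rcosets D - ?M) \<noteq> 1" using p by (auto simp: prime_nat_iff)
  moreover have "D \<in> rcosets D - ?M"
    using D.subgroup_in_rcosets[OF group_axioms] D.rcos_const[OF group_axioms] by auto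
  moreover from this have "rcosets D - ?M \<noteq> {D}" using \<open>card (rcosets D - ?M) \<noteq> 1\<close> by auto
  ultimately obtain R where R: "R \<in> rcosets D - ?M" "R \<noteq> D" by blast
  then obtain y where y: "y \<in> carrier G" "R = D #> y" by (auto simp: RCOSETS_def)
  have "y \<notin> D" using y R(2) coset_join2[OF y(1) D(1)] by auto
  moreover have "y \<otimes> g \<otimes> inv y \<in> D" if "g \<in> D" for g
    using rcoset_fixed_iff[OF D(1) y(1), of g] R(1) y(2) that by auto
  ultimately show ?thesis using y(1) by blast
qed

lemma cauchy:
  assumes p: "Factorial_Ring.prime p" and fin: "finite (carrier G)" and "p dvd card (carrier G)"
  shows "\<exists>x\<in>carrier G. x \<noteq> \<one> \<and> x [^] p = \<one>"
proof -
  obtain m where "order G = p ^ 1 * m" using assms(3) by (auto simp: order_def)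
  then obtain A where A: "subgroup A G" "card A = p ^ 1"
    using sylow_thm[OF p group_axioms _ fin] by blast
  have "A \<noteq> {\<one>}" using A(2) p by (auto simp: prime_nat_iff)
  then obtain x where "x \<in> A" "x \<noteq> \<one>" using subgroup.one_closed[OF A(1)] by blast
  then show ?thesis
    using pow_card_eq_one[OF A(1), of x] A(2) subgroup.mem_carrier[OF A(1)] by auto
qed

text \<open>Some conjugate of \<open>N\<close> lies in \<open>Q\<close>, and by normality that
  conjugate is \<open>N\<close>.\<close>

lemma sylow_normalI:
  assumes p: "Factorial_Ring.prime p" and fin: "finite (carrier G)"
    and N: "N \<lhd> G" "card N = p ^ a"
    and Q: "subgroup Q G" "\<not> p dvd card (carrier G) div card Q"
  shows "N \<subseteq> Q"
proof
  interpret N: normal N G by fact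
  obtain y where y: "y \<in> carrier G" "\<forall>g\<in>N. y \<otimes> g \<otimes> inv y \<in> Q"
    using sylow_conjugate[OF p fin N.subgroup_axioms N(2) Q] by blast
  fix x assume x: "x \<in> N"
  then have "inv y \<otimes> x \<otimes> y \<in> N" using N.inv_op_closed1 y(1) by simp
  then have "y \<otimes> (inv y \<otimes> x \<otimes> y) \<otimes> inv y \<in> Q" using y by blast
  then show "x \<in> Q" using x y(1) by (simp add: m_assoc)
qed

section \<open>Normalizers, conjugates and the Frattini argument\<close>

definition normer :: "'a set \<Rightarrow> 'a set"
  where "normer R = {g \<in> carrier G. \<forall>x\<in>R. g \<otimes> x \<otimes> inv g \<in> R}"

text \<open>\<open>normer\<close> asks only that conjugation maps \<open>R\<close> into itself,
  which is the easier condition to verify. Finiteness turns this injective map into a bijection of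
  \<open>R\<close>, and so inverses normalize as well.\<close>

lemma subgroup_normer:
  assumes "finite (carrier G)" "subgroup R G"
  shows "subgroup (normer R) G"
proof (rule subgroupI)
  interpret R: subgroup R G by fact
  show "normer R \<subseteq> carrier G" by (auto simp: normer_def)
  have "\<one> \<in> normer R" by (auto simp: normer_def)
  then show "normer R \<noteq> {}" by blast
  show "g \<otimes> h \<in> normer R" if "g \<in> normer R" "h \<in> normer R" for g h
    using that by (auto simp: normer_def conj_conj)
  show "inv g \<in> normer R" if "g \<in> normer R" for g
  proof -
    have g: "g \<in> carrier G" "\<forall>x\<in>R. g \<otimes> x \<otimes> inv g \<in> R" using that by (auto simp: normer_def)
    have "inj_on (\<lambda>x. g \<otimes> x \<otimes> inv g) R" using g(1) by (auto simp: inj_on_def)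
    moreover have "(\<lambda>x. g \<otimes> x \<otimes> inv g) ` R \<subseteq> R" using g(2) by blast
    ultimately have "(\<lambda>x. g \<otimes> x \<otimes> inv g) ` R = R"
      using endo_inj_surj finite_subgroup[OF assms] by blast
    have "inv g \<otimes> x \<otimes> g \<in> R" if "x \<in> R" for x
    proof -
      have "x \<in> (\<lambda>x. g \<otimes> x \<otimes> inv g) ` R" using that \<open>(\<lambda>x. g \<otimes> x \<otimes> inv g) ` R = R\<close> by simp
      then obtain z where z: "z \<in> R" "x = g \<otimes> z \<otimes> inv g" by blast
      then have "inv g \<otimes> x \<otimes> g = z" using g(1) by (simp add: m_assoc)
      then show ?thesis using z(1) by simp
    qed
    then show ?thesis using g(1) by (simp add: normer_def)
  qed
qed

lemma subset_normer:
  assumes "subgroup R G" shows "R \<subseteq> normer R"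
  using assms by (auto simp: normer_def subgroup.m_closed subgroup.m_inv_closed subgroup.mem_carrier)

lemma normer_eq_carrier: "subgroup R G \<Longrightarrow> normer R = carrier G \<Longrightarrow> R \<lhd> G"
  by (rule normal_invI) (auto simp: normer_def)

definition conjugate :: "'a \<Rightarrow> 'a set \<Rightarrow> 'a set"
  where "conjugate g R = (\<lambda>x. g \<otimes> x \<otimes> inv g) ` R"

lemma mem_conjugate_iff:
  assumes "R \<subseteq> carrier G" "g \<in> carrier G"
  shows "x \<in> conjugate g R \<longleftrightarrow> x \<in> carrier G \<and> inv g \<otimes> x \<otimes> g \<in> R"
proof
  assume "x \<in> conjugate g R"
  then obtain y where "y \<in> R" "x = g \<otimes> y \<otimes> inv g" by (auto simp: conjugate_def)
  then show "x \<in> carrier G \<and> inv g \<otimes> x \<otimes> g \<in> R" using assms by (auto simp: m_assoc subsetD)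
next
  assume x: "x \<in> carrier G \<and> inv g \<otimes> x \<otimes> g \<in> R"
  have "x = g \<otimes> (inv g \<otimes> x \<otimes> g) \<otimes> inv g" using x assms by (simp add: m_assoc)
  then show "x \<in> conjugate g R" using x by (auto simp: conjugate_def)
qed

lemma card_conjugate:
  assumes "R \<subseteq> carrier G" "g \<in> carrier G"
  shows "card (conjugate g R) = card R"
  unfolding conjugate_def using assms by (intro card_image) (auto simp: inj_on_def subsetD)

lemma subgroup_conjugate:
  assumes "subgroup R G" "g \<in> carrier G"
  shows "subgroup (conjugate g R) G"
proof (rule subgroupI)
  interpret R: subgroup R G by fact
  show "conjugate g R \<subseteq> carrier G" using assms by (auto simp: conjugate_def)
  show "conjugate g R \<noteq> {}" using R.one_closed unfolding conjugate_def by blast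
  show "inv z \<in> conjugate g R" if "z \<in> conjugate g R" for z
    using that assms by (auto simp: conjugate_def simp flip: conj_inv)
  show "z \<otimes> w \<in> conjugate g R" if "z \<in> conjugate g R" "w \<in> conjugate g R" for z w
    using that assms by (auto simp: conjugate_def simp flip: conj_mult)
qed

text \<open>The conjugate of \<open>R\<close> by \<open>g\<close> still lies in the normal subgroup
  \<open>Y\<close>, where Sylow's theorem brings it back into \<open>R\<close> by some
  \<open>y\<close> in \<open>Y\<close>. Then \<open>y \<otimes> g\<close> normalizes
  \<open>R\<close>.\<close>

lemma frattini:
  assumes r: "Factorial_Ring.prime r" and fin: "finite (carrier G)" and Y: "Y \<lhd> G"
    and R: "subgroup R G" "R \<subseteq> Y" "card R = r ^ a" "\<not> r dvd card Y div card R"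
    and g: "g \<in> carrier G"
  shows "\<exists>y\<in>Y. \<exists>t\<in>normer R. g = y \<otimes> t"
proof -
  interpret Y: normal Y G by fact
  interpret R: subgroup R G by fact
  interpret GY: group "G\<lparr>carrier := Y\<rparr>" using Y.subgroup_axioms by (rule subgroup_imp_group)
  let ?A = "conjugate g R"
  have A: "subgroup ?A G" by (rule subgroup_conjugate[OF R(1) g])
  have AY: "?A \<subseteq> Y" using R(2) Y.inv_op_closed2[OF g] by (auto simp: conjugate_def)
  have finY: "finite (carrier (G\<lparr>carrier := Y\<rparr>))" using finite_subgroup[OF fin Y.subgroup_axioms] by simp
  have "\<exists>y\<in>carrier (G\<lparr>carrier := Y\<rparr>). \<forall>x\<in>?A.
      y \<otimes>\<^bsub>G\<lparr>carrier := Y\<rparr>\<^esub> x \<otimes>\<^bsub>G\<lparr>carrier := Y\<rparr>\<^esub> inv\<^bsub>G\<lparr>carrier := Y\<rparr>\<^esub> y \<in> R"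
  proof (rule GY.sylow_conjugate[OF r finY])
    show "subgroup ?A (G\<lparr>carrier := Y\<rparr>)" using subgroup_incl[OF A Y.subgroup_axioms AY] .
    show "subgroup R (G\<lparr>carrier := Y\<rparr>)" using subgroup_incl[OF R(1) Y.subgroup_axioms R(2)] .
    show "card ?A = r ^ a" using R(3) card_conjugate[OF R.subset g] by simp
    show "\<not> r dvd card (carrier (G\<lparr>carrier := Y\<rparr>)) div card R" using R(4) by simp
  qed
  then obtain y where y: "y \<in> Y" "\<forall>x\<in>?A. y \<otimes> x \<otimes> inv y \<in> R"
    using m_inv_consistent[OF Y.subgroup_axioms] by auto
  have "y \<otimes> g \<in> normer R"
    using y g by (auto simp: normer_def conj_conj conjugate_def)
  moreover have "g = inv y \<otimes> (y \<otimes> g)" using y(1) g by simp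
  ultimately show ?thesis using y(1) by (metis Y.m_inv_closed)
qed

lemma maximal_above:
  assumes fin: "finite (carrier G)" and T: "subgroup T G" "T \<noteq> carrier G"
  shows "\<exists>M. maximal_subgroup M G \<and> T \<subseteq> M"
proof -
  let ?P = "\<lambda>M. subgroup M G \<and> M \<noteq> carrier G \<and> T \<subseteq> M"
  have "\<exists>M. ?P M \<and> (\<forall>L. ?P L \<longrightarrow> card L \<le> card M)"
    by (rule ex_has_greatest_nat[where b = "Suc (card (carrier G))" and k = T])
       (use T in \<open>auto intro!: le_imp_less_Suc card_mono[OF fin] dest: subgroup.subset\<close>)
  then obtain M where M: "?P M" "\<And>L. ?P L \<Longrightarrow> card L \<le> card M" by blast
  have "maximal_subgroup M G"
    unfolding maximal_subgroup_def
  proof (intro conjI allI impI)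
    fix L assume L: "subgroup L G \<and> M \<subseteq> L"
    show "L = M \<or> L = carrier G"
    proof (rule disjCI)
      assume "L \<noteq> carrier G"
      then have "card L \<le> card M" using M L by blast
      then show "L = M" using subgroup_eqI_card[OF fin] L by blast
    qed
  qed (use M(1) in auto)
  then show ?thesis using M(1) by blast
qed

text \<open>A maximal subgroup above a proper normalizer of \<open>R\<close> would contain
  \<open>G = Y N\<^sub>G(R) = N N\<^sub>G(R)\<close>.\<close>
lemma frattini_normal:
  assumes r: "Factorial_Ring.prime r" and fin: "finite (carrier G)" and Y: "Y \<lhd> G"
    and R: "subgroup R G" "R \<subseteq> Y" "card R = r ^ a" "\<not> r dvd card Y div card R"
    and N: "Y \<subseteq> N <#> R" "\<And>M. maximal_subgroup M G \<Longrightarrow> N \<subseteq> M"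
  shows "R \<lhd> G"
proof (rule normer_eq_carrier[OF R(1)], rule ccontr)
  assume "normer R \<noteq> carrier G"
  then obtain M where M: "maximal_subgroup M G" "normer R \<subseteq> M"
    using maximal_above[OF fin subgroup_normer[OF fin R(1)]] by blast
  then interpret M: subgroup M G by (simp add: maximal_subgroup_def)
  have "carrier G \<subseteq> M"
  proof
    fix g assume "g \<in> carrier G"
    then obtain y t where yt: "y \<in> Y" "t \<in> normer R" "g = y \<otimes> t"
      using frattini[OF r fin Y R] by blast
    moreover obtain n x where "n \<in> N" "x \<in> R" "y = n \<otimes> x" using N(1) yt(1) by (auto simp: set_mult_def)
    moreover have "x \<in> M" using \<open>x \<in> R\<close> subset_normer[OF R(1)] M(2) by blast
    ultimately show "g \<in> M" using N(2)[OF M(1)] M(2) by auto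
  qed
  then show False using M(1) M.subset by (auto simp: maximal_subgroup_def)
qed

section \<open>The core of a subgroup, and normal subgroups of prime order\<close>

lemma core_eq:
  assumes "subgroup H G"
  shows "core G H = {x \<in> carrier G. \<forall>g\<in>carrier G. g \<otimes> x \<otimes> inv g \<in> H}"
proof -
  interpret H: subgroup H G by fact
  have *: "x \<in> g <# H #> inv g \<longleftrightarrow> x \<in> carrier G \<and> inv g \<otimes> x \<otimes> g \<in> H" if g: "g \<in> carrier G" for g x
  proof
    assume "x \<in> g <# H #> inv g"
    then obtain y where "y \<in> H" "x = g \<otimes> y \<otimes> inv g" by (auto simp: l_coset_def r_coset_def)
    then show "x \<in> carrier G \<and> inv g \<otimes> x \<otimes> g \<in> H" using g by (simp add: m_assoc)
  next
    assume x: "x \<in> carrier G \<and> inv g \<otimes> x \<otimes> g \<in> H"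
    have "x = g \<otimes> (inv g \<otimes> x \<otimes> g) \<otimes> inv g" using x g by (simp add: m_assoc)
    then show "x \<in> g <# H #> inv g" using x by (auto simp: l_coset_def r_coset_def)
  qed
  have "x \<in> core G H \<longleftrightarrow> x \<in> carrier G \<and> (\<forall>g\<in>carrier G. g \<otimes> x \<otimes> inv g \<in> H)" for x
  proof -
    have "x \<in> core G H \<longleftrightarrow> (\<forall>g\<in>carrier G. x \<in> carrier G \<and> inv g \<otimes> x \<otimes> g \<in> H)"
      by (simp add: core_def *)
    \<comment> \<open>The index set contains \<open>\<one>\<close>, so
      \<open>x \<in> carrier G\<close> can leave the quantifier; replacing \<open>g\<close> by
      \<open>inv g\<close> changes the side of the inverse.\<close>
    also have "\<dots> \<longleftrightarrow> x \<in> carrier G \<and> (\<forall>g\<in>carrier G. g \<otimes> x \<otimes> inv g \<in> H)"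
      using one_closed by (metis inv_closed inv_inv)
    finally show ?thesis .
  qed
  then show ?thesis by blast
qed

lemma core_subset: "subgroup H G \<Longrightarrow> core G H \<subseteq> H"
proof
  fix x assume "subgroup H G" "x \<in> core G H"
  then have x: "x \<in> carrier G" "\<forall>g\<in>carrier G. g \<otimes> x \<otimes> inv g \<in> H" by (auto simp: core_eq)
  then have "\<one> \<otimes> x \<otimes> inv \<one> \<in> H" by blast
  then show "x \<in> H" using x(1) by simp
qed

lemma normal_core:
  assumes "subgroup H G" shows "core G H \<lhd> G"
proof (rule normal_invI)
  interpret H: subgroup H G by fact
  show "subgroup (core G H) G"
    unfolding core_eq[OF assms]
  proof (rule subgroupI)
    show "{x \<in> carrier G. \<forall>g\<in>carrier G. g \<otimes> x \<otimes> inv g \<in> H} \<noteq> {}" by (auto intro: exI[of _ \<one>])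
  qed (auto simp: conj_inv conj_mult)
  show "x \<otimes> y \<otimes> inv x \<in> core G H" if "x \<in> carrier G" "y \<in> core G H" for x y
    using that by (auto simp: core_eq[OF assms] conj_conj[symmetric])
qed

lemma core_greatest:
  assumes "subgroup H G" "N \<lhd> G" "N \<subseteq> H" shows "N \<subseteq> core G H"
  using assms normal.inv_op_closed2[OF assms(2)] subgroup.subset[OF normal_imp_subgroup[OF assms(2)]]
  by (auto simp: core_eq[OF assms(1)])

text \<open>A variant of Sylow counting: the conjugates of the Sylow \<open>q\<close>-subgroup \<open>Q\<close> either intersect
  trivially, and then leave room for only one subgroup of order \<open>p\<close>, or a maximal intersection of
  two of them is contained in all of them.\<close>
lemma normal_subgroup_of_order_prime:
  assumes fin: "finite (carrier G)" and p: "Factorial_Ring.prime p" and q: "Factorial_Ring.prime q"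
    and pq: "p \<noteq> q" and card: "card (carrier G) = p * q ^ n" and n: "1 \<le> n"
    and Q: "subgroup Q G" "card Q = q ^ n" and corefree: "core G Q = {\<one>}"
  shows "\<exists>P. P \<lhd> G \<and> card P = p"
proof -
  interpret Q: subgroup Q G by fact
  have Qc: "Q \<subseteq> carrier G" by (rule Q.subset)
  have q0: "q ^ n > 0" using q prime_gt_0_nat by simp
  have cop: "coprime p (q ^ n)" using primes_coprime[OF p q pq] by simp
  let ?C = "\<lambda>g. conjugate g Q"
  have C: "subgroup (?C g) G" "card (?C g) = q ^ n" if "g \<in> carrier G" for g
    using that subgroup_conjugate Q card_conjugate[OF Qc] by auto
  have idx: "\<not> q dvd card (carrier G) div card Q"
  proof -
    have "card (carrier G) div card Q = p" using card Q(2) q0 by simp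
    then show ?thesis using primes_dvd_imp_eq[OF q p] pq by auto
  qed
  show ?thesis
  proof (cases "\<exists>g\<in>carrier G. \<exists>h\<in>carrier G. ?C g \<noteq> ?C h \<and> ?C g \<inter> ?C h \<noteq> {\<one>}")
    case True
    let ?P = "\<lambda>(g, h). g \<in> carrier G \<and> h \<in> carrier G \<and> ?C g \<noteq> ?C h"
    obtain g0 h0 where gh0: "?P (g0, h0)" "?C g0 \<inter> ?C h0 \<noteq> {\<one>}" using True by auto
    have finC: "finite (?C g)" if "g \<in> carrier G" for g using finite_subgroup[OF fin] C that by blast
    have "\<exists>z. ?P z \<and> (\<forall>w. ?P w \<longrightarrow> card (?C (fst w) \<inter> ?C (snd w)) \<le> card (?C (fst z) \<inter> ?C (snd z)))"
    proof (rule ex_has_greatest_nat[of ?P _ _ "Suc (q ^ n)"])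
      show "?P (g0, h0)" by (rule gh0(1))
      show "\<forall>y. ?P y \<longrightarrow> card (?C (fst y) \<inter> ?C (snd y)) < Suc (q ^ n)"
      proof (intro allI impI)
        fix y assume "?P y"
        then have "card (?C (fst y) \<inter> ?C (snd y)) \<le> card (?C (fst y))"
          by (intro card_mono finC) auto
        then show "card (?C (fst y) \<inter> ?C (snd y)) < Suc (q ^ n)" using C(2)[of "fst y"] \<open>?P y\<close> by auto
      qed
    qed
    then obtain z where z: "?P z"
      "\<And>w. ?P w \<Longrightarrow> card (?C (fst w) \<inter> ?C (snd w)) \<le> card (?C (fst z) \<inter> ?C (snd z))" by blast
    define g h where "g = fst z" and "h = snd z"
    have gh: "g \<in> carrier G" "h \<in> carrier G" "?C g \<noteq> ?C h"
      using z(1) by (simp_all add: g_def h_def split_beta)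
    \<comment> \<open>Among the intersections of two distinct conjugates of \<open>Q\<close>, that
      of \<open>?C g\<close> and \<open>?C h\<close> has the largest order.\<close>
    have max: "card (?C g' \<inter> ?C h') \<le> card (?C g \<inter> ?C h)" if "?P (g', h')" for g' h'
      using z(2)[OF that] by (simp add: g_def h_def)
    define D where "D = ?C g \<inter> ?C h"
    have D: "subgroup D G" unfolding D_def using C gh subgroups_Inter_pair by blast
    interpret D: subgroup D G by fact
    have sg0: "subgroup (?C g0 \<inter> ?C h0) G" using C gh0(1) subgroups_Inter_pair by simp
    have "card (?C g0 \<inter> ?C h0) \<noteq> 1" using card_eq_one_iff[OF sg0] gh0(2) by simp
    moreover have "card (?C g0 \<inter> ?C h0) > 0" by (rule card_subgroup_pos[OF fin sg0])
    ultimately have D1: "D \<noteq> {\<one>}" using max[OF gh0(1)] by (auto simp: D_def)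
    \<comment> \<open>\<open>?C a\<close> is a \<open>q\<close>-group with \<open>D\<close> as a
      proper subgroup, so it contains an element outside \<open>D\<close> that normalizes
      \<open>D\<close>.\<close>
    have grow: "\<exists>y \<in> ?C a - D. y \<in> normer D"
      if ab: "a \<in> carrier G" "b \<in> carrier G" "?C a \<noteq> ?C b" "D = ?C a \<inter> ?C b" for a b
    proof -
      interpret A: group "G\<lparr>carrier := ?C a\<rparr>" using C ab subgroup_imp_group by blast
      have "D \<noteq> ?C a"
      proof
        assume "D = ?C a"
        then have "?C a \<subseteq> ?C b" using ab(4) by blast
        then have "?C a = ?C b" using subgroup_eqI_card[OF fin C(1)[OF ab(2)]] C(2) ab(1,2) by simp
        then show False using ab(3) by simp
      qed
      then have "\<exists>y\<in>carrier (G\<lparr>carrier := ?C a\<rparr>) - D. \<forall>x\<in>D. y \<otimes>\<^bsub>G\<lparr>carrier := ?C a\<rparr>\<^esub> x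
          \<otimes>\<^bsub>G\<lparr>carrier := ?C a\<rparr>\<^esub> inv\<^bsub>G\<lparr>carrier := ?C a\<rparr>\<^esub> y \<in> D"
        using ab C finC D subgroup_incl[OF D C(1)[OF ab(1)]]
        by (intro A.normalizer_grows[OF q, of n]) auto
      then obtain y where "y \<in> ?C a - D" "\<forall>x\<in>D. y \<otimes> x \<otimes> inv y \<in> D"
        using m_inv_consistent[OF C(1)[OF ab(1)]] by auto
      then show ?thesis using subgroup.mem_carrier[OF C(1)[OF ab(1)]] by (auto simp: normer_def)
    qed
    have N: "subgroup (normer D) G" using subgroup_normer[OF fin D] .
    \<comment> \<open>Otherwise the normalizer of \<open>D\<close> is a \<open>q\<close>-group and
      lies in one conjugate of \<open>Q\<close>. That conjugate meets \<open>?C g\<close> and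
      \<open>?C h\<close> in more than \<open>D\<close>, so by the choice of \<open>D\<close> it
      equals both of them.\<close>
    have "p dvd card (normer D)"
    proof (rule ccontr)
      assume "\<not> p dvd card (normer D)"
      then have "coprime (card (normer D)) p" using p prime_imp_coprime coprime_commute by blast
      moreover have "card (normer D) dvd p * q ^ n"
        using card_subgroup_dvd[OF N subgroup_self] card subgroup.subset[OF N] by simp
      ultimately have "card (normer D) dvd q ^ n" using coprime_dvd_mult_right_iff by blast
      then obtain j where "card (normer D) = q ^ j" using divides_primepow_nat[OF q] by blast
      then obtain y where y: "y \<in> carrier G" "\<forall>x\<in>normer D. y \<otimes> x \<otimes> inv y \<in> Q"
        using sylow_conjugate[OF q fin N _ Q(1) idx] by blast
      then have sub: "normer D \<subseteq> ?C (inv y)"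
        using subgroup.subset[OF N] by (auto simp: mem_conjugate_iff[OF Qc])
      have "?C (inv y) = ?C a"
        if ab: "a \<in> carrier G" "b \<in> carrier G" "?C a \<noteq> ?C b" "D = ?C a \<inter> ?C b" for a b
      proof (rule ccontr)
        assume "?C (inv y) \<noteq> ?C a"
        then have le: "card (?C (inv y) \<inter> ?C a) \<le> card D" using max[of "inv y" a] y ab by (simp add: D_def)
        obtain z where z: "z \<in> ?C a - D" "z \<in> normer D" using grow[OF ab] by blast
        have "insert z D \<subseteq> ?C (inv y) \<inter> ?C a" using sub z ab(4) subset_normer[OF D] by auto
        then have "card (insert z D) \<le> card (?C (inv y) \<inter> ?C a)"
          using finC ab by (intro card_mono) auto
        moreover have "card (insert z D) = Suc (card D)"
          using z finite_subgroup[OF fin D] by simp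
        ultimately show False using le by simp
      qed
      from this[of g h] this[of h g] show False using gh by (auto simp: D_def)
    qed
    then obtain m where m: "card (normer D) = p ^ 1 * m" by auto
    interpret N: group "G\<lparr>carrier := normer D\<rparr>" using N by (rule subgroup_imp_group)
    obtain P where P: "subgroup P (G\<lparr>carrier := normer D\<rparr>)" "card P = p ^ 1"
      using sylow_thm[OF p N.is_group, of 1 m] m finite_subgroup[OF fin N] by (auto simp: order_def)
    have PN: "P \<subseteq> normer D" using subgroup.subset[OF P(1)] by simp
    have PG: "subgroup P G" using incl_subgroup[OF N P(1)] .
    have "P \<inter> ?C g = {\<one>}"
      using Int_coprime_card[OF PG C(1)[OF gh(1)]] P(2) C(2)[OF gh(1)] cop by simp
    then have "card (P <#> ?C g) = card (carrier G)"
      using card_set_mult[OF fin PG C(1)[OF gh(1)]] C(2)[OF gh(1)] P(2) card by simp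
    then have PC: "P <#> ?C g = carrier G"
      using subgroup_eqI_card[OF fin subgroup_self, of "P <#> ?C g"]
        set_mult_subset[OF subgroup_self subgroup.subset[OF PG] subgroup.subset[OF C(1)[OF gh(1)]]] by simp
    \<comment> \<open>\<open>P\<close> normalizes \<open>D\<close> and
      \<open>G = P <#> ?C g\<close>, hence conjugating an element of \<open>D\<close> by any
      \<open>x\<close> never leads out of \<open>?C g\<close>. So \<open>D\<close> lies in every
      conjugate of \<open>Q\<close>, that is, in the trivial core.\<close>
    have Dg: "inv x \<otimes> d \<otimes> x \<in> ?C g" if d: "d \<in> D" and x: "x \<in> carrier G" for d x
    proof -
      have "x \<in> P <#> ?C g" using x PC by simp
      then obtain y z where yz: "y \<in> P" "z \<in> ?C g" "x = y \<otimes> z" by (rule set_multE)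
      interpret Cg: subgroup "?C g" G using C(1)[OF gh(1)] .
      interpret ND: subgroup "normer D" G by (rule N)
      have y: "y \<in> normer D" "inv y \<in> normer D" using yz PN by auto
      have yG: "y \<in> carrier G" using ND.mem_carrier[OF y(1)] .
      have "\<forall>x\<in>D. inv y \<otimes> x \<otimes> inv (inv y) \<in> D" using y(2) unfolding normer_def by blast
      then have "inv y \<otimes> d \<otimes> inv (inv y) \<in> D" using d by blast
      then have "inv y \<otimes> d \<otimes> y \<in> D" using yG by simp
      then have "inv y \<otimes> d \<otimes> y \<in> ?C g" by (simp add: D_def)
      then have "inv z \<otimes> (inv y \<otimes> d \<otimes> y) \<otimes> z \<in> ?C g" using yz by simp
      then show ?thesis using yz y d by (simp add: m_assoc inv_mult_group)
    qed
    have "D \<subseteq> core G Q"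
    proof
      fix d assume d: "d \<in> D"
      have "x \<otimes> d \<otimes> inv x \<in> Q" if x: "x \<in> carrier G" for x
      proof -
        have "inv (inv (g \<otimes> x)) \<otimes> d \<otimes> inv (g \<otimes> x) \<in> ?C g" using Dg[OF d, of "inv (g \<otimes> x)"] x gh by simp
        then have "inv g \<otimes> (inv (inv (g \<otimes> x)) \<otimes> d \<otimes> inv (g \<otimes> x)) \<otimes> g \<in> Q"
          using mem_conjugate_iff[OF Qc gh(1)] by simp
        then show ?thesis using x gh d by (simp add: m_assoc inv_mult_group)
      qed
      then show "d \<in> core G Q" using d by (simp add: core_eq[OF Q(1)])
    qed
    then show ?thesis using D1 corefree D.one_closed by blast
  next
    case False
    then have triv: "\<And>g h. g \<in> carrier G \<Longrightarrow> h \<in> carrier G \<Longrightarrow> ?C g \<noteq> ?C h \<Longrightarrow> ?C g \<inter> ?C h = {\<one>}" by blast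
    obtain P where P: "subgroup P G" "card P = p"
      using sylow_thm[OF p group_axioms, of 1 "q ^ n"] card fin by (auto simp: order_def)
    interpret P: subgroup P G by fact
    have "P \<inter> ?C g = {\<one>}" if "g \<in> carrier G" for g
      using Int_coprime_card[OF P(1) C(1)[OF that]] P(2) C(2)[OF that] cop by simp
    then have PC: "x = \<one>" if "x \<in> P" "x \<in> ?C g" "g \<in> carrier G" for x g
      using that by blast
    have N: "subgroup (normer Q) G" using subgroup_normer[OF fin Q(1)] .
    \<comment> \<open>The index of \<open>Q\<close> is the prime \<open>p\<close>, so the normalizer
      is \<open>Q\<close> or \<open>G\<close>; the latter would put \<open>Q\<close> into its
      trivial core, and \<open>1 \<le> n\<close> excludes that.\<close>
    have NQ: "normer Q = Q"
    proof -
      obtain j where j: "card (normer Q) = q ^ n * j"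
        using card_subgroup_dvd[OF Q(1) N subset_normer[OF Q(1)]] Q(2) by auto
      have "q ^ n * j dvd q ^ n * p"
        using card_subgroup_dvd[OF N subgroup_self subgroup.subset[OF N]] card j by (simp add: mult.commute)
      then have "j dvd p" using q0 by auto
      then consider "j = 1" | "j = p" using p by (auto simp: prime_nat_iff)
      then show ?thesis
      proof cases
        case 1
        then show ?thesis using subgroup_eqI_card[OF fin N subset_normer[OF Q(1)]] j Q(2) by simp
      next
        case 2
        then have "normer Q = carrier G"
          using subgroup_eqI_card[OF fin subgroup_self subgroup.subset[OF N]] j card by simp
        then have "Q \<subseteq> {\<one>}" using core_greatest[OF Q(1) normer_eq_carrier[OF Q(1)]] corefree by simp
        then have "card Q \<le> 1" using card_mono[of "{\<one>}" Q] by simp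
        moreover have "q ^ 1 \<le> q ^ n" using n q prime_ge_1_nat by (intro power_increasing) auto
        ultimately show ?thesis using Q(2) prime_gt_1_nat[OF q] by simp
      qed
    qed
    \<comment> \<open>The conjugates by the \<open>p\<close> elements of \<open>P\<close> are
      distinct and meet trivially, so they use up \<open>p * (q ^ n - 1)\<close> nontrivial
      elements. At most \<open>p\<close> elements remain for \<open>?S\<close>, which contains
      \<open>P\<close>.\<close>
    let ?U = "\<Union>y\<in>P. ?C y - {\<one>}"
    let ?S = "carrier G - (\<Union>y\<in>carrier G. ?C y - {\<one>})"
    have inj: "y = z" if yz: "y \<in> P" "z \<in> P" "?C y = ?C z" for y z
    proof -
      have "inv z \<otimes> y \<in> normer Q"
        unfolding normer_def
      proof (intro CollectI conjI ballI)
        show "inv z \<otimes> y \<in> carrier G" using yz by simp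
        fix x assume x: "x \<in> Q"
        have "y \<otimes> x \<otimes> inv y \<in> ?C z" using x yz(3) by (auto simp: conjugate_def)
        then have "inv z \<otimes> (y \<otimes> x \<otimes> inv y) \<otimes> z \<in> Q" using yz mem_conjugate_iff[OF Qc] by simp
        then show "inv z \<otimes> y \<otimes> x \<otimes> inv (inv z \<otimes> y) \<in> Q" using x yz by (simp add: m_assoc inv_mult_group)
      qed
      moreover have "Q = ?C \<one>" by (auto simp: mem_conjugate_iff[OF Qc])
      ultimately have "inv z \<otimes> y = \<one>" using PC[of "inv z \<otimes> y" \<one>] NQ yz by simp
      then show ?thesis using yz by (metis P.mem_carrier inv_closed inv_equality inv_inv)
    qed
    have card_diff: "card (?C y - {\<one>}) = q ^ n - 1" if "y \<in> carrier G" for y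
      using C[OF that] subgroup.one_closed[OF C(1)[OF that]] by (simp add: card_Diff_singleton)
    have "card ?U = (\<Sum>y\<in>P. card (?C y - {\<one>}))"
    proof (rule card_UN_disjoint)
      show "finite P" using finite_subgroup[OF fin P(1)] .
      show "\<forall>y\<in>P. finite (?C y - {\<one>})" using finite_subgroup[OF fin C(1)] by auto
      show "\<forall>y\<in>P. \<forall>z\<in>P. y \<noteq> z \<longrightarrow> (?C y - {\<one>}) \<inter> (?C z - {\<one>}) = {}"
      proof (intro ballI impI)
        fix y z assume "y \<in> P" "z \<in> P" "y \<noteq> z"
        then have "?C y \<inter> ?C z = {\<one>}" using inj[of y z] triv[of y z] P.mem_carrier by blast
        then show "(?C y - {\<one>}) \<inter> (?C z - {\<one>}) = {}" by blast
      qed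
    qed
    also have "\<dots> = p * (q ^ n - 1)" using card_diff P(2) by simp
    finally have cardU: "card ?U = p * (q ^ n - 1)" .
    have "?S \<subseteq> carrier G - ?U" using P.mem_carrier by blast
    then have "card ?S \<le> card (carrier G - ?U)" using fin by (intro card_mono) auto
    also have "\<dots> = card (carrier G) - card ?U"
    proof (rule card_Diff_subset)
      show "?U \<subseteq> carrier G"
      proof
        fix x assume "x \<in> ?U"
        then obtain y where "y \<in> P" "x \<in> ?C y" by blast
        then show "x \<in> carrier G" using subgroup.mem_carrier[OF C(1)[OF P.mem_carrier]] by simp
      qed
      then show "finite ?U" by (rule finite_subset[OF _ fin])
    qed
    also have "\<dots> = p"
    proof -
      have "p \<le> p * q ^ n" using q0 by (cases "q ^ n") auto
      then show ?thesis unfolding cardU card by (simp add: diff_mult_distrib2)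
    qed
    finally have "card ?S \<le> card P" using P(2) by simp
    moreover have "P \<subseteq> ?S"
    proof
      fix x assume x: "x \<in> P"
      have "x \<notin> ?C y - {\<one>}" if "y \<in> carrier G" for y 
      proof
        assume "x \<in> ?C y - {\<one>}"
        then have "x \<in> ?C y" "x \<noteq> \<one>" by simp_all
        then show False using PC[OF x _ that] by simp
      qed
      then show "x \<in> ?S" using P.mem_carrier[OF x] by blast
    qed
    ultimately have PS: "P = ?S" using fin by (intro card_seteq) auto
    \<comment> \<open>\<open>P\<close> equals \<open>?S\<close>, and \<open>?S\<close> is invariant
      under conjugation by its construction from all conjugates of \<open>Q\<close>.\<close>
    have "P \<lhd> G"
    proof (rule normal_invI[OF P(1)])
      fix x y assume x: "x \<in> carrier G" and y: "y \<in> P"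
      show "x \<otimes> y \<otimes> inv x \<in> P"
      proof (rule ccontr)
        assume "x \<otimes> y \<otimes> inv x \<notin> P"
        then have "x \<otimes> y \<otimes> inv x \<notin> ?S" by (rule subst[OF PS, where P = "\<lambda>A. x \<otimes> y \<otimes> inv x \<notin> A"])
        moreover have "x \<otimes> y \<otimes> inv x \<in> carrier G" using x P.mem_carrier[OF y] by simp
        ultimately obtain z where z: "z \<in> carrier G" "x \<otimes> y \<otimes> inv x \<in> ?C z" "x \<otimes> y \<otimes> inv x \<noteq> \<one>"
          by blast
        have "inv z \<otimes> (x \<otimes> y \<otimes> inv x) \<otimes> z \<in> Q" using z mem_conjugate_iff[OF Qc] by simp
        then have "inv (inv x \<otimes> z) \<otimes> y \<otimes> (inv x \<otimes> z) \<in> Q" using x y z(1) by (simp add: m_assoc inv_mult_group)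
        then have "y \<in> ?C (inv x \<otimes> z)" using x y z(1) mem_conjugate_iff[OF Qc] by simp
        then have "y = \<one>" using PC[OF y] x z(1) by simp
        then show False using z(3) x by simp
      qed
    qed
    then show ?thesis using P(2) by blast
  qed
qed

end

section \<open>Eigenvectors of automorphisms of elementary abelian groups\<close>

lemma primroot_power_cong:
  assumes "Factorial_Ring.prime p" "residue_primroot p w"
  shows "[w ^ (p - 1) = 1] (mod p)"
proof -
  have "ord p w = p - 1" using assms by (simp add: residue_primroot_def totient_prime)
  then show ?thesis by (metis ord_works)
qed

text \<open>Orthogonality of characters: a geometric series with ratio \<open>w ^ i\<close>. The
  order of \<open>w\<close> is \<open>p - 1\<close>, so \<open>1 - w ^ i\<close> is invertible
  modulo \<open>p\<close> for these \<open>i\<close>. The computation moves to \<open>int\<close>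
  for the sake of the subtraction.\<close>

lemma primroot_power_sum:
  fixes w p i :: nat
  assumes p: "Factorial_Ring.prime p" and w: "residue_primroot p w" and i: "0 < i" "i < p - 1"
  shows "[(\<Sum>c<p - 1. w ^ (c * i)) = 0] (mod p)"
proof -
  let ?x = "int w ^ i"
  have ord: "ord p w = p - 1" using w p by (simp add: residue_primroot_def totient_prime)
  have "[w ^ (p - 1) = 1] (mod p)" by (metis ord ord_works)
  then have "[(w ^ (p - 1)) ^ i = 1 ^ i] (mod p)" by (rule cong_pow)
  moreover have "(w ^ (p - 1)) ^ i = w ^ (i * (p - 1))" by (metis power_mult mult.commute)
  ultimately have "[w ^ (i * (p - 1)) = 1] (mod p)" by simp
  then have "[int (w ^ (i * (p - 1))) = int 1] (mod int p)" by (simp only: cong_int_iff)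
  then have "int p dvd 1 - ?x ^ (p - 1)"
    by (simp add: cong_iff_dvd_diff power_mult dvd_diff_commute)
  then have "int p dvd (1 - ?x) * (\<Sum>c<p - 1. ?x ^ c)" by (simp add: one_diff_power_eq)
  moreover have "\<not> int p dvd 1 - ?x"
  proof
    assume "int p dvd 1 - ?x"
    then have "[int (w ^ i) = int 1] (mod int p)" by (simp add: cong_iff_dvd_diff dvd_diff_commute)
    then have "[w ^ i = 1] (mod p)" by (simp only: cong_int_iff)
    then have "p - 1 dvd i" using ord ord_divides by metis
    then show False using i by (auto dest: dvd_imp_le)
  qed
  ultimately have "int p dvd (\<Sum>c<p - 1. ?x ^ c)"
    using p prime_dvd_mult_iff[of "int p"] by simp
  also have "(\<Sum>c<p - 1. ?x ^ c) = int (\<Sum>c<p - 1. w ^ (c * i))"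
    by (simp add: power_mult[symmetric] mult.commute)
  finally have "p dvd (\<Sum>c<p - 1. w ^ (c * i))" by (simp only: int_dvd_int_iff)
  then show ?thesis by (simp add: cong_0_iff)
qed

section \<open>Finite products in commutative groups and Lagrange resolvents\<close>

context comm_group
begin

lemma finprod_pow_sum:
  fixes e :: "'c \<Rightarrow> nat"
  assumes "x \<in> carrier G" "finite A"
  shows "(\<Otimes>c\<in>A. x [^] e c) = x [^] (\<Sum>c\<in>A. e c)"
  using assms(2) by (induction A) (simp_all add: assms(1) nat_pow_mult)

lemma finprod_pow:
  fixes n :: nat
  assumes "f \<in> A \<rightarrow> carrier G" "finite A"
  shows "(\<Otimes>i\<in>A. f i) [^] n = (\<Otimes>i\<in>A. f i [^] n)"
  using assms(2,1) by (induction A) (simp_all add: pow_mult_distrib m_comm Pi_def)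

lemma finprod_swap:
  assumes "finite A" "finite B" "\<And>i j. i \<in> A \<Longrightarrow> j \<in> B \<Longrightarrow> f i j \<in> carrier G"
  shows "(\<Otimes>i\<in>A. \<Otimes>j\<in>B. f i j) = (\<Otimes>j\<in>B. \<Otimes>i\<in>A. f i j)"
  using assms(1,3)
proof (induction A)
  case (insert i A)
  have "(\<Otimes>i\<in>insert i A. \<Otimes>j\<in>B. f i j) = (\<Otimes>j\<in>B. f i j) \<otimes> (\<Otimes>j\<in>B. \<Otimes>i\<in>A. f i j)"
    using insert by (subst finprod_insert) (auto intro!: finprod_closed)
  also have "\<dots> = (\<Otimes>j\<in>B. f i j \<otimes> (\<Otimes>i\<in>A. f i j))"
    using insert by (subst finprod_multf) (auto intro!: finprod_closed)
  also have "\<dots> = (\<Otimes>j\<in>B. \<Otimes>i\<in>insert i A. f i j)"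
    using insert by (intro finprod_cong) (auto intro!: finprod_closed simp: simp_implies_def)
  finally show ?case .
qed simp

lemma hom_finprod_endo:
  assumes "T \<in> hom G G" "finite A" "f \<in> A \<rightarrow> carrier G"
  shows "T (\<Otimes>i\<in>A. f i) = (\<Otimes>i\<in>A. T (f i))"
proof -
  interpret T: group_hom G G T
    using assms(1) by (simp add: group_hom_def group_hom_axioms_def group_axioms)
  show ?thesis using assms(2,3) by (induction A) (simp_all add: Pi_def)
qed

text \<open>Both products are completed to the one over \<open>n + 1\<close> indices, by the factor
  at 0 and by the factor at \<open>n\<close>; these two factors are equal and cancel.\<close>

lemma finprod_lessThan_cyclic_shift:
  assumes "F \<in> {..n} \<rightarrow> carrier G" "F n = F 0"
  shows "(\<Otimes>i\<in>{..<n}. F (Suc i)) = (\<Otimes>i\<in>{..<n}. F i)"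
proof -
  have shift: "(\<Otimes>i\<in>{..<Suc m}. F i) = F 0 \<otimes> (\<Otimes>i\<in>{..<m}. F (Suc i))" if "m \<le> n" for m
    using that
  proof (induction m)
    case 0
    then show ?case using assms(1) by (simp add: lessThan_Suc Pi_def)
  next
    case (Suc m)
    have c: "F 0 \<in> carrier G" "F (Suc m) \<in> carrier G" "(\<lambda>i. F (Suc i)) \<in> {..<m} \<rightarrow> carrier G"
      "F \<in> {..<Suc m} \<rightarrow> carrier G" using assms(1) Suc.prems by (auto simp: Pi_def)
    have "(\<Otimes>i\<in>{..<Suc (Suc m)}. F i) = F (Suc m) \<otimes> (\<Otimes>i\<in>{..<Suc m}. F i)"
      using c by (subst lessThan_Suc) (subst finprod_insert, auto)
    also have "\<dots> = F 0 \<otimes> (F (Suc m) \<otimes> (\<Otimes>i\<in>{..<m}. F (Suc i)))"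
      using Suc c by (simp add: m_lcomm finprod_closed)
    also have "F (Suc m) \<otimes> (\<Otimes>i\<in>{..<m}. F (Suc i)) = (\<Otimes>i\<in>{..<Suc m}. F (Suc i))"
      using c by (subst lessThan_Suc) (subst finprod_insert, auto)
    finally show ?case .
  qed
  have c: "F 0 \<in> carrier G" "F n \<in> carrier G" "(\<lambda>i. F (Suc i)) \<in> {..<n} \<rightarrow> carrier G"
      "F \<in> {..<n} \<rightarrow> carrier G" using assms(1) by (auto simp: Pi_def)
  have "F 0 \<otimes> (\<Otimes>i\<in>{..<n}. F (Suc i)) = (\<Otimes>i\<in>{..<Suc n}. F i)" using shift[of n] by simp
  also have "\<dots> = F n \<otimes> (\<Otimes>i\<in>{..<n}. F i)" using c by (subst lessThan_Suc) (subst finprod_insert, auto)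
  finally show ?thesis using c assms(2) by (simp add: finprod_closed)
qed

text \<open>With a primitive root \<open>w\<close> modulo \<open>p\<close>, the Lagrange resolvents
  \<open>\<Prod>\<^sub>i T\<^sup>i(y)\<^bsup>w^(c i)\<^esup>\<close> are eigenvectors of \<open>T\<close>, and their product over all \<open>c\<close> is \<open>y\<^bsup>p - 1\<^esup>\<close>.\<close>
lemma exists_eigenvector:
  assumes p: "Factorial_Ring.prime p" and T: "T \<in> hom G G"
    and exp: "\<And>x. x \<in> carrier G \<Longrightarrow> x [^] p = \<one>"
    and per: "\<And>x. x \<in> carrier G \<Longrightarrow> (T ^^ (p - 1)) x = x"
    and y: "y \<in> carrier G" "y \<noteq> \<one>"
  shows "\<exists>v\<in>carrier G. v \<noteq> \<one> \<and> (\<exists>a::nat. T v = v [^] a)"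
proof (rule ccontr)
  \<comment> \<open>Without eigenvectors all resolvents \<open>m c\<close> are trivial; their
    product then shows that \<open>y\<close> is trivial.\<close>
  assume no: "\<not> ?thesis"
  interpret T: group_hom G G T
    using T by (simp add: group_hom_def group_hom_axioms_def group_axioms)
  obtain w where w: "residue_primroot p w" using prime_primitive_root_exists[OF prime_gt_1_nat[OF p] p] ..
  have w1: "[w ^ (p - 1) = 1] (mod p)" by (rule primroot_power_cong[OF p w])
  have Ty: "(T ^^ i) y \<in> carrier G" for i by (induction i) (use y in auto)
  define m where "m c = (\<Otimes>i\<in>{..<p - 1}. (T ^^ i) y [^] (w ^ (c * i)))" for c :: nat
  have mc: "m c \<in> carrier G" for c unfolding m_def using Ty by (intro finprod_closed) auto
  \<comment> \<open>Applying \<open>T\<close> and raising to the power \<open>w ^ c\<close> shifts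
    the index \<open>i\<close> by one, and the family is periodic. So the eigenvalue is the inverse
    of \<open>w ^ c\<close>; this form postpones the inversion modulo \<open>p\<close>.\<close>
  have eig: "T (m c) [^] (w ^ c) = m c" for c
  proof -
    let ?F = "\<lambda>i. (T ^^ i) y [^] (w ^ (c * i))"
    have TyS: "(\<lambda>i. (T ^^ Suc i) y [^] (w ^ (c * i))) \<in> {..<p - 1} \<rightarrow> carrier G"
      by (intro Pi_I nat_pow_closed Ty)
    have "T (m c) = (\<Otimes>i\<in>{..<p - 1}. (T ^^ Suc i) y [^] (w ^ (c * i)))"
      unfolding m_def using Ty by (subst hom_finprod_endo[OF T]) (auto simp: T.hom_nat_pow)
    then have "T (m c) [^] (w ^ c) = (\<Otimes>i\<in>{..<p - 1}. ((T ^^ Suc i) y [^] (w ^ (c * i))) [^] (w ^ c))"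
      by (simp only: finprod_pow[OF TyS finite_lessThan])
    also have "\<dots> = (\<Otimes>i\<in>{..<p - 1}. ?F (Suc i))"
    proof (rule finprod_cong')
      show "(\<lambda>i. ?F (Suc i)) \<in> {..<p - 1} \<rightarrow> carrier G" by (intro Pi_I nat_pow_closed Ty)
      show "((T ^^ Suc i) y [^] (w ^ (c * i))) [^] (w ^ c) = ?F (Suc i)" for i
        unfolding nat_pow_pow[OF Ty[of "Suc i"]] by (simp add: power_add mult.commute)
    qed simp
    also have "\<dots> = (\<Otimes>i\<in>{..<p - 1}. ?F i)"
    proof (rule finprod_lessThan_cyclic_shift)
      show "?F \<in> {..p - 1} \<rightarrow> carrier G" using Ty by auto
      have "[w ^ (c * (p - 1)) = 1] (mod p)"
        using cong_pow[OF w1, of c] by (simp add: power_mult[symmetric] mult.commute)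
      then have "y [^] (w ^ (c * (p - 1))) = y [^] (1::nat)"
        using pow_mod_eq exp y(1) by blast
      then show "?F (p - 1) = ?F 0" using per y(1) by simp
    qed
    finally show ?thesis by (simp add: m_def)
  qed
  have m1: "m c = \<one>" for c
  proof (rule ccontr)
    assume mc1: "m c \<noteq> \<one>"
    \<comment> \<open>The inverse \<open>b\<close> of \<open>w ^ c\<close> modulo \<open>p\<close>
      is the exponent of the eigenvalue, and a nontrivial \<open>m c\<close> would be the excluded
      eigenvector.\<close>
    have "coprime (w ^ c) p" using w by (simp add: residue_primroot_def coprime_commute)
    then obtain b where b: "[w ^ c * b = 1] (mod p)" using cong_solve_coprime_nat[of "w ^ c" p] by (auto simp only: One_nat_def)
    have "T (m c) = T (m c) [^] (w ^ c * b)"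
      using pow_mod_eq[OF _ exp b] mc by simp
    also have "\<dots> = m c [^] b" using eig mc by (simp add: nat_pow_pow[symmetric])
    finally show False using no mc mc1 by blast
  qed
  have "\<one> = (\<Otimes>c\<in>{..<p - 1}. m c)" by (simp add: m1)
  also have "\<dots> = (\<Otimes>i\<in>{..<p - 1}. \<Otimes>c\<in>{..<p - 1}. (T ^^ i) y [^] (w ^ (c * i)))"
    unfolding m_def using Ty by (intro finprod_swap) auto
  also have "\<dots> = (\<Otimes>i\<in>{..<p - 1}. (T ^^ i) y [^] (\<Sum>c<p - 1. w ^ (c * i)))"
    using Ty by (intro finprod_cong) (auto simp: finprod_pow_sum simp_implies_def)
  \<comment> \<open>For \<open>i > 0\<close> the sum of exponents vanishes modulo \<open>p\<close>;
    for \<open>i = 0\<close> it has \<open>p - 1\<close> summands equal to 1.\<close>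
  also have "\<dots> = (\<Otimes>i\<in>{..<p - 1}. if 0 = i then y [^] (p - 1) else \<one>)"
  proof (rule finprod_cong')
    fix i assume i: "i \<in> {..<p - 1}"
    show "(T ^^ i) y [^] (\<Sum>c<p - 1. w ^ (c * i)) = (if 0 = i then y [^] (p - 1) else \<one>)"
    proof (cases "i = 0")
      case False
      then have "[(\<Sum>c<p - 1. w ^ (c * i)) = 0] (mod p)" using primroot_power_sum[OF p w] i by simp
      then have "(T ^^ i) y [^] (\<Sum>c<p - 1. w ^ (c * i)) = (T ^^ i) y [^] (0::nat)"
        using pow_mod_eq[OF Ty exp[OF Ty]] by blast
      then show ?thesis using False by simp
    qed simp
  qed (use y in simp_all)
  also have "\<dots> = y [^] (p - 1)"
  proof -
    have "0 \<in> {..<p - 1}" using prime_gt_1_nat[OF p] by simp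
    then show ?thesis using finprod_singleton[of 0 "{..<p - 1}" "\<lambda>_. y [^] (p - 1)"] y(1)
      by simp
  qed
  finally have "y [^] (p - 1) = \<one>" ..
  moreover have "coprime (p - 1) p" using coprime_diff_one_left_nat[OF prime_gt_0_nat[OF p]] .
  ultimately have "y = \<one>" using pow_coprime_eq_one[OF y(1) _ exp[OF y(1)]] by blast
  then show False using y(2) by simp
qed

end

section \<open>Factors of prime order\<close>

context group
begin

lemma pow_eq_imp_cong:
  fixes i j :: nat
  assumes p: "Factorial_Ring.prime p" and x: "x \<in> carrier G" "x \<noteq> \<one>" "x [^] p = \<one>"
    and eq: "x [^] i = x [^] j"
  shows "[i = j] (mod p)"
proof -
  have "ord x dvd p" using pow_eq_id[of x p] x by simp
  moreover have "ord x \<noteq> 1" using ord_eq_1[OF x(1)] x(2) by simp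
  ultimately have ord: "ord x = p" using p by (auto simp: prime_nat_iff)
  have "x [^] int j = x [^] int i" using eq by (simp add: int_pow_int)
  then have "int (ord x) dvd int i - int j" using int_pow_eq[OF x(1)] by blast
  then show ?thesis by (simp add: ord cong_iff_dvd_diff flip: cong_int_iff)
qed

lemma prime_order_pow:
  assumes p: "Factorial_Ring.prime p" and W: "subgroup W G" "card W = p" and w: "w \<in> W" "w \<noteq> \<one>"
    and x: "x \<in> W"
  shows "\<exists>i<p. x = w [^] i"
proof -
  interpret W: subgroup W G by fact
  have finW: "finite W" using W(2) p by (metis card.infinite not_prime_0)
  have wp: "w [^] p = \<one>" using pow_card_eq_one[OF W(1) w(1)] W(2) by simp
  have inj: "inj_on (\<lambda>i::nat. w [^] i) {..<p}"
  proof (rule inj_onI)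
    fix i j :: nat assume ij: "i \<in> {..<p}" "j \<in> {..<p}" "w [^] i = w [^] j"
    then have "[i = j] (mod p)" using pow_eq_imp_cong[OF p W.mem_carrier[OF w(1)] w(2) wp] by blast
    then show "i = j" using ij(1,2) cong_less_modulus_unique_nat by simp
  qed
  have "(\<lambda>i::nat. w [^] i) ` {..<p} = W"
    using subgroup_pow[OF W(1) w(1)] card_image[OF inj] W(2) finW by (intro card_seteq) auto
  then show ?thesis using x by blast
qed

text \<open>Every automorphism of a group of order \<open>p\<close> is a power map, so conjugation
  on \<open>W\<close> is a character of \<open>G\<close> modulo \<open>p\<close>. The exponents are
  arbitrarily chosen natural numbers, hence multiplicativity is a congruence.\<close>

lemma prime_order_action:
  assumes p: "Factorial_Ring.prime p" and W: "W \<lhd> G" "card W = p"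
  obtains a :: "'a \<Rightarrow> nat" where
    "\<And>g x. g \<in> carrier G \<Longrightarrow> x \<in> W \<Longrightarrow> g \<otimes> x \<otimes> inv g = x [^] a g"
    "\<And>g h. g \<in> carrier G \<Longrightarrow> h \<in> carrier G \<Longrightarrow> [a (g \<otimes> h) = a g * a h] (mod p)"
    "\<And>g. g \<in> carrier G \<Longrightarrow> (\<forall>x\<in>W. g \<otimes> x \<otimes> inv g = x) \<longleftrightarrow> [a g = 1] (mod p)"
proof -
  interpret W: normal W G by fact
  have "W \<noteq> {\<one>}" using W(2) p by (auto simp: prime_nat_iff)
  then obtain w where w: "w \<in> W" "w \<noteq> \<one>" using W.one_closed by blast
  note pow = prime_order_pow[OF p W.subgroup_axioms W(2) w]
  have wp: "x [^] p = \<one>" if "x \<in> W" for x using pow_card_eq_one[OF W.subgroup_axioms that] W(2) by simp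
  define a where "a g = (SOME i::nat. g \<otimes> w \<otimes> inv g = w [^] i)" for g
  have a: "g \<otimes> w \<otimes> inv g = w [^] a g" if "g \<in> carrier G" for g
    unfolding a_def by (rule someI_ex) (use pow[of "g \<otimes> w \<otimes> inv g"] W.inv_op_closed2[OF that w(1)] in blast)
  have act: "g \<otimes> x \<otimes> inv g = x [^] a g" if "g \<in> carrier G" "x \<in> W" for g x
  proof -
    obtain i :: nat where "x = w [^] i" using pow[OF \<open>x \<in> W\<close>] by blast
    then show ?thesis using that w by (simp add: conj_pow a nat_pow_pow mult.commute)
  qed
  have cong: "[i = j] (mod p)" if "w [^] i = w [^] j" for i j :: nat
    using pow_eq_imp_cong[OF p _ w(2) wp[OF w(1)] that] w(1) by simp
  show ?thesis
  proof (rule that[of a])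
    show "g \<otimes> x \<otimes> inv g = x [^] a g" if "g \<in> carrier G" "x \<in> W" for g x using act that .
    show "[a (g \<otimes> h) = a g * a h] (mod p)" if "g \<in> carrier G" "h \<in> carrier G" for g h
    proof (rule cong)
      have "w [^] a (g \<otimes> h) = g \<otimes> (h \<otimes> w \<otimes> inv h) \<otimes> inv g"
        using that w a[of "g \<otimes> h"] by (simp flip: conj_conj)
      also have "\<dots> = w [^] (a g * a h)" using that w by (simp add: a conj_pow nat_pow_pow)
      finally show "w [^] a (g \<otimes> h) = w [^] (a g * a h)" .
    qed
    show "(\<forall>x\<in>W. g \<otimes> x \<otimes> inv g = x) \<longleftrightarrow> [a g = 1] (mod p)" if g: "g \<in> carrier G" for g
    proof
      assume "\<forall>x\<in>W. g \<otimes> x \<otimes> inv g = x"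
      then have "w [^] a g = w [^] (1::nat)" using a[OF g] w by simp
      then show "[a g = 1] (mod p)" by (rule cong)
    next
      assume "[a g = 1] (mod p)"
      then show "\<forall>x\<in>W. g \<otimes> x \<otimes> inv g = x"
        using pow_mod_eq[OF W.mem_carrier wp, of _ "a g" 1] act[OF g] by (metis W.mem_carrier nat_pow_eone)
    qed
  qed
qed

end

text \<open>A homomorphism into the units modulo \<open>p\<close>, written with natural
  representatives. The condition at \<open>\<one>\<close> excludes the function that vanishes modulo
  \<open>p\<close>.\<close>

locale mod_character = group +
  fixes a :: "'a \<Rightarrow> nat" and p :: nat
  assumes p: "Factorial_Ring.prime p"
    and mult: "\<And>g h. g \<in> carrier G \<Longrightarrow> h \<in> carrier G \<Longrightarrow> [a (g \<otimes> h) = a g * a h] (mod p)"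
    and one: "[a \<one> = 1] (mod p)"
begin

definition ker where "ker = {g \<in> carrier G. [a g = 1] (mod p)}"

lemma mem_ker: "g \<in> ker \<longleftrightarrow> g \<in> carrier G \<and> [a g = 1] (mod p)"
  by (simp add: ker_def)

lemma ker_subset: "ker \<subseteq> carrier G"
  by (auto simp: ker_def)

lemma mult_inv: "g \<in> carrier G \<Longrightarrow> [a g * a (inv g) = 1] (mod p)"
  using mult[of g "inv g"] one by (metis cong_sym cong_trans inv_closed r_inv)

lemma coprime_a: "g \<in> carrier G \<Longrightarrow> coprime (a g) p"
  using mult_inv[of g] by (metis cong_imp_coprime cong_sym coprime_1_left coprime_mult_left_iff)

lemma pow_cong:
  fixes n :: nat
  assumes "g \<in> carrier G" shows "[a (g [^] n) = a g ^ n] (mod p)"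
proof (induction n)
  case 0
  then show ?case using one by simp
next
  case (Suc n)
  have "[a (g [^] n \<otimes> g) = a (g [^] n) * a g] (mod p)" using mult assms by simp
  also have "[a (g [^] n) * a g = a g ^ n * a g] (mod p)" using Suc by (rule cong_scalar_right)
  finally show ?case by (simp add: mult.commute)
qed

lemma conj_cong:
  assumes "g \<in> carrier G" "x \<in> carrier G" shows "[a (g \<otimes> x \<otimes> inv g) = a x] (mod p)"
proof -
  have "[a (g \<otimes> x \<otimes> inv g) = a (g \<otimes> x) * a (inv g)] (mod p)" using mult assms by simp
  also have "[a (g \<otimes> x) * a (inv g) = (a g * a x) * a (inv g)] (mod p)"
    using mult assms cong_scalar_right by blast
  also have "(a g * a x) * a (inv g) = a x * (a g * a (inv g))" by simp
  also have "[a x * (a g * a (inv g)) = a x * 1] (mod p)" using mult_inv[OF assms(1)] by (rule cong_scalar_left)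
  finally show ?thesis by simp
qed

lemma normal_ker: "ker \<lhd> G"
proof (rule normal_invI)
  show "subgroup ker G"
  proof (rule subgroupI)
    show "ker \<subseteq> carrier G" by (rule ker_subset)
    have "\<one> \<in> ker" using one by (simp add: mem_ker)
    then show "ker \<noteq> {}" by blast
    show "inv g \<in> ker" if "g \<in> ker" for g
    proof -
      have g: "g \<in> carrier G" "[a g = 1] (mod p)" using that by (simp_all only: mem_ker)
      have "[1 * a (inv g) = a g * a (inv g)] (mod p)" using cong_scalar_right[OF cong_sym[OF g(2)]] .
      from cong_trans[OF this mult_inv[OF g(1)]] have "[a (inv g) = 1] (mod p)" by simp
      then show ?thesis using g by (simp add: mem_ker)
    qed
    show "g \<otimes> h \<in> ker" if "g \<in> ker" "h \<in> ker" for g h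
    proof -
      have g: "g \<in> carrier G" "[a g = 1] (mod p)" and h: "h \<in> carrier G" "[a h = 1] (mod p)"
        using that by (simp_all only: mem_ker)
      have "[a (g \<otimes> h) = 1 * 1] (mod p)" using cong_trans[OF mult[OF g(1) h(1)] cong_mult[OF g(2) h(2)]] .
      then show ?thesis using g h by (simp add: mem_ker)
    qed
  qed
  show "x \<otimes> g \<otimes> inv x \<in> ker" if "x \<in> carrier G" "g \<in> ker" for x g
  proof -
    have g: "g \<in> carrier G" "[a g = 1] (mod p)" using that by (simp_all only: mem_ker)
    show ?thesis using cong_trans[OF conj_cong[OF that(1) g(1)] g(2)] that(1) g(1) by (simp add: mem_ker)
  qed
qed

lemma commutator_in_ker:
  assumes "g \<in> carrier G" "h \<in> carrier G"
  shows "g \<otimes> h \<otimes> inv g \<otimes> inv h \<in> ker"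
proof -
  have "[a (g \<otimes> h \<otimes> inv g \<otimes> inv h) = a (g \<otimes> h \<otimes> inv g) * a (inv h)] (mod p)" using mult assms by simp
  also have "[a (g \<otimes> h \<otimes> inv g) * a (inv h) = a h * a (inv h)] (mod p)"
    using conj_cong assms cong_scalar_right by blast
  also have "[a h * a (inv h) = 1] (mod p)" using mult_inv assms by blast
  finally show ?thesis using assms by (simp add: mem_ker)
qed

lemma pow_p_minus_1_in_ker:
  assumes "g \<in> carrier G" shows "g [^] (p - 1) \<in> ker"
proof -
  have "\<not> p dvd a g"
  proof
    assume "p dvd a g"
    then have "p dvd 1" using coprime_common_divisor[OF coprime_a[OF assms] _ dvd_refl] by simp
    then show False using p by simp
  qed
  then have "[a g ^ (p - 1) = 1] (mod p)" using fermat_theorem p by blast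
  from cong_trans[OF pow_cong[OF assms] this] show ?thesis using assms by (simp add: mem_ker)
qed

text \<open>The group of units modulo \<open>p\<close> has order prime to \<open>p\<close>: if
  \<open>?h [^] p\<close> is in the kernel, then so is \<open>?h\<close>, because Fermat puts
  \<open>?h [^] (p - 1)\<close> there. This step removes one factor \<open>p\<close> from the
  exponent.\<close>

lemma pow_p_power_in_ker_imp:
  assumes "g \<in> carrier G" "g [^] (p ^ m) \<in> ker" shows "g \<in> ker"
  using assms(2)
proof (induction m)
  case 0
  then show ?case using assms(1) by simp
next
  case (Suc m)
  interpret ker: normal ker G by (rule normal_ker)
  let ?h = "g [^] (p ^ m)"
  have h: "?h \<in> carrier G" using assms(1) by simp
  have "?h [^] (p - 1) \<in> ker" using pow_p_minus_1_in_ker[OF h] .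
  moreover have "?h [^] p = ?h [^] (p - 1) \<otimes> ?h"
    using prime_gt_0_nat[OF p] by (metis Suc_diff_1 nat_pow_Suc)
  moreover have "?h [^] p \<in> ker" using Suc.prems assms(1) by (simp add: nat_pow_pow mult.commute)
  ultimately have "inv (?h [^] (p - 1)) \<otimes> (?h [^] (p - 1) \<otimes> ?h) \<in> ker" by simp
  then have "?h \<in> ker" using h by simp
  then show ?case by (rule Suc.IH)
qed

text \<open>The quotient embeds in the cyclic group of units modulo \<open>p\<close>. Its generator
  comes from an element \<open>g0\<close> whose discrete logarithm to a primitive root is the least
  positive one that occurs.\<close>

lemma cyclic_Mod_ker: "cyclic_group (G Mod ker)"
proof -
  interpret ker: normal ker G by (rule normal_ker)
  interpret Q: group "G Mod ker" by (rule ker.factorgroup_is_group)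
  obtain w where w: "residue_primroot p w" using prime_primitive_root_exists[OF prime_gt_1_nat[OF p] p] ..
  have w1: "[w ^ (p - 1) = 1] (mod p)" by (rule primroot_power_cong[OF p w])
  have wcop: "coprime (w ^ n) p" for n using w by (simp add: residue_primroot_def coprime_commute)
  have log: "\<exists>m. [w ^ m = a g] (mod p)" if "g \<in> carrier G" for g
  proof -
    have "bij_betw (\<lambda>i. w ^ i mod p) {..<totient p} (totatives p)"
      using residue_primroot_is_generator[OF prime_gt_1_nat[OF p] w] .
    moreover have "a g mod p \<in> totatives p"
    proof -
      have "coprime (a g mod p) p"
        using coprime_a[OF that] prime_gt_0_nat[OF p] by (simp add: coprime_mod_left_iff)
      moreover have "a g mod p \<noteq> 0"
      proof
        assume "a g mod p = 0"
        with \<open>coprime (a g mod p) p\<close> have "coprime 0 p" by simp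
        then show False using prime_gt_1_nat[OF p] by simp
      qed
      ultimately show ?thesis using prime_gt_0_nat[OF p] by (simp add: in_totatives_iff less_imp_le)
    qed
    ultimately have "a g mod p \<in> (\<lambda>i. w ^ i mod p) ` {..<totient p}" by (simp add: bij_betw_def)
    then obtain m where "a g mod p = w ^ m mod p" by blast
    then show ?thesis by (auto simp: cong_def)
  qed
  let ?P = "\<lambda>e. e > 0 \<and> (\<exists>g\<in>carrier G. [w ^ e = a g] (mod p))"
  obtain e0 where "?P e0"
  proof
    show "?P (if p = 2 then 1 else p - 1)"
    proof (cases "p = 2")
      case True
      have "[w ^ 1 = 1] (mod p)" using w1 True by simp
      then have "[w ^ 1 = a \<one>] (mod p)" using one cong_sym cong_trans by blast
      then show ?thesis using True by auto
    next
      case False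
      have "[w ^ (p - 1) = a \<one>] (mod p)" using one w1 cong_sym cong_trans by blast
      then show ?thesis using False prime_gt_1_nat[OF p] by auto
    qed
  qed
  define d where "d = (LEAST e. ?P e)"
  have "?P d" unfolding d_def using \<open>?P e0\<close> by (rule LeastI)
  then obtain g0 where d: "d > 0" and g0: "g0 \<in> carrier G" "[w ^ d = a g0] (mod p)" by blast
  have least: "d \<le> e" if "?P e" for e unfolding d_def using that by (rule Least_le)
  \<comment> \<open>The logarithm of \<open>g\<close> is divided by \<open>d\<close>. The remainder
    is a logarithm of \<open>g \<otimes> inv (g0 [^] s)\<close> below \<open>d\<close>, so it is
    zero.\<close>
  have gen: "\<exists>s::nat. g \<otimes> inv (g0 [^] s) \<in> ker" if g: "g \<in> carrier G" for g
  proof -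
    obtain m where m: "[w ^ m = a g] (mod p)" using log[OF g] by blast
    define s r where "s = m div d" and "r = m mod d"
    let ?h = "g \<otimes> inv (g0 [^] s)"
    have h: "?h \<in> carrier G" using g g0 by simp
    have "?h \<otimes> g0 [^] s = g" using g g0 by (simp add: m_assoc)
    then have "[a g = a ?h * a (g0 [^] s)] (mod p)" using mult[OF h, of "g0 [^] s"] g0 by simp
    also have "[a ?h * a (g0 [^] s) = a ?h * a g0 ^ s] (mod p)" using pow_cong[OF g0(1)] by (rule cong_scalar_left)
    also have "[a ?h * a g0 ^ s = a ?h * (w ^ d) ^ s] (mod p)"
      using cong_pow[OF cong_sym[OF g0(2)]] by (rule cong_scalar_left)
    finally have "[w ^ m = a ?h * w ^ (d * s)] (mod p)" using m by (metis cong_trans power_mult)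
    moreover have "w ^ m = w ^ r * w ^ (d * s)" by (simp add: s_def r_def flip: power_add)
    ultimately have "[w ^ r = a ?h] (mod p)" using wcop cong_mult_rcancel_nat by metis
    moreover have "r < d" using d by (simp add: r_def)
    ultimately have "r = 0" using least[of r] h by force
    then have "[a ?h = 1] (mod p)" using \<open>[w ^ r = a ?h] (mod p)\<close> by (simp add: cong_sym)
    then show ?thesis using h mem_ker by blast
  qed
  have "carrier (G Mod ker) = range (\<lambda>n::int. (ker #> g0) [^]\<^bsub>G Mod ker\<^esub> n)"
  proof
    show "carrier (G Mod ker) \<subseteq> range (\<lambda>n::int. (ker #> g0) [^]\<^bsub>G Mod ker\<^esub> n)"
    proof
      fix R assume "R \<in> carrier (G Mod ker)"
      then obtain g where g: "g \<in> carrier G" "R = ker #> g" by (auto simp: carrier_FactGroup)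
      then obtain s :: nat where "g \<otimes> inv (g0 [^] s) \<in> ker" using gen by blast
      then have "g \<in> ker #> (g0 [^] s)" using ker.rcos_module[OF is_group] g g0 by simp
      then have "R = ker #> (g0 [^] s)" using g g0 repr_independence ker.subgroup_axioms by auto
      also have "\<dots> = (ker #> g0) [^]\<^bsub>G Mod ker\<^esub> (int s)" using ker.FactGroup_pow[OF g0(1)] by (simp add: int_pow_int)
      finally show "R \<in> range (\<lambda>n::int. (ker #> g0) [^]\<^bsub>G Mod ker\<^esub> n)" by blast
    qed
    have "ker #> g0 \<in> carrier (G Mod ker)" using g0 by (auto simp: carrier_FactGroup)
    then show "range (\<lambda>n::int. (ker #> g0) [^]\<^bsub>G Mod ker\<^esub> n) \<subseteq> carrier (G Mod ker)" by auto
  qed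
  moreover have "ker #> g0 \<in> carrier (G Mod ker)" using g0 by (auto simp: carrier_FactGroup)
  ultimately show ?thesis using Q.cyclic_group by blast
qed

end

section \<open>Centralizers of factors of prime order\<close>

context group
begin

text \<open>Conjugation on the image of \<open>H\<close> in \<open>G Mod K\<close>, a normal
  subgroup of order \<open>p\<close>, is a character; composed with the projection it becomes a
  character of \<open>G\<close> whose kernel is the centralizer.\<close>

lemma factor_centralizer_character:
  assumes fin: "finite (carrier G)" and HK: "H \<lhd> G" "K \<lhd> G" "K \<subseteq> H"
    and p: "Factorial_Ring.prime p" "card H = p * card K"
  obtains a where "mod_character G a p" "mod_character.ker G a p = factor_centralizer G H K"
proof -
  interpret H: normal H G by fact
  interpret K: normal K G by fact
  interpret f: epi_hom G "G Mod K" "\<lambda>x. K #> x" by (rule epi_hom_Mod[OF HK(2) fin])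
  have ker: "f.ker = K" by (rule kernel_Mod[OF HK(2)])
  let ?W = "(\<lambda>x. K #> x) ` H"
  have W: "?W \<lhd> G Mod K" by (rule f.normal_image[OF HK(1)])
  have "card H = card ?W * card K" using f.card_eq_card_image[OF H.subgroup_axioms] ker HK(3) by simp
  then have "card ?W = p" using p(2) card_subgroup_pos[OF fin K.subgroup_axioms] by simp
  then obtain b where
    b: "\<And>g h. g \<in> carrier (G Mod K) \<Longrightarrow> h \<in> carrier (G Mod K) \<Longrightarrow> [b (g \<otimes>\<^bsub>G Mod K\<^esub> h) = b g * b h] (mod p)"
      "\<And>g. g \<in> carrier (G Mod K) \<Longrightarrow> (\<forall>x\<in>?W. g \<otimes>\<^bsub>G Mod K\<^esub> x \<otimes>\<^bsub>G Mod K\<^esub> inv\<^bsub>G Mod K\<^esub> g = x) \<longleftrightarrow> [b g = 1] (mod p)"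
    using f.H.prime_order_action[OF p(1) W] by metis
  let ?a = "\<lambda>g. b (K #> g)"
  have hom: "K #> (g \<otimes> h \<otimes> inv g) = (K #> g) \<otimes>\<^bsub>G Mod K\<^esub> (K #> h) \<otimes>\<^bsub>G Mod K\<^esub> inv\<^bsub>G Mod K\<^esub> (K #> g)"
    if "g \<in> carrier G" "h \<in> carrier G" for g h
    using that f.hom_mult f.hom_inv by (simp del: mult_FactGroup)
  have iff: "(\<forall>h\<in>H. K #> (g \<otimes> h \<otimes> inv g) = K #> h) \<longleftrightarrow> [?a g = 1] (mod p)" if "g \<in> carrier G" for g
    using b(2)[of "K #> g"] f.hom_closed[OF that] hom[OF that H.mem_carrier] by simp
  interpret a: mod_character G ?a p
  proof
    show "Factorial_Ring.prime p" by (rule p(1))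
    show "[?a (g \<otimes> h) = ?a g * ?a h] (mod p)" if "g \<in> carrier G" "h \<in> carrier G" for g h
      using b(1)[of "K #> g" "K #> h"] that f.hom_closed f.hom_mult by (simp del: mult_FactGroup)
    show "[?a \<one> = 1] (mod p)" using iff[of \<one>] H.mem_carrier by simp
  qed
  have "g \<in> a.ker \<longleftrightarrow> g \<in> factor_centralizer G H K" for g
    unfolding a.mem_ker factor_centralizer_def using iff[of g] by blast
  then have "a.ker = factor_centralizer G H K" by blast
  with a.mod_character_axioms show ?thesis by (rule that)
qed

text \<open>The quotient by the centralizer embeds in the units modulo \<open>p\<close>, a cyclic
  group of order \<open>p - 1\<close>; everything here is read off from that.\<close>

lemma
  assumes fin: "finite (carrier G)" and HK: "H \<lhd> G" "K \<lhd> G" "K \<subseteq> H"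
    and p: "Factorial_Ring.prime p" "card H = p * card K"
  shows normal_factor_centralizer: "factor_centralizer G H K \<lhd> G"
    and cyclic_Mod_factor_centralizer: "cyclic_group (G Mod factor_centralizer G H K)"
    and commutator_in_factor_centralizer: "\<And>g h. g \<in> carrier G \<Longrightarrow> h \<in> carrier G \<Longrightarrow>
      g \<otimes> h \<otimes> inv g \<otimes> inv h \<in> factor_centralizer G H K"
    and pow_in_factor_centralizer: "\<And>g. g \<in> carrier G \<Longrightarrow> g [^] (p - 1) \<in> factor_centralizer G H K"
    and p_element_in_factor_centralizer: "\<And>g m. g \<in> carrier G \<Longrightarrow> g [^] (p ^ m) \<in> factor_centralizer G H K \<Longrightarrow>
      g \<in> factor_centralizer G H K"
proof -
  obtain a where a: "mod_character G a p" and eq: "mod_character.ker G a p = factor_centralizer G H K"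
    using factor_centralizer_character[OF assms] .
  interpret mod_character G a p by (rule a)
  show "factor_centralizer G H K \<lhd> G" "cyclic_group (G Mod factor_centralizer G H K)"
    "\<And>g h. g \<in> carrier G \<Longrightarrow> h \<in> carrier G \<Longrightarrow> g \<otimes> h \<otimes> inv g \<otimes> inv h \<in> factor_centralizer G H K"
    "\<And>g. g \<in> carrier G \<Longrightarrow> g [^] (p - 1) \<in> factor_centralizer G H K"
    "\<And>g m. g \<in> carrier G \<Longrightarrow> g [^] (p ^ m) \<in> factor_centralizer G H K \<Longrightarrow> g \<in> factor_centralizer G H K"
    using normal_ker cyclic_Mod_ker commutator_in_ker pow_p_minus_1_in_ker pow_p_power_in_ker_imp
    unfolding eq by blast+
qed

lemma rcos_eq_iff:
  assumes "subgroup K G" "x \<in> carrier G" "y \<in> carrier G"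
  shows "K #> x = K #> y \<longleftrightarrow> x \<otimes> inv y \<in> K"
proof -
  interpret K: subgroup K G by fact
  have "K #> x = K #> y \<longleftrightarrow> x \<in> K #> y"
    using assms repr_independence[of x K y] rcos_self[of x K] by auto
  then show ?thesis using K.rcos_module assms is_group by simp
qed

lemma mem_factor_centralizer_iff:
  assumes "H \<lhd> G" "K \<lhd> G"
  shows "g \<in> factor_centralizer G H K \<longleftrightarrow> g \<in> carrier G \<and> (\<forall>h\<in>H. g \<otimes> h \<otimes> inv g \<otimes> inv h \<in> K)"
proof -
  have "K #> (g \<otimes> h \<otimes> inv g) = K #> h \<longleftrightarrow> g \<otimes> h \<otimes> inv g \<otimes> inv h \<in> K" if "g \<in> carrier G" "h \<in> H" for h
    using rcos_eq_iff[OF normal_imp_subgroup[OF assms(2)]] that subgroup.mem_carrier[OF normal_imp_subgroup[OF assms(1)]]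
    by simp
  then show ?thesis by (auto simp: factor_centralizer_def)
qed

text \<open>Commutators of elements of \<open>S\<close> and \<open>H\<close> lie in both normal
  subgroups, hence in \<open>K\<close>.\<close>

lemma subset_factor_centralizer:
  assumes HK: "H \<lhd> G" "K \<lhd> G" and S: "S \<lhd> G" "S \<inter> H \<subseteq> K"
  shows "S \<subseteq> factor_centralizer G H K"
proof
  interpret H: normal H G by fact
  interpret S: normal S G by fact
  fix g assume g: "g \<in> S"
  have "g \<otimes> h \<otimes> inv g \<otimes> inv h \<in> K" if h: "h \<in> H" for h
  proof -
    have "g \<otimes> h \<otimes> inv g \<in> H" using g h H.inv_op_closed2[of g h] by simp
    then have "g \<otimes> h \<otimes> inv g \<otimes> inv h \<in> H" using h by simp
    moreover have "h \<otimes> inv g \<otimes> inv h \<in> S" using g h S.inv_op_closed2[of h "inv g"] by simp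
    then have "g \<otimes> (h \<otimes> inv g \<otimes> inv h) \<in> S" using g by simp
    then have "g \<otimes> h \<otimes> inv g \<otimes> inv h \<in> S" using g h by (simp add: m_assoc)
    ultimately show ?thesis using S(2) by blast
  qed
  then show "g \<in> factor_centralizer G H K" using g by (simp add: mem_factor_centralizer_iff[OF HK])
qed

text \<open>The \<open>p\<close>-th power of an element of \<open>H\<close> lies in
  \<open>K\<close>, which lies in the centralizer; modulo the centralizer there are no nontrivial
  \<open>p\<close>-elements.\<close>

lemma factor_subset_factor_centralizer:
  assumes fin: "finite (carrier G)" and HK: "H \<lhd> G" "K \<lhd> G" "K \<subseteq> H"
    and p: "Factorial_Ring.prime p" "card H = p * card K"
  shows "H \<subseteq> factor_centralizer G H K"
proof
  interpret H: normal H G by fact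
  interpret K: normal K G by fact
  interpret f: epi_hom G "G Mod K" "\<lambda>x. K #> x" by (rule epi_hom_Mod[OF HK(2) fin])
  have ker: "f.ker = K" by (rule kernel_Mod[OF HK(2)])
  have W: "subgroup ((\<lambda>x. K #> x) ` H) (G Mod K)" by (rule f.subgroup_image[OF H.subgroup_axioms])
  have "card H = card ((\<lambda>x. K #> x) ` H) * card K"
    using f.card_eq_card_image[OF H.subgroup_axioms] ker HK(3) by simp
  then have cW: "card ((\<lambda>x. K #> x) ` H) = p" using p(2) card_subgroup_pos[OF fin K.subgroup_axioms] by simp
  fix h assume h: "h \<in> H"
  have "(K #> h) [^]\<^bsub>G Mod K\<^esub> p = \<one>\<^bsub>G Mod K\<^esub>" using f.H.pow_card_eq_one[OF W, of "K #> h"] cW h by simp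
  then have "K #> (h [^] p) = K" using K.FactGroup_pow h by simp
  then have "h [^] p \<in> K" using coset_join1[of K "h [^] p"] h K.subgroup_axioms by simp
  moreover have "K \<subseteq> factor_centralizer G H K" using subset_factor_centralizer[OF HK(1,2) HK(2)] by blast
  ultimately show "h \<in> factor_centralizer G H K"
    using p_element_in_factor_centralizer[OF assms, of h 1] h by auto
qed

text \<open>A single coset outside \<open>K\<close> generates the factor of order \<open>p\<close>,
  so it suffices that \<open>y\<close> fixes that one.\<close>

lemma mem_factor_centralizerI:
  assumes fin: "finite (carrier G)" and HK: "H \<lhd> G" "K \<lhd> G" "K \<subseteq> H"
    and p: "Factorial_Ring.prime p" "card H = p * card K"
    and x: "x \<in> H" "x \<notin> K" and y: "y \<in> carrier G" "y \<otimes> x \<otimes> inv y \<otimes> inv x \<in> K"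
  shows "y \<in> factor_centralizer G H K"
proof -
  interpret H: normal H G by fact
  interpret K: normal K G by fact
  interpret f: epi_hom G "G Mod K" "\<lambda>x. K #> x" by (rule epi_hom_Mod[OF HK(2) fin])
  have ker: "f.ker = K" by (rule kernel_Mod[OF HK(2)])
  have W: "subgroup ((\<lambda>x. K #> x) ` H) (G Mod K)" by (rule f.subgroup_image[OF H.subgroup_axioms])
  have "card H = card ((\<lambda>x. K #> x) ` H) * card K"
    using f.card_eq_card_image[OF H.subgroup_axioms] ker HK(3) by simp
  then have cW: "card ((\<lambda>x. K #> x) ` H) = p" using p(2) card_subgroup_pos[OF fin K.subgroup_axioms] by simp
  have xW: "K #> x \<in> (\<lambda>x. K #> x) ` H" using x(1) by blast
  have xG: "x \<in> carrier G" using x(1) by simp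
  have "K #> x \<noteq> \<one>\<^bsub>G Mod K\<^esub>" using x coset_join1[of K x] K.subgroup_axioms xG by auto
  note pow = f.H.prime_order_pow[OF p(1) W cW xW this]
  have hom: "K #> (y \<otimes> h \<otimes> inv y) = (K #> y) \<otimes>\<^bsub>G Mod K\<^esub> (K #> h) \<otimes>\<^bsub>G Mod K\<^esub> inv\<^bsub>G Mod K\<^esub> (K #> y)"
    if "h \<in> carrier G" for h
    using that y(1) f.hom_mult f.hom_inv by (simp del: mult_FactGroup)
  have c: "K #> x \<in> carrier (G Mod K)" "K #> y \<in> carrier (G Mod K)" using xG y(1) f.hom_closed by auto
  have "y \<otimes> x \<otimes> inv y \<in> carrier G" using y(1) xG by simp
  then have "K #> (y \<otimes> x \<otimes> inv y) = K #> x" using rcos_eq_iff[OF K.subgroup_axioms _ xG] y(2) by blast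
  then have yx: "(K #> y) \<otimes>\<^bsub>G Mod K\<^esub> (K #> x) \<otimes>\<^bsub>G Mod K\<^esub> inv\<^bsub>G Mod K\<^esub> (K #> y) = K #> x"
    using hom[OF xG] by simp
  have "K #> (y \<otimes> h \<otimes> inv y) = K #> h" if h: "h \<in> H" for h
  proof -
    obtain i :: nat where i: "K #> h = (K #> x) [^]\<^bsub>G Mod K\<^esub> i" using pow[of "K #> h"] h by blast
    have "K #> (y \<otimes> h \<otimes> inv y) = (K #> y) \<otimes>\<^bsub>G Mod K\<^esub> (K #> h) \<otimes>\<^bsub>G Mod K\<^esub> inv\<^bsub>G Mod K\<^esub> (K #> y)"
      using hom h by simp
    also have "\<dots> = K #> h" unfolding i f.H.conj_pow[OF c(2,1)] yx ..
    finally show ?thesis .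
  qed
  then show ?thesis using y(1) by (simp add: factor_centralizer_def)
qed

section \<open>Chief factors\<close>

lemma chief_factor_above:
  assumes fin: "finite (carrier G)" and KL: "K \<lhd> G" "L \<lhd> G" "K \<subset> L"
  shows "\<exists>H. chief_factor G H K \<and> H \<subseteq> L"
proof -
  let ?P = "\<lambda>H. H \<lhd> G \<and> K \<subset> H \<and> H \<subseteq> L"
  obtain H where H: "?P H" "\<And>J. ?P J \<Longrightarrow> card H \<le> card J"
    using ex_has_least_nat[of ?P L card] KL by blast
  have "J = K \<or> J = H" if J: "J \<lhd> G" "K \<subseteq> J" "J \<subseteq> H" for J
  proof (cases "J = K")
    case False
    then have "card H \<le> card J" using H(1) J by (intro H(2)) blast
    then have "J = H" using subgroup_eqI_card[OF fin normal_imp_subgroup J(3)] H(1) by simp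
    then show ?thesis ..
  qed simp
  then have "chief_factor G H K" unfolding chief_factor_def using H(1) KL(1) by blast
  then show ?thesis using H(1) by blast
qed

lemma chief_factor_below:
  assumes fin: "finite (carrier G)" and KL: "K \<lhd> G" "L \<lhd> G" "K \<subset> L"
  shows "\<exists>W. chief_factor G L W \<and> K \<subseteq> W"
proof -
  let ?P = "\<lambda>H. H \<lhd> G \<and> K \<subseteq> H \<and> H \<subset> L"
  have "\<exists>W. ?P W \<and> (\<forall>J. ?P J \<longrightarrow> card J \<le> card W)"
  proof (rule ex_has_greatest_nat[of ?P _ _ "Suc (card (carrier G))"])
    show "?P K" using KL by blast
    show "\<forall>J. ?P J \<longrightarrow> card J < Suc (card (carrier G))"
      using card_mono[OF fin subgroup.subset[OF normal_imp_subgroup]] by (simp add: le_imp_less_Suc)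
  qed
  then obtain W where W: "?P W" "\<And>J. ?P J \<Longrightarrow> card J \<le> card W" by blast
  have "J = W \<or> J = L" if J: "J \<lhd> G" "W \<subseteq> J" "J \<subseteq> L" for J
  proof (cases "J = L")
    case False
    then have "card J \<le> card W" using W(1) J by (intro W(2)) blast
    then have "W = J" using subgroup_eqI_card[OF fin normal_imp_subgroup[OF J(1)] J(2)] by simp
    then show ?thesis by simp
  qed simp
  then have "chief_factor G L W" unfolding chief_factor_def using W(1) KL(2) by blast
  then show ?thesis using W(1) by blast
qed

lemma minimal_normalD:
  assumes "chief_factor G N {\<one>}"
  shows "N \<lhd> G" "N \<noteq> {\<one>}" "\<And>S. S \<lhd> G \<Longrightarrow> S \<subseteq> N \<Longrightarrow> S \<noteq> {\<one>} \<Longrightarrow> S = N"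
  using assms subgroup.one_closed[OF normal_imp_subgroup] by (auto simp: chief_factor_def)

text \<open>In the commutative group \<open>N\<close> the elements of exponent \<open>p\<close> form
  a subgroup, which conjugation preserves. By Cauchy it is nontrivial, so minimality makes it
  \<open>N\<close>.\<close>

lemma minimal_normal_exponent:
  assumes fin: "finite (carrier G)" and N: "chief_factor G N {\<one>}"
    and comm: "\<And>x y. x \<in> N \<Longrightarrow> y \<in> N \<Longrightarrow> x \<otimes> y = y \<otimes> x"
    and p: "Factorial_Ring.prime p" "p dvd card N" and x: "x \<in> N"
  shows "x [^] p = \<one>"
proof -
  interpret N: normal N G by (rule minimal_normalD(1)[OF N])
  interpret GN: group "G\<lparr>carrier := N\<rparr>" using N.subgroup_axioms by (rule subgroup_imp_group)
  define E where "E = {x \<in> N. x [^] p = \<one>}"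
  have "E \<lhd> G"
  proof (rule normal_invI)
    show "subgroup E G"
    proof (rule subgroupI)
      show "E \<subseteq> carrier G" by (auto simp: E_def)
      have "\<one> \<in> E" by (simp add: E_def)
      then show "E \<noteq> {}" by blast
      show "inv g \<in> E" if "g \<in> E" for g using that by (simp add: E_def nat_pow_inv)
      show "g \<otimes> h \<in> E" if "g \<in> E" "h \<in> E" for g h
        using that by (simp add: E_def pow_mult_distrib[OF comm])
    qed
    show "x \<otimes> e \<otimes> inv x \<in> E" if "x \<in> carrier G" "e \<in> E" for x e
      using that N.inv_op_closed2 by (simp add: E_def conj_pow[symmetric])
  qed
  moreover have "E \<noteq> {\<one>}"
  proof -
    obtain y where "y \<in> N" "y \<noteq> \<one>" "y [^] p = \<one>"
      using GN.cauchy[OF p(1)] finite_subgroup[OF fin N.subgroup_axioms] p(2)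
      by (auto simp flip: nat_pow_consistent)
    then show ?thesis by (auto simp: E_def)
  qed
  ultimately have "E = N" using minimal_normalD(3)[OF N] by (auto simp: E_def)
  then show ?thesis using x by (auto simp: E_def)
qed

text \<open>The order of \<open>N\<close> is the order of its generator, and this divides any prime
  divisor \<open>p\<close> of \<open>card N\<close>, because \<open>N\<close> has exponent
  \<open>p\<close>.\<close>

lemma minimal_normal_cyclic_prime_card:
  assumes fin: "finite (carrier G)" and N: "chief_factor G N {\<one>}" and x: "N = generate G {x}" "x \<in> carrier G"
  shows "Factorial_Ring.prime (card N)"
proof -
  interpret N: normal N G by (rule minimal_normalD(1)[OF N])
  have comm: "y \<otimes> z = z \<otimes> y" if yz: "y \<in> N" "z \<in> N" for y z
  proof -
    obtain i j :: int where "y = x [^] i" "z = x [^] j" using yz x generate_pow[OF x(2)] by auto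
    then show ?thesis using int_pow_mult[OF x(2)] by (metis add.commute)
  qed
  have card: "card N = ord x" using generate_pow_card[OF x(2)] x(1) by simp
  have cN1: "card N \<noteq> 1" using card_eq_one_iff[OF N.subgroup_axioms] minimal_normalD(2)[OF N] by simp
  obtain p where p: "Factorial_Ring.prime p" "p dvd card N" using prime_factor_nat[OF cN1] by blast
  have "x \<in> N" unfolding x(1) by (simp add: generate.incl)
  then have "ord x dvd p"
    using minimal_normal_exponent[OF fin N comm p] pow_eq_id[OF x(2)] by blast
  then show ?thesis using card cN1 p(1) by (metis prime_nat_iff)
qed

lemma chief_factor_mult_eq:
  assumes HK: "chief_factor G H K" and D: "D \<lhd> G" "D \<subseteq> H" "\<not> D \<subseteq> K"
  shows "K <#> D = H"
proof -
  have HG: "subgroup H G" and KG: "K \<lhd> G" and KH: "K \<subseteq> H"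
    using HK normal_imp_subgroup by (auto simp: chief_factor_def)
  have "K <#> D \<lhd> G" by (rule normal_set_mult[OF KG D(1)])
  moreover have "K \<subseteq> K <#> D" "D \<subseteq> K <#> D"
    using subset_set_mult[OF normal_imp_subgroup[OF KG] normal_imp_subgroup[OF D(1)]] by auto
  moreover have "K <#> D \<subseteq> H" by (rule set_mult_subset[OF HG KH D(2)])
  ultimately show ?thesis using HK D(3) unfolding chief_factor_def by metis
qed

text \<open>Moves \<open>N\<close> to an isomorphic chief factor above \<open>S\<close>, where
  information on the quotient by \<open>S\<close> applies. A normal subgroup between
  \<open>S\<close> and the product is determined by its intersection with \<open>N\<close>.\<close>

lemma chief_factor_mult:
  assumes fin: "finite (carrier G)" and N: "chief_factor G N {\<one>}" and S: "S \<lhd> G" "N \<inter> S = {\<one>}"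
  shows "chief_factor G (N <#> S) S" "card (N <#> S) = card N * card S"
proof -
  have NG: "N \<lhd> G" and N1: "N \<noteq> {\<one>}" using N by (auto simp: chief_factor_def)
  interpret N: normal N G by fact
  interpret S: normal S G by fact
  show card: "card (N <#> S) = card N * card S"
    using card_set_mult[OF fin N.subgroup_axioms S.subgroup_axioms] S(2) by simp
  show "chief_factor G (N <#> S) S"
    unfolding chief_factor_def
  proof (intro conjI allI impI)
    show "N <#> S \<lhd> G" by (rule normal_set_mult[OF NG S(1)])
    show "S \<lhd> G" by (rule S(1))
    have "S \<subseteq> N <#> S" "N \<subseteq> N <#> S" using subset_set_mult N.subgroup_axioms S.subgroup_axioms by auto
    moreover have "N \<noteq> {}" using N.one_closed by blast
    then have "\<not> N \<subseteq> S" using S(2) N1 by blast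
    ultimately show "S \<subset> N <#> S" by blast
    fix L assume L: "L \<lhd> G \<and> S \<subseteq> L \<and> L \<subseteq> N <#> S"
    then interpret L: normal L G by simp
    have "L \<inter> N \<lhd> G" using L NG normal_subgroup_intersect by blast
    then consider "L \<inter> N = {\<one>}" | "L \<inter> N = N"
      using N L.one_closed N.one_closed by (auto simp: chief_factor_def)
    then show "L = S \<or> L = N <#> S"
    proof cases
      case 1
      have "L \<subseteq> S"
      proof
        fix x assume x: "x \<in> L"
        then have "x \<in> N <#> S" using L by blast
        then obtain n s where ns: "n \<in> N" "s \<in> S" "x = n \<otimes> s" by (rule set_multE)
        then have "s \<in> L" using L by blast
        then have "x \<otimes> inv s \<in> L" using x by simp
        then have "n \<in> L" using ns by (simp add: m_assoc)
        then have "n = \<one>" using 1 ns by blast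
        then show "x \<in> S" using ns by simp
      qed
      then show ?thesis using L by blast
    next
      case 2
      then have "N <#> S \<subseteq> L" using L set_mult_subset[OF L.subgroup_axioms] by blast
      then show ?thesis using L by blast
    qed
  qed
qed

end

section \<open>Minimal normal subgroups\<close>

text \<open>Speaks about the quotient by \<open>N\<close> inside the fixed group \<open>G\<close>,
  so that an induction over quotients does not change the type of the elements.\<close>

definition prime_chief_factors_above :: "('a, 'b) monoid_scheme \<Rightarrow> 'a set \<Rightarrow> bool"
  where "prime_chief_factors_above G N \<longleftrightarrow>
    (\<forall>H K. chief_factor G H K \<and> N \<subseteq> K \<longrightarrow> (\<exists>p. Factorial_Ring.prime p \<and> card H = p * card K))"

context group
begin

text \<open>A subgroup of prime order in the quotient has a preimage strictly above
  \<open>M\<close>, which must be the whole group.\<close>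

lemma normal_maximal_prime_index:
  assumes fin: "finite (carrier G)" and M: "maximal_subgroup M G" "M \<lhd> G"
  shows "\<exists>p. Factorial_Ring.prime p \<and> card (carrier G) = p * card M"
proof -
  interpret M: normal M G by fact
  interpret f: epi_hom G "G Mod M" "\<lambda>x. M #> x" by (rule epi_hom_Mod[OF M(2) fin])
  have ker: "f.ker = M" by (rule kernel_Mod[OF M(2)])
  have c: "card (carrier G) = card (carrier (G Mod M)) * card M" using f.card_carrier ker by simp
  have Mpos: "card M > 0" using card_subgroup_pos[OF fin M.subgroup_axioms] .
  have "card (carrier (G Mod M)) \<noteq> 1"
  proof
    assume "card (carrier (G Mod M)) = 1"
    then have "M = carrier G" using c subgroup_eqI_card[OF fin subgroup_self M.subset] by simp
    then show False using M(1) by (simp add: maximal_subgroup_def)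
  qed
  then obtain p where p: "Factorial_Ring.prime p" "p dvd card (carrier (G Mod M))"
    using prime_factor_nat by blast
  then obtain m where "order (G Mod M) = p ^ 1 * m" by (auto simp: order_def)
  then obtain P where P: "subgroup P (G Mod M)" "card P = p ^ 1"
    using sylow_thm[OF p(1) f.H.group_axioms _ f.finite_H] by blast
  have preP: "subgroup (f.pre P) G" "M \<subseteq> f.pre P" "card (f.pre P) = p * card M"
    using f.subgroup_pre[OF P(1)] f.ker_subset_pre[OF P(1)] f.card_pre[OF P(1)] P(2) ker by auto
  have "f.pre P \<noteq> M"
  proof
    assume "f.pre P = M"
    then have "p = 1" using preP(3) Mpos by simp
    then show False using p(1) by simp
  qed
  then have "f.pre P = carrier G" using M(1) preP by (auto simp: maximal_subgroup_def)
  then show ?thesis using preP(3) p(1) by auto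
qed

lemma maximal_normalI:
  assumes fin: "finite (carrier G)" and M: "maximal_subgroup M G"
    and y: "y \<in> carrier G" "y \<notin> M" "\<forall>x\<in>M. y \<otimes> x \<otimes> inv y \<in> M"
  shows "M \<lhd> G"
proof -
  have MG: "subgroup M G" using M by (simp add: maximal_subgroup_def)
  have "y \<in> normer M" using y by (simp add: normer_def)
  then have "normer M \<noteq> M" using y(2) by blast
  then have "normer M = carrier G"
    using M subgroup_normer[OF fin MG] subset_normer[OF MG] by (auto simp: maximal_subgroup_def)
  then show ?thesis by (rule normer_eq_carrier[OF MG])
qed

text \<open>\<open>L\<close> is the core of \<open>M\<close>, stated in a form that passes to quotients.\<close>
definition core_quotient :: "'a set \<Rightarrow> 'a set \<Rightarrow> nat \<Rightarrow> nat \<Rightarrow> nat \<Rightarrow> bool"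
  where "core_quotient M L p q n \<longleftrightarrow>
    L \<lhd> G \<and> L \<subseteq> M \<and> (\<forall>S. S \<lhd> G \<and> S \<subseteq> M \<longrightarrow> S \<subseteq> L) \<and>
    Factorial_Ring.prime p \<and> Factorial_Ring.prime q \<and>
    card (carrier G) = p * q ^ n * card L \<and> card (carrier G) = p * card M"

definition good_maximal :: "'a set \<Rightarrow> bool"
  where "good_maximal M \<longleftrightarrow> M \<lhd> G \<or> (\<exists>L p q n. core_quotient M L p q n)"

text \<open>If \<open>M\<close> is normal, \<open>N\<close> complements it and its order is the
  prime index. Otherwise \<open>N\<close> embeds in \<open>G Mod L\<close>, of order
  \<open>p q^n\<close>, which has a normal subgroup of order \<open>p\<close>. Either
  \<open>N\<close> goes into it and has order \<open>p\<close>, or \<open>N\<close> is a normal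
  \<open>q\<close>-group and falls into the Sylow subgroup \<open>M/L\<close>, against the choice of
  \<open>M\<close>.\<close>

lemma card_chief_factor_not_in_maximal:
  assumes fin: "finite (carrier G)" and N: "chief_factor G N {\<one>}"
    and M: "maximal_subgroup M G" "\<not> N \<subseteq> M" "good_maximal M"
  shows "Factorial_Ring.prime (card N)"
proof -
  note NG = minimal_normalD(1)[OF N] and N1 = minimal_normalD(2)[OF N] and Nmin = minimal_normalD(3)[OF N]
  interpret N: normal N G by fact
  have MG: "subgroup M G" and MG': "M \<noteq> carrier G" using M(1) by (auto simp: maximal_subgroup_def)
  interpret M: subgroup M G by fact
  have cN1: "card N \<noteq> 1" using card_eq_one_iff[OF N.subgroup_axioms] N1 by simp
  have int: "N \<inter> S = {\<one>}" if S: "S \<lhd> G" "\<not> N \<subseteq> S" for S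
    using Nmin[of "N \<inter> S"] normal_subgroup_intersect[OF NG S(1)] S(2) by blast
  have normal_case: ?thesis if Mn: "M \<lhd> G"
  proof -
    obtain p where p: "Factorial_Ring.prime p" "card (carrier G) = p * card M"
      using normal_maximal_prime_index[OF fin M(1) Mn] by blast
    have "N <#> M \<lhd> G" by (rule normal_set_mult[OF NG Mn])
    then have "subgroup (N <#> M) G" by (rule normal_imp_subgroup)
    then have "N <#> M = carrier G"
      using M(1,2) subset_set_mult[OF N.subgroup_axioms MG] by (auto simp: maximal_subgroup_def)
    then have "card (carrier G) = card N * card M"
      using card_set_mult[OF fin N.subgroup_axioms MG] int[OF Mn M(2)] by simp
    then show ?thesis using p card_subgroup_pos[OF fin MG] by simp
  qed
  show ?thesis
  proof (cases "M \<lhd> G")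
    case True
    then show ?thesis by (rule normal_case)
  next
    case False
    then obtain L p q n where "core_quotient M L p q n" using M(3) by (auto simp: good_maximal_def)
    then have L: "L \<lhd> G" "L \<subseteq> M" "\<And>S. S \<lhd> G \<Longrightarrow> S \<subseteq> M \<Longrightarrow> S \<subseteq> L"
      and p: "Factorial_Ring.prime p" and q: "Factorial_Ring.prime q"
      and card: "card (carrier G) = p * q ^ n * card L" "card (carrier G) = p * card M"
      unfolding core_quotient_def by blast+
    interpret L: normal L G by fact
    have Lpos: "card L > 0" using card_subgroup_pos[OF fin L.subgroup_axioms] .
    have p0: "p > 0" using p prime_gt_0_nat by simp
    have q0: "q ^ n > 0" using q prime_gt_0_nat by simp
    have cM: "card M = q ^ n * card L" using card p0 by simp
    interpret f: epi_hom G "G Mod L" "\<lambda>x. L #> x" by (rule epi_hom_Mod[OF L(1) fin])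
    have ker: "f.ker = L" by (rule kernel_Mod[OF L(1)])
    have cQ: "card (carrier (G Mod L)) = p * q ^ n" using f.card_carrier ker card(1) Lpos by simp
    let ?M = "(\<lambda>x. L #> x) ` M"
    have M': "subgroup ?M (G Mod L)" by (rule f.subgroup_image[OF MG])
    have preM: "f.pre ?M = M" using f.pre_image[OF MG] ker L(2) by simp
    have cM': "card ?M = q ^ n" using f.card_eq_card_image[OF MG] ker L(2) cM Lpos by simp
    \<comment> \<open>Otherwise \<open>G Mod L\<close> is a \<open>p\<close>-group; the image of
      \<open>M\<close> is then properly contained in its normalizer, and the maximal subgroup
      \<open>M\<close> would be normal.\<close>
    have "p \<noteq> q"
    proof
      assume "p = q"
      then have "card (carrier (G Mod L)) = p ^ Suc n" using cQ by simp
      moreover have "?M \<noteq> carrier (G Mod L)" using preM MG' f.pre_carrier by metis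
      ultimately obtain z where z: "z \<in> carrier (G Mod L) - ?M"
        "\<forall>g\<in>?M. z \<otimes>\<^bsub>G Mod L\<^esub> g \<otimes>\<^bsub>G Mod L\<^esub> inv\<^bsub>G Mod L\<^esub> z \<in> ?M"
        using f.H.normalizer_grows[OF p f.finite_H _ M'] by metis
      then obtain y where y: "y \<in> carrier G" "z = L #> y" using f.memE by blast
      have "y \<notin> M" using z(1) y(2) by blast
      moreover have "y \<otimes> x \<otimes> inv y \<in> M" if "x \<in> M" for x
      proof -
        have "L #> (y \<otimes> x \<otimes> inv y) \<in> ?M"
          using z(2) that y f.hom_mult f.hom_inv by (simp del: mult_FactGroup)
        then have "y \<otimes> x \<otimes> inv y \<in> f.pre ?M" using y(1) that by (simp add: f.pre_def)
        then show ?thesis using preM by simp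
      qed
      ultimately show False using maximal_normalI[OF fin M(1) y(1)] False by blast
    qed
    have "n \<noteq> 0"
    proof
      assume "n = 0"
      then have "L = M" using subgroup_eqI_card[OF fin MG L(2)] cM by simp
      then show False using False L(1) by simp
    qed
    \<comment> \<open>The preimage of this core is a normal subgroup inside \<open>M\<close>, so it
      is already contained in \<open>L\<close>.\<close>
    have core: "core (G Mod L) ?M = {\<one>\<^bsub>G Mod L\<^esub>}"
    proof -
      let ?C = "core (G Mod L) ?M"
      have C: "?C \<lhd> G Mod L" by (rule f.H.normal_core[OF M'])
      have "f.pre ?C \<subseteq> M" using f.pre_mono[OF f.H.core_subset[OF M']] preM by simp
      then have "f.pre ?C \<subseteq> L" using L(3) f.normal_pre[OF C] by blast
      then have "f.pre ?C = L" using f.ker_subset_pre[OF normal_imp_subgroup[OF C]] ker by blast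
      then have "card ?C = 1" using f.card_pre[OF normal_imp_subgroup[OF C]] ker Lpos by simp
      then show ?thesis using f.H.card_eq_one_iff[OF normal_imp_subgroup[OF C]] by blast
    qed
    obtain P where P: "P \<lhd> G Mod L" "card P = p"
      using f.H.normal_subgroup_of_order_prime[OF f.finite_H p q \<open>p \<noteq> q\<close> cQ _ M' cM' core] \<open>n \<noteq> 0\<close> by auto
    have P': "f.pre P \<lhd> G" "card (f.pre P) = p * card L"
      using f.normal_pre[OF P(1)] f.card_pre[OF normal_imp_subgroup[OF P(1)]] P(2) ker by auto
    have "\<not> N \<subseteq> L" using L(2) M(2) by blast
    then have NL: "N \<inter> L = {\<one>}" using int L(1) by blast
    have NLG: "N <#> L \<lhd> G" by (rule normal_set_mult[OF NG L(1)])
    have cNL: "card (N <#> L) = card N * card L"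
      using card_set_mult[OF fin N.subgroup_axioms L.subgroup_axioms] NL by simp
    show ?thesis
    proof (cases "N \<subseteq> f.pre P")
      case True
      have "L \<subseteq> f.pre P" using f.ker_subset_pre[OF normal_imp_subgroup[OF P(1)]] ker by simp
      then have "N <#> L \<subseteq> f.pre P" using set_mult_subset[OF normal_imp_subgroup[OF P'(1)] True] by blast
      then have "card N * card L dvd p * card L"
        using card_subgroup_dvd[OF normal_imp_subgroup[OF NLG] normal_imp_subgroup[OF P'(1)]] cNL P'(2) by simp
      then have "card N dvd p" using Lpos by simp
      then have "card N = p" using p cN1 by (auto simp: prime_nat_iff)
      then show ?thesis using p by simp
    next
      case False
      \<comment> \<open>The product of \<open>N\<close> and the preimage of \<open>P\<close> has
        order \<open>card N * (p * card L)\<close>, which divides the group order; what is left for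
        \<open>card N\<close> is a divisor of \<open>q ^ n\<close>.\<close>
      then have "N \<inter> f.pre P = {\<one>}" using int P'(1) by blast
      then have "card (N <#> f.pre P) = card N * (p * card L)"
        using card_set_mult[OF fin N.subgroup_axioms normal_imp_subgroup[OF P'(1)]] P'(2) by simp
      moreover have "subgroup (N <#> f.pre P) G" using normal_imp_subgroup[OF normal_set_mult[OF NG P'(1)]] .
      ultimately have "card N * (p * card L) dvd q ^ n * (p * card L)"
        using card_subgroup_dvd[OF _ subgroup_self] subgroup.subset card(1) by (metis mult.assoc mult.commute)
      then have "card N dvd q ^ n" using Lpos p0 by auto
      then obtain j where j: "card N = q ^ j" using divides_primepow_nat[OF q] by blast
      let ?N = "(\<lambda>x. L #> x) ` N"
      have N': "?N \<lhd> G Mod L" by (rule f.normal_image[OF NG])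
      have "f.pre ?N = N <#> L"
      proof
        have "N <#> L \<subseteq> carrier G" using normal_imp_subgroup[OF NLG] subgroup.subset by blast
        moreover have "L #> (x \<otimes> y) = L #> x" if "x \<in> N" "y \<in> L" for x y
          using that rcos_eq_iff[OF L.subgroup_axioms, of "x \<otimes> y" x] L.inv_op_closed2[of x y] by simp
        ultimately show "N <#> L \<subseteq> f.pre ?N" by (fastforce simp: f.pre_def elim!: set_multE)
        show "f.pre ?N \<subseteq> N <#> L"
        proof
          fix x assume "x \<in> f.pre ?N"
          then obtain y where y: "x \<in> carrier G" "y \<in> N" "L #> x = L #> y" by (auto simp: f.pre_def)
          then have "x \<otimes> inv y \<in> L" using rcos_eq_iff[OF L.subgroup_axioms] by simp
          then have "inv y \<otimes> (x \<otimes> inv y) \<otimes> y \<in> L" using y L.inv_op_closed1 by simp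
          then have "y \<otimes> (inv y \<otimes> x) \<in> N <#> L" using y by (intro set_multI) (simp_all add: m_assoc)
          then show "x \<in> N <#> L" using y by simp
        qed
      qed
      then have "card ?N = q ^ j" using f.card_pre[OF normal_imp_subgroup[OF N']] ker cNL Lpos j by simp
      moreover have "\<not> q dvd card (carrier (G Mod L)) div card ?M"
        using cQ cM' q0 primes_dvd_imp_eq[OF q p] \<open>p \<noteq> q\<close> by auto
      ultimately have "?N \<subseteq> ?M" using f.H.sylow_normalI[OF q f.finite_H N' _ M'] by blast
      then have "f.pre ?N \<subseteq> M" using f.pre_mono[of ?N ?M] preM by simp
      moreover have "N \<subseteq> f.pre ?N" by (auto simp: f.pre_def)
      ultimately show ?thesis using M(2) by blast
    qed
  qed
qed

section \<open>Minimal normal subgroups contained in every maximal subgroup\<close>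

lemma sylow_in:
  assumes r: "Factorial_Ring.prime r" and fin: "finite (carrier G)" and L: "subgroup L G" "card L = r ^ a * m" "\<not> r dvd m"
  shows "\<exists>R. subgroup R G \<and> R \<subseteq> L \<and> card R = r ^ a \<and> \<not> r dvd card L div card R"
proof -
  interpret L: group "G\<lparr>carrier := L\<rparr>" using L(1) by (rule subgroup_imp_group)
  obtain R where R: "subgroup R (G\<lparr>carrier := L\<rparr>)" "card R = r ^ a"
    using sylow_thm[OF r L.group_axioms, of a m] L(2) finite_subgroup[OF fin L(1)] by (auto simp: order_def)
  have "R \<subseteq> L" using subgroup.subset[OF R(1)] by simp
  moreover have "card L div card R = m" using L(2) R(2) r prime_gt_0_nat[OF r] by simp
  ultimately show ?thesis using R incl_subgroup[OF L(1) R(1)] L(3) by auto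
qed

text \<open>If \<open>x z x\<^sup>-\<^sup>1 = w z\<close> and \<open>x w x\<^sup>-\<^sup>1 = w\<close> modulo \<open>N\<close>, then \<open>z = x\<^sup>r z x\<^bsup>-r\<^esup> = w\<^sup>r z\<close>.\<close>
lemma coprime_action_trivial:
  assumes fin: "finite (carrier G)" and r: "Factorial_Ring.prime r" and p: "Factorial_Ring.prime p" and rp: "r \<noteq> p"
    and N: "N \<lhd> G" and P: "P \<lhd> G" "card P = p ^ m"
    and x: "x \<in> carrier G" "x [^] r = \<one>"
    and triv: "\<And>H K. chief_factor G H K \<Longrightarrow> N \<subseteq> K \<Longrightarrow> H \<subseteq> P \<Longrightarrow> x \<in> factor_centralizer G H K"
    and Z: "Z \<lhd> G" "N \<subseteq> Z" "Z \<subseteq> P" and z: "z \<in> Z"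
  shows "x \<otimes> z \<otimes> inv x \<otimes> inv z \<in> N"
  using Z z
proof (induction "card Z" arbitrary: Z z rule: less_induct)
  case less
  interpret Z: normal Z G by (rule less.prems(1))
  interpret N: normal N G by fact
  interpret P: normal P G by fact
  show ?case
  proof (cases "Z = N")
    case True
    have zN: "z \<in> N" using less.prems(4) True by simp
    then have "x \<otimes> z \<otimes> inv x \<in> N" using x(1) N.inv_op_closed2 by simp
    then show ?thesis using zN by simp
  next
    case False
    \<comment> \<open>The commutator \<open>w\<close> of \<open>x\<close> and \<open>z\<close> falls
      into the smaller subgroup \<open>W\<close>, so the induction hypothesis makes \<open>x\<close>
      commute with \<open>w\<close> modulo \<open>N\<close>.\<close>
    then obtain W where W: "chief_factor G Z W" "N \<subseteq> W"
      using chief_factor_below[OF fin N less.prems(1)] less.prems(2) by blast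
    have WG: "W \<lhd> G" "W \<subset> Z" using W(1) by (auto simp: chief_factor_def)
    define w where "w = x \<otimes> z \<otimes> inv x \<otimes> inv z"
    have zG: "z \<in> carrier G" using less.prems(4) by simp
    have wG: "w \<in> carrier G" using zG x(1) by (simp add: w_def)
    have "w \<in> W"
      using triv[OF W(1,2)] less.prems(3,4) mem_factor_centralizer_iff[OF less.prems(1) WG(1)] by (auto simp: w_def)
    moreover have "card W < card Z"
      using WG(2) finite_subgroup[OF fin Z.subgroup_axioms] by (simp add: psubset_card_mono)
    ultimately have w: "x \<otimes> w \<otimes> inv x \<otimes> inv w \<in> N"
      using less.hyps[OF _ WG(1) W(2)] WG(2) less.prems(3) by blast
    interpret f: epi_hom G "G Mod N" "\<lambda>x. N #> x" by (rule epi_hom_Mod[OF N fin])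
    let ?f = "\<lambda>x. N #> x" and ?Q = "G Mod N"
    have c: "?f x \<in> carrier ?Q" "?f w \<in> carrier ?Q" "?f z \<in> carrier ?Q" using x zG wG f.hom_closed by auto
    have hom: "?f (g \<otimes> h \<otimes> inv g) = ?f g \<otimes>\<^bsub>?Q\<^esub> ?f h \<otimes>\<^bsub>?Q\<^esub> inv\<^bsub>?Q\<^esub> (?f g)"
      if "g \<in> carrier G" "h \<in> carrier G" for g h
      using that f.hom_mult f.hom_inv by (simp del: mult_FactGroup)
    have xw: "?f x \<otimes>\<^bsub>?Q\<^esub> ?f w \<otimes>\<^bsub>?Q\<^esub> inv\<^bsub>?Q\<^esub> (?f x) = ?f w"
      using rcos_eq_iff[OF N.subgroup_axioms, of "x \<otimes> w \<otimes> inv x" w] w hom[OF x(1) wG] wG x(1) by simp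
    have "w \<otimes> z = x \<otimes> z \<otimes> inv x" using x(1) zG by (simp add: w_def m_assoc)
    then have xz: "?f x \<otimes>\<^bsub>?Q\<^esub> ?f z \<otimes>\<^bsub>?Q\<^esub> inv\<^bsub>?Q\<^esub> (?f x) = ?f w \<otimes>\<^bsub>?Q\<^esub> ?f z"
      using hom[OF x(1) zG] f.hom_mult[OF wG zG] by simp
    have iter: "(?f x [^]\<^bsub>?Q\<^esub> i) \<otimes>\<^bsub>?Q\<^esub> ?f z \<otimes>\<^bsub>?Q\<^esub> inv\<^bsub>?Q\<^esub> (?f x [^]\<^bsub>?Q\<^esub> i) = (?f w [^]\<^bsub>?Q\<^esub> i) \<otimes>\<^bsub>?Q\<^esub> ?f z"
      for i :: nat
    proof (induction i)
      case 0
      then show ?case using c by (simp del: mult_FactGroup one_FactGroup)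
    next
      case (Suc i)
      have "(?f x [^]\<^bsub>?Q\<^esub> Suc i) = ?f x \<otimes>\<^bsub>?Q\<^esub> (?f x [^]\<^bsub>?Q\<^esub> i)" using c(1) by (rule f.H.nat_pow_Suc2)
      then have "(?f x [^]\<^bsub>?Q\<^esub> Suc i) \<otimes>\<^bsub>?Q\<^esub> ?f z \<otimes>\<^bsub>?Q\<^esub> inv\<^bsub>?Q\<^esub> (?f x [^]\<^bsub>?Q\<^esub> Suc i)
          = ?f x \<otimes>\<^bsub>?Q\<^esub> ((?f w [^]\<^bsub>?Q\<^esub> i) \<otimes>\<^bsub>?Q\<^esub> ?f z) \<otimes>\<^bsub>?Q\<^esub> inv\<^bsub>?Q\<^esub> (?f x)"
        using c f.H.conj_conj Suc by (simp del: mult_FactGroup one_FactGroup)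
      also have "\<dots> = (?f w [^]\<^bsub>?Q\<^esub> i) \<otimes>\<^bsub>?Q\<^esub> (?f w \<otimes>\<^bsub>?Q\<^esub> ?f z)"
        using c f.H.conj_mult f.H.conj_pow xw xz by (simp del: mult_FactGroup one_FactGroup)
      finally show ?case using c by (simp add: f.H.m_assoc del: mult_FactGroup one_FactGroup)
    qed
    have "?f x [^]\<^bsub>?Q\<^esub> r = \<one>\<^bsub>?Q\<^esub>" using f.hom_nat_pow[OF x(1), of r] x(2) f.hom_one by simp
    then have "(?f w [^]\<^bsub>?Q\<^esub> r) \<otimes>\<^bsub>?Q\<^esub> ?f z = ?f z" using iter[of r] c by (simp del: mult_FactGroup one_FactGroup)
    then have "?f w [^]\<^bsub>?Q\<^esub> r = \<one>\<^bsub>?Q\<^esub>"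
      using c f.H.r_cancel_one f.H.nat_pow_closed by (simp del: mult_FactGroup one_FactGroup)
    \<comment> \<open>The order of \<open>w\<close> modulo \<open>N\<close> divides both
      \<open>r\<close> and \<open>p ^ m\<close>, so \<open>w\<close> is trivial there.\<close>
    moreover have "w [^] (p ^ m) = \<one>"
      using pow_card_eq_one[OF P.subgroup_axioms, of w] \<open>w \<in> W\<close> WG(2) less.prems(3) P(2) by auto
    then have "?f w [^]\<^bsub>?Q\<^esub> (p ^ m) = \<one>\<^bsub>?Q\<^esub>" using f.hom_nat_pow[OF wG, of "p ^ m"] f.hom_one by simp
    moreover have "coprime r (p ^ m)" using primes_coprime[OF r p rp] by simp
    ultimately have "?f w = \<one>\<^bsub>?Q\<^esub>" using f.H.pow_coprime_eq_one[OF c(2)] by blast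
    then have "N #> w = N" by simp
    then show ?thesis using coset_join1[OF _ wG N.subgroup_axioms] by (simp add: w_def)
  qed
qed

text \<open>Maximal subgroups give no direct information on such an \<open>N\<close>. If another
  normal subgroup avoids it, \<open>N\<close> is isomorphic to a chief factor of a proper quotient.
  Otherwise every nontrivial normal subgroup contains \<open>N\<close>; this uniqueness finally
  contradicts any normal subgroup of order prime to \<open>p\<close> and so controls the centralizer
  \<open>A\<close> below.\<close>

lemma card_chief_factor_in_all_maximals:
  assumes fin: "finite (carrier G)" and N: "chief_factor G N {\<one>}"
    and Nmax: "\<And>M. maximal_subgroup M G \<Longrightarrow> N \<subseteq> M"
    and CF: "\<And>S. S \<lhd> G \<Longrightarrow> S \<noteq> {\<one>} \<Longrightarrow> prime_chief_factors_above G S"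
  shows "Factorial_Ring.prime (card N)"
proof (cases "\<exists>S. S \<lhd> G \<and> S \<noteq> {\<one>} \<and> N \<inter> S = {\<one>}")
  case True
  then obtain S where S: "S \<lhd> G" "S \<noteq> {\<one>}" "N \<inter> S = {\<one>}" by blast
  have ch: "chief_factor G (N <#> S) S" "card (N <#> S) = card N * card S"
    using chief_factor_mult[OF fin N S(1,3)] by auto
  then obtain p where "Factorial_Ring.prime p" "card (N <#> S) = p * card S"
    using CF[OF S(1,2)] unfolding prime_chief_factors_above_def by blast
  then show ?thesis using ch(2) card_subgroup_pos[OF fin normal_imp_subgroup[OF S(1)]] by simp
next
  case False
  note NG = minimal_normalD(1)[OF N] and N1 = minimal_normalD(2)[OF N] and Nmin = minimal_normalD(3)[OF N]
  interpret N: normal N G by fact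
  have uniq: "N \<subseteq> S" if S: "S \<lhd> G" "S \<noteq> {\<one>}" for S
  proof -
    have "N \<inter> S \<noteq> {\<one>}" using False S by blast
    then show ?thesis using Nmin[OF normal_subgroup_intersect[OF NG S(1)]] by blast
  qed
  have finN: "finite N" by (rule finite_subgroup[OF fin N.subgroup_axioms])
  have cN1: "card N \<noteq> 1" using card_eq_one_iff[OF N.subgroup_axioms] N1 by simp
  obtain p where p: "Factorial_Ring.prime p" "p dvd card N" using prime_factor_nat[OF cN1] by blast
  have "card N \<noteq> 0" using card_subgroup_pos[OF fin N.subgroup_axioms] by simp
  then obtain c where c: "card N = p ^ multiplicity p (card N) * c" "\<not> p dvd c"
    using multiplicity_decompose'[of "card N" p] p(1) not_prime_unit by metis
  define a where "a = multiplicity p (card N)"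
  have a0: "a \<noteq> 0"
  proof
    assume "a = 0"
    then have "card N = c" using c(1) by (simp add: a_def)
    then show False using c(2) p(2) by simp
  qed
  obtain R where R: "subgroup R G" "R \<subseteq> N" "card R = p ^ a" "\<not> p dvd card N div card R"
    using sylow_in[OF p(1) fin N.subgroup_axioms, of a c] c by (auto simp: a_def)
  \<comment> \<open>The Frattini argument applied to \<open>N\<close> itself: a Sylow subgroup of
    \<open>N\<close> is normal in \<open>G\<close>, so by minimality \<open>N\<close> is a
    \<open>p\<close>-group.\<close>
  have "R \<lhd> G"
    using frattini_normal[OF p(1) fin NG R _ Nmax] subset_set_mult(1)[OF N.subgroup_axioms R(1)] by blast
  moreover have "R \<noteq> {\<one>}"
  proof
    assume "R = {\<one>}"
    then have "p ^ a = 1" using R(3) by simp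
    then show False using one_less_power[OF prime_gt_1_nat[OF p(1)], of a] a0 by simp
  qed
  ultimately have "R = N" using Nmin R(2) by blast
  then have cN: "card N = p ^ a" using R(3) by simp
  have p1: "p > 1" using prime_gt_1_nat[OF p(1)] .
  have ppos: "p ^ i > 0" for i using p1 by simp

  \<comment> \<open>A Sylow \<open>r\<close>-subgroup of \<open>L\<close> complements
    \<open>N\<close> in \<open>L\<close>. The Frattini argument makes it normal in \<open>G\<close>,
    although it avoids \<open>N\<close>.\<close>
  have no_r: False if L: "L \<lhd> G" "N \<subseteq> L" "card L = r * card N" and r: "Factorial_Ring.prime r" "r \<noteq> p" for L r
  proof -
    interpret L: normal L G by (rule L(1))
    have ndvd: "\<not> r dvd p ^ a" using r p(1) by (meson prime_dvd_power primes_dvd_imp_eq)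
    obtain R where R: "subgroup R G" "R \<subseteq> L" "card R = r ^ 1" "\<not> r dvd card L div card R"
      using sylow_in[OF r(1) fin L.subgroup_axioms, of 1 "p ^ a"] L(3) cN ndvd by auto
    have "coprime (p ^ a) (r ^ 1)"
      using coprime_commute[THEN iffD1, OF prime_imp_coprime[OF r(1) ndvd]] by simp
    then have NR: "N \<inter> R = {\<one>}" using Int_coprime_card[OF N.subgroup_axioms R(1)] cN R(3) by simp
    have "card (N <#> R) = card L"
      using card_set_mult[OF fin N.subgroup_axioms R(1)] NR R(3) L(3) by simp
    then have "N <#> R = L"
      using subgroup_eqI_card[OF fin L.subgroup_axioms set_mult_subset[OF L.subgroup_axioms L(2) R(2)]] by simp
    then have "R \<lhd> G" using frattini_normal[OF r(1) fin L(1) R _ Nmax] by blast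
    moreover have "R \<noteq> {\<one>}" using R(3) prime_gt_1_nat[OF r(1)] by auto
    ultimately have "N \<subseteq> R" using uniq by blast
    then have "N = {\<one>}" using NR by blast
    then show False using N1 by simp
  qed

  let ?P = "\<lambda>P. P \<lhd> G \<and> N \<subseteq> P \<and> (\<exists>m. card P = p ^ m)"
  have "\<exists>P. ?P P \<and> (\<forall>J. ?P J \<longrightarrow> card J \<le> card P)"
  proof (rule ex_has_greatest_nat[of ?P _ _ "Suc (card (carrier G))"])
    show "?P N" using NG cN by blast
    show "\<forall>J. ?P J \<longrightarrow> card J < Suc (card (carrier G))"
      using card_mono[OF fin subgroup.subset[OF normal_imp_subgroup]] by (simp add: le_imp_less_Suc)
  qed
  then obtain P where PP: "?P P" and Pmax: "\<And>J. ?P J \<Longrightarrow> card J \<le> card P" by blast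
  then obtain m where P: "P \<lhd> G" "N \<subseteq> P" "card P = p ^ m" by blast
  interpret P: normal P G by (rule P(1))
  have P1: "P \<noteq> {\<one>}" using P(2) N1 N.one_closed by blast

  have CFN: "\<exists>r. Factorial_Ring.prime r \<and> card H = r * card K" if "chief_factor G H K" "N \<subseteq> K" for H K
    using CF[OF NG N1] that unfolding prime_chief_factors_above_def by blast
  have CFP: "card H = p * card K" if HK: "chief_factor G H K" "N \<subseteq> K" "H \<subseteq> P" for H K
  proof -
    have H: "subgroup H G" using HK(1) normal_imp_subgroup by (auto simp: chief_factor_def)
    obtain r where r: "Factorial_Ring.prime r" "card H = r * card K" using CFN[OF HK(1,2)] by blast
    have "card H dvd p ^ m" using card_subgroup_dvd[OF H P.subgroup_axioms HK(3)] P(3) by simp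
    then have "r dvd p ^ m" using r(2) dvd_mult_left by metis
    then have "r = p" using r(1) p(1) by (meson prime_dvd_power primes_dvd_imp_eq)
    then show ?thesis using r(2) by simp
  qed
  let ?chief = "\<lambda>H K. chief_factor G H K \<and> N \<subseteq> K \<and> H \<subseteq> P"
  \<comment> \<open>The common centralizer of all chief factors between \<open>N\<close> and
    \<open>P\<close>. Modulo each single centralizer \<open>G\<close> is abelian of exponent
    dividing \<open>p - 1\<close>, hence also modulo \<open>A\<close>; the aim is
    \<open>A = P\<close>.\<close>
  define A where "A = {g \<in> carrier G. \<forall>H K. ?chief H K \<longrightarrow> g \<in> factor_centralizer G H K}"
  have chiefD: "H \<lhd> G" "K \<lhd> G" "K \<subseteq> H" "card H = p * card K" if "?chief H K" for H K
  proof -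
    show "H \<lhd> G" "K \<lhd> G" "K \<subseteq> H" using that unfolding chief_factor_def by blast+
    show "card H = p * card K" using CFP that by blast
  qed
  have cent: "factor_centralizer G H K \<lhd> G" if "?chief H K" for H K
    using normal_factor_centralizer[OF fin chiefD(1-3)[OF that] p(1) chiefD(4)[OF that]] .
  have A: "A \<lhd> G"
  proof (rule normal_invI)
    have sub: "subgroup (factor_centralizer G H K) G" if "?chief H K" for H K
      using normal_imp_subgroup[OF cent[OF that]] .
    show "subgroup A G"
    proof (rule subgroupI)
      show "A \<subseteq> carrier G" by (auto simp: A_def)
      have "\<one> \<in> A" using subgroup.one_closed[OF sub] by (simp add: A_def)
      then show "A \<noteq> {}" by blast
      show "inv g \<in> A" if "g \<in> A" for g using that subgroup.m_inv_closed[OF sub] by (simp add: A_def)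
      show "g \<otimes> h \<in> A" if "g \<in> A" "h \<in> A" for g h using that subgroup.m_closed[OF sub] by (simp add: A_def)
    qed
    show "x \<otimes> g \<otimes> inv x \<in> A" if "x \<in> carrier G" "g \<in> A" for x g
      using that normal.inv_op_closed2[OF cent] by (simp add: A_def)
  qed
  interpret A: normal A G by (rule A)
  \<comment> \<open>\<open>P\<close> consists of \<open>p\<close>-elements, and these are trivial
    modulo each of the centralizers.\<close>
  have PA: "P \<subseteq> A"
  proof
    fix g assume g: "g \<in> P"
    have "g [^] (p ^ m) = \<one>" using pow_card_eq_one[OF P.subgroup_axioms g] P(3) by simp
    have "g \<in> factor_centralizer G H K" if HK: "?chief H K" for H K
    proof -
      have "\<one> \<in> factor_centralizer G H K" using subgroup.one_closed[OF normal_imp_subgroup[OF cent[OF HK]]] .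
      then have "g [^] (p ^ m) \<in> factor_centralizer G H K" by (simp only: \<open>g [^] (p ^ m) = \<one>\<close>)
      then show ?thesis
        using p_element_in_factor_centralizer[OF fin chiefD(1-3)[OF HK] p(1) chiefD(4)[OF HK] P.mem_carrier[OF g]]
        by blast
    qed
    then show "g \<in> A" unfolding A_def using P.mem_carrier[OF g] by blast
  qed
  \<comment> \<open>Otherwise a chief factor of prime order \<open>r\<close> lies above
    \<open>P\<close> inside \<open>A\<close>. If \<open>r = p\<close>, then \<open>P\<close> was not
    the largest normal \<open>p\<close>-subgroup; if not, a subgroup of order \<open>r\<close> gives
    a normal subgroup of order \<open>r * card N\<close>, excluded by \<open>no_r\<close>.\<close>
  have "A = P"
  proof (rule ccontr)
    assume "A \<noteq> P"
    then obtain L where L: "chief_factor G L P" "L \<subseteq> A"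
      using chief_factor_above[OF fin P(1) A] PA by blast
    have LG: "L \<lhd> G" "P \<subset> L" using L(1) by (auto simp: chief_factor_def)
    interpret L: normal L G by (rule LG(1))
    obtain r where r: "Factorial_Ring.prime r" "card L = r * card P" using CFN[OF L(1) P(2)] by blast
    show False
    proof (cases "r = p")
      case True
      then have "card L = p ^ Suc m" using r(2) P(3) by simp
      then have "?P L" using LG P(2) by blast
      then have "card L \<le> card P" by (rule Pmax)
      then show False using r P(3) prime_gt_1_nat[OF r(1)] ppos[of m] by simp
    next
      case rp: False
      have ndvd: "\<not> r dvd p ^ m" using r rp p(1) by (meson prime_dvd_power primes_dvd_imp_eq)
      obtain R where R: "subgroup R G" "R \<subseteq> L" "card R = r ^ 1" "\<not> r dvd card L div card R"
        using sylow_in[OF r(1) fin L.subgroup_axioms, of 1 "p ^ m"] r(2) P(3) ndvd by auto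
      interpret R: subgroup R G by (rule R(1))
      have R_pow: "x [^] r = \<one>" if "x \<in> R" for x using pow_card_eq_one[OF R(1) that] R(3) by simp
      have "coprime (p ^ m) (r ^ 1)"
        using coprime_commute[THEN iffD1, OF prime_imp_coprime[OF r(1) ndvd]] by simp
      then have PR: "P \<inter> R = {\<one>}" using Int_coprime_card[OF P.subgroup_axioms R(1)] P(3) R(3) by simp
      have "card (P <#> R) = card L"
        using card_set_mult[OF fin P.subgroup_axioms R(1)] PR R(3) r(2) by simp
      then have PRL: "P <#> R = L"
        using subgroup_eqI_card[OF fin L.subgroup_axioms set_mult_subset[OF L.subgroup_axioms _ R(2)]] LG(2) by simp
      \<comment> \<open>\<open>R\<close> lies in \<open>A\<close>, so it centralizes every chief
        factor between \<open>N\<close> and \<open>P\<close>; as its order is prime to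
        \<open>p\<close>, it centralizes all of \<open>P\<close> modulo \<open>N\<close>.\<close>
      have comm: "x \<otimes> z \<otimes> inv x \<otimes> inv z \<in> N" if x: "x \<in> R" and z: "z \<in> P" for x z
      proof (rule coprime_action_trivial[OF fin r(1) p(1) rp NG P(1,3) _ R_pow[OF x] _ P(1,2) _ z])
        show "x \<in> carrier G" using x by simp
        have "x \<in> A" using x R(2) L(2) by blast
        then show "x \<in> factor_centralizer G H K" if "chief_factor G H K" "N \<subseteq> K" "H \<subseteq> P" for H K
          using \<open>x \<in> A\<close> that unfolding A_def by blast
      qed simp
      \<comment> \<open>By the Frattini argument and \<open>L = P <#> R\<close>, every
        \<open>g\<close> is \<open>z \<otimes> y \<otimes> t\<close> with \<open>z\<close> in
        \<open>P\<close> and \<open>y\<close>, \<open>t\<close> normalizing \<open>R\<close>; by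
        \<open>comm\<close>, conjugation with \<open>z\<close> changes elements of \<open>R\<close>
        only by factors in \<open>N\<close>.\<close>
      have NRG: "N <#> R \<lhd> G"
      proof (rule normal_invI)
        show "subgroup (N <#> R) G" by (rule mult_norm_subgroup[OF NG R(1)])
        then interpret NR: subgroup "N <#> R" G .
        fix g h assume g: "g \<in> carrier G" and "h \<in> N <#> R"
        then obtain n x where nx: "n \<in> N" "x \<in> R" "h = n \<otimes> x" by (auto elim: set_multE)
        obtain l t where lt: "l \<in> L" "t \<in> normer R" "g = l \<otimes> t"
          using frattini[OF r(1) fin LG(1) R g] by blast
        have tG: "t \<in> carrier G" and tx: "t \<otimes> x \<otimes> inv t \<in> R" using lt(2) nx(2) by (auto simp: normer_def)
        have "l \<in> P <#> R" using lt(1) PRL by simp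
        then obtain z y where zy: "z \<in> P" "y \<in> R" "l = z \<otimes> y" by (rule set_multE)
        define x' where "x' = y \<otimes> (t \<otimes> x \<otimes> inv t) \<otimes> inv y"
        have x': "x' \<in> R" using zy(2) tx by (simp add: x'_def)
        have "inv (x' \<otimes> z \<otimes> inv x' \<otimes> inv z) \<in> N" using comm[OF x' zy(1)] by simp
        then have "z \<otimes> x' \<otimes> inv z \<otimes> inv x' \<in> N" using x' zy(1) by (simp add: inv_mult_group m_assoc)
        then have "(z \<otimes> x' \<otimes> inv z \<otimes> inv x') \<otimes> x' \<in> N <#> R" using x' by (rule set_multI)
        then have "z \<otimes> x' \<otimes> inv z \<in> N <#> R" using x' zy(1) by (simp add: m_assoc)
        moreover have "z \<otimes> x' \<otimes> inv z = g \<otimes> x \<otimes> inv g"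
          using zy tG nx(2) by (simp add: x'_def lt(3) conj_conj)
        ultimately have "g \<otimes> x \<otimes> inv g \<in> N <#> R" by simp
        moreover have "g \<otimes> n \<otimes> inv g \<in> N <#> R"
          using N.inv_op_closed2[OF g nx(1)] subset_set_mult(1)[OF N.subgroup_axioms R(1)] by blast
        ultimately show "g \<otimes> h \<otimes> inv g \<in> N <#> R"
          using nx g by (simp add: conj_mult)
      qed
      have "N \<inter> R = {\<one>}" using PR P(2) N.one_closed R.one_closed by blast
      then have "card (N <#> R) = r * card N"
        using card_set_mult[OF fin N.subgroup_axioms R(1)] R(3) by simp
      then show False
        using no_r[OF NRG subset_set_mult(1)[OF N.subgroup_axioms R(1)] _ r(1) rp] by simp
    qed
  qed

  have commP: "g \<otimes> h \<otimes> inv g \<otimes> inv h \<in> P" if "g \<in> carrier G" "h \<in> carrier G" for g h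
  proof -
    have "g \<otimes> h \<otimes> inv g \<otimes> inv h \<in> factor_centralizer G H K" if HK: "?chief H K" for H K
      using commutator_in_factor_centralizer[OF fin chiefD(1-3)[OF HK] p(1) chiefD(4)[OF HK]] \<open>g \<in> carrier G\<close> \<open>h \<in> carrier G\<close> .
    then have "g \<otimes> h \<otimes> inv g \<otimes> inv h \<in> A"
      unfolding A_def using m_closed[OF m_closed[OF m_closed[OF that] inv_closed[OF that(1)]] inv_closed[OF that(2)]] by blast
    then show ?thesis using \<open>A = P\<close> by simp
  qed
  have powP: "g [^] (p - 1) \<in> P" if "g \<in> carrier G" for g
  proof -
    have "g [^] (p - 1) \<in> factor_centralizer G H K" if HK: "?chief H K" for H K
      using pow_in_factor_centralizer[OF fin chiefD(1-3)[OF HK] p(1) chiefD(4)[OF HK] \<open>g \<in> carrier G\<close>] .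
    then have "g [^] (p - 1) \<in> A" unfolding A_def using nat_pow_closed[OF that] by blast
    then show ?thesis using \<open>A = P\<close> by simp
  qed

  interpret GP: group "G\<lparr>carrier := P\<rparr>" using P.subgroup_axioms by (rule subgroup_imp_group)
  interpret GN: group "G\<lparr>carrier := N\<rparr>" using N.subgroup_axioms by (rule subgroup_imp_group)
  have invP: "inv\<^bsub>G\<lparr>carrier := P\<rparr>\<^esub> g = inv g" if "g \<in> P" for g
    using m_inv_consistent[OF P.subgroup_axioms that] .
  \<comment> \<open>The elements of \<open>N\<close> fixed by \<open>P\<close>. A
    \<open>p\<close>-group acting on a nontrivial \<open>p\<close>-group has a nontrivial fixed
    point, and \<open>F\<close> is normal because \<open>P\<close> is, so minimality shows that
    \<open>P\<close> centralizes \<open>N\<close>.\<close>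
  define F where "F = {x \<in> N. \<forall>g\<in>P. g \<otimes> x \<otimes> inv g = x}"
  have "F \<lhd> G"
  proof (rule normal_invI)
    show "subgroup F G"
    proof (rule subgroupI)
      show "F \<subseteq> carrier G" by (auto simp: F_def)
      have "\<one> \<in> F" by (simp add: F_def)
      then show "F \<noteq> {}" by blast
      show "inv g \<in> F" if "g \<in> F" for g using that by (simp add: F_def conj_inv)
      show "g \<otimes> h \<in> F" if "g \<in> F" "h \<in> F" for g h using that by (simp add: F_def conj_mult)
    qed
    fix x f assume x: "x \<in> carrier G" and f: "f \<in> F"
    have "g \<otimes> (x \<otimes> f \<otimes> inv x) \<otimes> inv g = x \<otimes> f \<otimes> inv x" if g: "g \<in> P" for g
    proof -
      have "inv x \<otimes> g \<otimes> x \<in> P" using P.inv_op_closed1 x g by simp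
      then have "(inv x \<otimes> g \<otimes> x) \<otimes> f \<otimes> inv (inv x \<otimes> g \<otimes> x) = f" using f unfolding F_def by blast
      then have "x \<otimes> f \<otimes> inv x = x \<otimes> ((inv x \<otimes> g \<otimes> x) \<otimes> f \<otimes> inv (inv x \<otimes> g \<otimes> x)) \<otimes> inv x" by simp
      also have "\<dots> = g \<otimes> (x \<otimes> f \<otimes> inv x) \<otimes> inv g" using f x g by (simp add: F_def m_assoc inv_mult_group)
      finally show ?thesis by simp
    qed
    then show "x \<otimes> f \<otimes> inv x \<in> F" using f x N.inv_op_closed2 by (simp add: F_def)
  qed
  moreover have "F \<noteq> {\<one>}"
  proof
    assume F: "F = {\<one>}"
    interpret act: group_action "G\<lparr>carrier := P\<rparr>" N "\<lambda>g. \<lambda>x\<in>N. g \<otimes> x \<otimes> inv g"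
      by (rule GP.group_actionI) (auto simp: N.inv_op_closed2 conj_conj)
    have "p dvd card {x \<in> N. \<exists>g\<in>carrier (G\<lparr>carrier := P\<rparr>). (\<lambda>x\<in>N. g \<otimes> x \<otimes> inv g) x \<noteq> x}"
      using act.prime_dvd_card_moved_points[OF p(1) _ finN, of m] P(3) by (simp add: order_def)
    moreover have "{x \<in> N. \<exists>g\<in>carrier (G\<lparr>carrier := P\<rparr>). (\<lambda>x\<in>N. g \<otimes> x \<otimes> inv g) x \<noteq> x} = N - F"
      by (auto simp: F_def)
    ultimately have "p dvd card (N - F)" by simp
    moreover have "card (N - F) = card N - 1" using F finN N.one_closed by (simp add: card_Diff_singleton)
    ultimately have "p dvd card N - 1" by simp
    then have "p dvd card N - (card N - 1)" using p(2) by (rule dvd_diff_nat[rotated])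
    then show False using p1 card_subgroup_pos[OF fin N.subgroup_axioms] by simp
  qed
  ultimately have "F = N" using Nmin by (auto simp: F_def)
  then have PN: "g \<otimes> x \<otimes> inv g = x" if "g \<in> P" "x \<in> N" for g x using that by (auto simp: F_def)
  \<comment> \<open>\<open>N\<close> lies in \<open>P\<close>, so it centralizes itself.\<close>
  have Ncomm: "x \<otimes> y = y \<otimes> x" if "x \<in> N" "y \<in> N" for x y
  proof -
    have "x \<otimes> y \<otimes> inv x = y" using PN[of x y] that P(2) by blast
    then have "x \<otimes> y \<otimes> inv x \<otimes> x = y \<otimes> x" by simp
    then show ?thesis using that by (simp add: m_assoc)
  qed
  have powN: "x [^]\<^bsub>G\<lparr>carrier := N\<rparr>\<^esub> (n::nat) = x [^] n" for x n
    by (simp flip: nat_pow_consistent)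
  have commN: "comm_group (G\<lparr>carrier := N\<rparr>)"
    by (rule GN.group_comm_groupI) (simp add: Ncomm)
  note expN = minimal_normal_exponent[OF fin N Ncomm p]

  \<comment> \<open>The \<open>(p - 1)\<close>-th iterate of conjugation by \<open>g\<close> is
    conjugation by an element of \<open>P\<close>, hence trivial on \<open>N\<close>: this is the
    periodicity that yields an eigenvector.\<close>
  have power_map: "\<exists>b::nat. \<forall>x\<in>N. g \<otimes> x \<otimes> inv g = x [^] b" if g: "g \<in> carrier G" for g
  proof -
    let ?T = "\<lambda>x. g \<otimes> x \<otimes> inv g"
    obtain y where y: "y \<in> N" "y \<noteq> \<one>" using N1 N.one_closed by blast
    have iter: "(?T ^^ i) x = g [^] i \<otimes> x \<otimes> inv (g [^] i)" if "x \<in> carrier G" for i x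
    proof (induction i)
      case (Suc i)
      have "g [^] Suc i = g \<otimes> g [^] i" using g by (rule nat_pow_Suc2)
      then show ?case using Suc that g by (simp add: conj_conj)
    qed (use that in simp)
    have "\<exists>v\<in>carrier (G\<lparr>carrier := N\<rparr>). v \<noteq> \<one>\<^bsub>G\<lparr>carrier := N\<rparr>\<^esub> \<and> (\<exists>b::nat. ?T v = v [^]\<^bsub>G\<lparr>carrier := N\<rparr>\<^esub> b)"
    proof (rule comm_group.exists_eigenvector[OF commN p(1)])
      show "?T \<in> hom (G\<lparr>carrier := N\<rparr>) (G\<lparr>carrier := N\<rparr>)"
        using g N.inv_op_closed2[OF g] by (auto simp: hom_def conj_mult)
      show "x [^]\<^bsub>G\<lparr>carrier := N\<rparr>\<^esub> p = \<one>\<^bsub>G\<lparr>carrier := N\<rparr>\<^esub>" if "x \<in> carrier (G\<lparr>carrier := N\<rparr>)" for x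
        using that expN by (simp add: powN)
      show "(?T ^^ (p - 1)) x = x" if "x \<in> carrier (G\<lparr>carrier := N\<rparr>)" for x
        using that iter[of x] PN[OF powP[OF g]] by simp
      show "y \<in> carrier (G\<lparr>carrier := N\<rparr>)" "y \<noteq> \<one>\<^bsub>G\<lparr>carrier := N\<rparr>\<^esub>" using y by auto
    qed
    then obtain v b where v: "v \<in> N" "v \<noteq> \<one>" "g \<otimes> v \<otimes> inv g = v [^] (b::nat)" by (auto simp: powN)
    define V where "V = {x \<in> N. g \<otimes> x \<otimes> inv g = x [^] b}"
    have "V \<lhd> G"
    proof (rule normal_invI)
      show "subgroup V G"
      proof (rule subgroupI)
        show "V \<subseteq> carrier G" by (auto simp: V_def)
        show "V \<noteq> {}" using v by (auto simp: V_def)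
        show "inv x \<in> V" if "x \<in> V" for x using that g by (simp add: V_def nat_pow_inv conj_inv)
        show "x \<otimes> z \<in> V" if "x \<in> V" "z \<in> V" for x z
          using that g by (simp add: V_def conj_mult pow_mult_distrib[OF Ncomm])
      qed
      fix h x assume h: "h \<in> carrier G" and x: "x \<in> V"
      have xN: "x \<in> N" "g \<otimes> x \<otimes> inv g = x [^] b" using x by (auto simp: V_def)
      let ?c = "g \<otimes> h \<otimes> inv g \<otimes> inv h"
      have hxN: "h \<otimes> x \<otimes> inv h \<in> N" using N.inv_op_closed2[OF h xN(1)] .
      \<comment> \<open>Exchanging \<open>g\<close> and \<open>h\<close> costs the commutator
        \<open>?c\<close>, which lies in \<open>P\<close> and acts trivially on \<open>N\<close>.
        Therefore the eigenspace \<open>V\<close> is invariant under all of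
        \<open>G\<close>.\<close>
      have "g \<otimes> (h \<otimes> x \<otimes> inv h) \<otimes> inv g = ?c \<otimes> (h \<otimes> (g \<otimes> x \<otimes> inv g) \<otimes> inv h) \<otimes> inv ?c"
        using g h xN(1) by (simp add: m_assoc inv_mult_group)
      also have "h \<otimes> (g \<otimes> x \<otimes> inv g) \<otimes> inv h = (h \<otimes> x \<otimes> inv h) [^] b"
        using h xN by (simp add: conj_pow)
      also have "?c \<otimes> (h \<otimes> x \<otimes> inv h) [^] b \<otimes> inv ?c = (h \<otimes> x \<otimes> inv h) [^] b"
        using PN[OF commP[OF g h] subgroup_pow[OF N.subgroup_axioms hxN]] .
      finally show "h \<otimes> x \<otimes> inv h \<in> V" using hxN by (simp add: V_def)
    qed
    moreover have "V \<noteq> {\<one>}" using v by (auto simp: V_def)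
    ultimately have "V = N" using Nmin by (auto simp: V_def)
    then show ?thesis by (auto simp: V_def)
  qed

  obtain v where v: "v \<in> N" "v \<noteq> \<one>" using N1 N.one_closed by blast
  \<comment> \<open>All elements of \<open>G\<close> act on \<open>N\<close> by power maps, so every
    cyclic subgroup of \<open>N\<close> is normal in \<open>G\<close>; minimality leaves a cyclic
    \<open>N\<close>.\<close>
  define V where "V = generate G {v}"
  have vG: "v \<in> carrier G" using v(1) by simp
  have V: "subgroup V G" unfolding V_def using vG by (simp add: generate_is_subgroup)
  have VN: "V \<subseteq> N" unfolding V_def using v(1) by (intro generate_subgroup_incl N.subgroup_axioms) simp
  have "V \<lhd> G"
  proof (rule normal_invI[OF V])
    fix g x assume g: "g \<in> carrier G" and x: "x \<in> V"
    obtain b :: nat where "g \<otimes> x \<otimes> inv g = x [^] b" using power_map[OF g] VN x by blast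
    then show "g \<otimes> x \<otimes> inv g \<in> V" using subgroup_pow[OF V x] by simp
  qed
  moreover have "v \<in> V" unfolding V_def by (simp add: generate.incl)
  then have "V \<noteq> {\<one>}" using v(2) by blast
  ultimately have "N = generate G {v}" using Nmin[OF _ VN] by (simp add: V_def)
  then show ?thesis by (rule minimal_normal_cyclic_prime_card[OF fin N _ vG])
qed

end

section \<open>Maximal subgroups and chief factors under surjective homomorphisms\<close>

context epi_hom
begin

lemma maximal_pre:
  assumes "maximal_subgroup M H" shows "maximal_subgroup (pre M) G"
  unfolding maximal_subgroup_def
proof (intro conjI allI impI)
  have M: "subgroup M H" "M \<noteq> carrier H" using assms by (auto simp: maximal_subgroup_def)
  show "subgroup (pre M) G" by (rule subgroup_pre[OF M(1)])
  show "pre M \<noteq> carrier G" using M image_pre[OF subgroup.subset[OF M(1)]] surj by auto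
  fix L assume L: "subgroup L G \<and> pre M \<subseteq> L"
  have "M \<subseteq> h ` L" using image_pre[OF subgroup.subset[OF M(1)]] L by blast
  then have "h ` L = M \<or> h ` L = carrier H"
    using assms subgroup_image L by (auto simp: maximal_subgroup_def)
  moreover have "pre (h ` L) = L" using pre_image[of L] L ker_subset_pre[OF M(1)] by blast
  ultimately show "L = pre M \<or> L = carrier G" using pre_carrier by metis
qed

lemma maximal_image:
  assumes M: "maximal_subgroup M G" "ker \<subseteq> M" shows "maximal_subgroup (h ` M) H"
  unfolding maximal_subgroup_def
proof (intro conjI allI impI)
  have MG: "subgroup M G" "M \<noteq> carrier G" using M by (auto simp: maximal_subgroup_def)
  show "subgroup (h ` M) H" by (rule subgroup_image[OF MG(1)])
  have pre: "pre (h ` M) = M" by (rule pre_image[OF MG(1) M(2)])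
  then show "h ` M \<noteq> carrier H" using MG(2) pre_carrier by metis
  fix L assume L: "subgroup L H \<and> h ` M \<subseteq> L"
  then have "M \<subseteq> pre L" using pre_mono[of "h ` M" L] pre by simp
  then have "pre L = M \<or> pre L = carrier G"
    using M(1) subgroup_pre L by (auto simp: maximal_subgroup_def)
  moreover have "h ` pre L = L" using image_pre[of L] L subgroup.subset[of L H] by simp
  ultimately show "L = h ` M \<or> L = carrier H" using surj by metis
qed

text \<open>The kernel is normal and contained in \<open>pre M\<close>, so it lies in the subgroup
  \<open>L\<close> that plays the core; all orders then shrink by the common factor
  \<open>card ker\<close>.\<close>

lemma good_maximal_of_pre:
  assumes M: "subgroup M H" "G.good_maximal (pre M)"
  shows "H.good_maximal M"
proof (cases "pre M \<lhd> G")
  case True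
  then have "h ` pre M \<lhd> H" by (rule normal_image)
  then show ?thesis using image_pre[OF subgroup.subset[OF M(1)]] by (simp add: H.good_maximal_def)
next
  case False
  then obtain L p q n where "G.core_quotient (pre M) L p q n" using M(2) by (auto simp: G.good_maximal_def)
  then have L: "L \<lhd> G" "L \<subseteq> pre M" "\<And>S. S \<lhd> G \<Longrightarrow> S \<subseteq> pre M \<Longrightarrow> S \<subseteq> L"
      and pq: "Factorial_Ring.prime p" "Factorial_Ring.prime q"
      and card: "card (carrier G) = p * q ^ n * card L" "card (carrier G) = p * card (pre M)"
    unfolding G.core_quotient_def by blast+
  have ker: "ker \<subseteq> L" using L(3)[OF normal_kernel] ker_subset_pre[OF M(1)] .
  have kpos: "card ker > 0" using G.card_subgroup_pos[OF fin subgroup_kernel] .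
  have imM: "h ` pre M = M" using image_pre[OF subgroup.subset[OF M(1)]] .
  have "H.core_quotient M (h ` L) p q n"
    unfolding H.core_quotient_def
  proof (intro conjI allI impI)
    show "h ` L \<lhd> H" by (rule normal_image[OF L(1)])
    show "h ` L \<subseteq> M" using L(2) imM by blast
    show "S \<subseteq> h ` L" if S: "S \<lhd> H \<and> S \<subseteq> M" for S
    proof -
      have "pre S \<subseteq> L" using L(3) normal_pre pre_mono S by blast
      then have "h ` pre S \<subseteq> h ` L" by blast
      then show ?thesis using image_pre S subgroup.subset[OF normal_imp_subgroup] by metis
    qed
    show "card (carrier H) = p * q ^ n * card (h ` L)"
      using card(1) card_carrier card_eq_card_image[OF normal_imp_subgroup[OF L(1)] ker] kpos by simp
    show "card (carrier H) = p * card M"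
      using card(2) card_carrier card_pre[OF M(1)] kpos by simp
  qed (use pq in auto)
  then show ?thesis by (auto simp: H.good_maximal_def)
qed

lemma chief_factor_pre:
  assumes "chief_factor H A B" shows "chief_factor G (pre A) (pre B)"
  unfolding chief_factor_def
proof (intro conjI allI impI)
  have AB: "A \<lhd> H" "B \<lhd> H" "B \<subset> A" using assms by (auto simp: chief_factor_def)
  have im: "h ` pre A = A" "h ` pre B = B"
    using image_pre[OF subgroup.subset[OF normal_imp_subgroup]] AB by auto
  show "pre A \<lhd> G" "pre B \<lhd> G" using normal_pre AB by auto
  show "pre B \<subset> pre A" using pre_mono[of B A] AB(3) im by auto
  fix L assume L: "L \<lhd> G \<and> pre B \<subseteq> L \<and> L \<subseteq> pre A"
  then have "B \<subseteq> h ` L" "h ` L \<subseteq> A"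
    using image_mono[of "pre B" L h] image_mono[of L "pre A" h] im by simp_all
  then have "h ` L = B \<or> h ` L = A" using assms normal_image L by (auto simp: chief_factor_def)
  moreover have "pre (h ` L) = L"
    using pre_image[OF normal_imp_subgroup] L ker_subset_pre[OF normal_imp_subgroup[OF AB(2)]] by blast
  ultimately show "L = pre B \<or> L = pre A" by metis
qed

lemma chief_factor_image:
  assumes "chief_factor G A B" "ker \<subseteq> B" shows "chief_factor H (h ` A) (h ` B)"
  unfolding chief_factor_def
proof (intro conjI allI impI)
  have AB: "A \<lhd> G" "B \<lhd> G" "B \<subset> A" using assms by (auto simp: chief_factor_def)
  have pre: "pre (h ` A) = A" "pre (h ` B) = B"
    using pre_image[OF normal_imp_subgroup] AB assms(2) by auto
  show "h ` A \<lhd> H" "h ` B \<lhd> H" using normal_image AB by auto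
  show "h ` B \<subset> h ` A" using AB(3) pre by auto
  fix L assume L: "L \<lhd> H \<and> h ` B \<subseteq> L \<and> L \<subseteq> h ` A"
  then have "B \<subseteq> pre L" "pre L \<subseteq> A" using pre_mono pre by metis+
  then have "pre L = B \<or> pre L = A" using assms normal_pre L by (auto simp: chief_factor_def)
  moreover have "h ` pre L = L" using image_pre[OF subgroup.subset[OF normal_imp_subgroup]] L by blast
  ultimately show "L = h ` B \<or> L = h ` A" by metis
qed

end

context group
begin

text \<open>Induction on the part of \<open>G\<close> above \<open>K\<close>. Only the factors
  \<open>H/K\<close> directly above \<open>K\<close> are new; they are minimal normal subgroups of
  \<open>G Mod K\<close>, and either some maximal subgroup omits them or all contain them.\<close>

lemma prime_chief_factors_if_good_maximals:
  assumes fin: "finite (carrier G)" and good: "\<And>M. maximal_subgroup M G \<Longrightarrow> good_maximal M"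
    and K: "K \<lhd> G"
  shows "prime_chief_factors_above G K"
  using K
proof (induction "card (carrier G) - card K" arbitrary: K rule: less_induct)
  case less
  have IH: "\<exists>p. Factorial_Ring.prime p \<and> card A = p * card B"
    if AB: "chief_factor G A B" and B: "K \<subset> B" for A B
  proof -
    have BG: "B \<lhd> G" using AB by (simp add: chief_factor_def)
    have sub: "B \<subseteq> carrier G" using subgroup.subset[OF normal_imp_subgroup[OF BG]] .
    have "card K < card B" using B finite_subset[OF sub fin] by (simp add: psubset_card_mono)
    moreover have "card B \<le> card (carrier G)" using sub fin by (simp add: card_mono)
    ultimately have "prime_chief_factors_above G B" using less.hyps[OF _ BG] by simp
    then show ?thesis using AB unfolding prime_chief_factors_above_def by blast
  qed
  show ?case
    unfolding prime_chief_factors_above_def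
  proof (intro allI impI)
    fix H K' assume *: "chief_factor G H K' \<and> K \<subseteq> K'"
    show "\<exists>p. Factorial_Ring.prime p \<and> card H = p * card K'"
    proof (cases "K' = K")
      case False
      then show ?thesis using IH[of H K'] * by blast
    next
      case True
      then have HK: "chief_factor G H K" using * by simp
      have HG: "H \<lhd> G" "K \<subseteq> H" using HK by (auto simp: chief_factor_def)
      interpret f: epi_hom G "G Mod K" "\<lambda>x. K #> x" by (rule epi_hom_Mod[OF less.prems fin])
      have ker: "f.ker = K" by (rule kernel_Mod[OF less.prems])
      have kpos: "card K > 0" using card_subgroup_pos[OF fin normal_imp_subgroup[OF less.prems]] .
      let ?N = "(\<lambda>x. K #> x) ` H"
      have "(\<lambda>x. K #> x) ` K = {\<one>\<^bsub>G Mod K\<^esub>}"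
        using f.image_pre[of "{\<one>\<^bsub>G Mod K\<^esub>}"] f.pre_one ker by (simp del: one_FactGroup)
      then have N: "chief_factor (G Mod K) ?N {\<one>\<^bsub>G Mod K\<^esub>}"
        using f.chief_factor_image[OF HK] ker by simp
      have "Factorial_Ring.prime (card ?N)"
      proof (cases "\<exists>M. maximal_subgroup M (G Mod K) \<and> \<not> ?N \<subseteq> M")
        case True
        then obtain M where M: "maximal_subgroup M (G Mod K)" "\<not> ?N \<subseteq> M" by blast
        have "f.H.good_maximal M"
          using f.good_maximal_of_pre[OF _ good[OF f.maximal_pre[OF M(1)]]] M(1) by (simp add: maximal_subgroup_def)
        then show ?thesis by (rule f.H.card_chief_factor_not_in_maximal[OF f.finite_H N M])
      next
        case False
        \<comment> \<open>Chief factors of \<open>G Mod K\<close> above a nontrivial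
          \<open>S\<close> pull back to chief factors of \<open>G\<close> strictly above
          \<open>K\<close>, which the induction hypothesis covers.\<close>
        have "prime_chief_factors_above (G Mod K) S" if S: "S \<lhd> G Mod K" "S \<noteq> {\<one>\<^bsub>G Mod K\<^esub>}" for S
          unfolding prime_chief_factors_above_def
        proof (intro allI impI)
          fix A B assume AB: "chief_factor (G Mod K) A B \<and> S \<subseteq> B"
          have sg: "subgroup A (G Mod K)" "subgroup B (G Mod K)"
            using AB normal_imp_subgroup by (auto simp: chief_factor_def)
          have "K \<subset> f.pre B"
          proof
            show "K \<subseteq> f.pre B" using f.ker_subset_pre[OF sg(2)] ker by simp
            show "K \<noteq> f.pre B"
            proof
              assume "K = f.pre B"
              then have "B = {\<one>\<^bsub>G Mod K\<^esub>}"
                using f.image_pre[OF subgroup.subset[OF sg(2)]] \<open>(\<lambda>x. K #> x) ` K = {\<one>\<^bsub>G Mod K\<^esub>}\<close> by simp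
              then show False using AB S(2) subgroup.one_closed[OF normal_imp_subgroup[OF S(1)]] by blast
            qed
          qed
          then obtain p where "Factorial_Ring.prime p" "card (f.pre A) = p * card (f.pre B)"
            using IH f.chief_factor_pre AB by blast
          then show "\<exists>p. Factorial_Ring.prime p \<and> card A = p * card B"
            using f.card_pre[OF sg(1)] f.card_pre[OF sg(2)] ker kpos by auto
        qed
        then show ?thesis
          using False f.H.card_chief_factor_in_all_maximals[OF f.finite_H N] by blast
      qed
      moreover have "card H = card ?N * card K"
        using f.card_eq_card_image[OF normal_imp_subgroup[OF HG(1)]] ker HG(2) by simp
      ultimately show ?thesis using True by blast
    qed
  qed
qed

section \<open>Supersoluble groups\<close>

text \<open>The cosets by elements of \<open>H\<close> are the same sets on both sides, so the
  factors of a series are literally subgroups of \<open>G Mod K\<close> and no isomorphism is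
  carried along.\<close>

lemma Mod_subgroup: "G\<lparr>carrier := H\<rparr> Mod K = (G Mod K)\<lparr>carrier := (\<lambda>x. K #> x) ` H\<rparr>"
proof -
  have "set_mult (G\<lparr>carrier := H\<rparr>) = set_mult G" by (intro ext) simp
  then show ?thesis by (auto simp: FactGroup_def RCOSETS_def)
qed

lemma cyclic_subgroup_iff:
  assumes "subgroup C G"
  shows "cyclic_group (G\<lparr>carrier := C\<rparr>) \<longleftrightarrow> (\<exists>x\<in>C. C = range (\<lambda>n::int. x [^] n))"
proof -
  interpret C: group "G\<lparr>carrier := C\<rparr>" by (rule subgroup_imp_group[OF assms])
  have "(\<lambda>n::int. x [^]\<^bsub>G\<lparr>carrier := C\<rparr>\<^esub> n) = (\<lambda>n. x [^] n)" if "x \<in> C" for x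
    using int_pow_consistent[OF assms that] by auto
  then show ?thesis using C.cyclic_group by auto
qed

lemma cyclic_group_of_prime_order:
  assumes p: "Factorial_Ring.prime p" and W: "subgroup W G" "card W = p"
  shows "cyclic_group (G\<lparr>carrier := W\<rparr>)"
proof -
  interpret W: subgroup W G by (rule W(1))
  have "W \<noteq> {\<one>}" using W(2) p by (auto simp: prime_nat_iff)
  then obtain w where w: "w \<in> W" "w \<noteq> \<one>" using W.one_closed by blast
  have "W \<subseteq> range (\<lambda>n::int. w [^] n)"
  proof
    fix x assume "x \<in> W"
    then obtain i :: nat where "x = w [^] i" using prime_order_pow[OF p W w] by blast
    then have "x = w [^] (int i)" by (simp add: int_pow_int)
    then show "x \<in> range (\<lambda>n::int. w [^] n)" by blast
  qed
  then have "W = range (\<lambda>n::int. w [^] n)" using subgroup_int_pow_closed[OF W(1) w(1)] by blast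
  then show ?thesis using cyclic_subgroup_iff[OF W(1)] w(1) by blast
qed

text \<open>Any chief series serves as the required series: groups of prime order are cyclic. It is
  built upwards from a normal subgroup \<open>K\<close>, by induction on what lies above
  \<open>K\<close>.\<close>

lemma supersoluble_if_prime_chief_factors:
  assumes fin: "finite (carrier G)" and CF: "prime_chief_factors_above G {\<one>}"
  shows "supersoluble G"
proof -
  have "\<exists>N (m::nat). N 0 = K \<and> N m = carrier G \<and> (\<forall>i\<le>m. N i \<lhd> G) \<and>
       (\<forall>i<m. N i \<subseteq> N (Suc i) \<and> cyclic_group (G\<lparr>carrier := N (Suc i)\<rparr> Mod N i))" if "K \<lhd> G" for K
    using that
  proof (induction "card (carrier G) - card K" arbitrary: K rule: less_induct)
    case less
    have sub: "K \<subseteq> carrier G" using subgroup.subset[OF normal_imp_subgroup[OF less.prems]] .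
    show ?case
    proof (cases "K = carrier G")
      case True
      then show ?thesis using less.prems by (intro exI[of _ "\<lambda>_. K"] exI[of _ 0]) simp
    next
      case False
      then obtain H where H: "chief_factor G H K"
        using chief_factor_above[OF fin less.prems normal_self] sub by blast
      then have HG: "H \<lhd> G" "K \<subset> H" by (auto simp: chief_factor_def)
      have Hsub: "H \<subseteq> carrier G" using subgroup.subset[OF normal_imp_subgroup[OF HG(1)]] .
      have lt: "card K < card H" using HG(2) finite_subset[OF Hsub fin] by (simp add: psubset_card_mono)
      moreover have "card H \<le> card (carrier G)" using Hsub fin by (simp add: card_mono)
      ultimately obtain N m where N: "N 0 = H" "N m = carrier G" "\<forall>i\<le>m. N i \<lhd> G"
        "\<forall>i<m. N i \<subseteq> N (Suc i) \<and> cyclic_group (G\<lparr>carrier := N (Suc i)\<rparr> Mod N i)"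
        using less.hyps[OF _ HG(1)] by (metis diff_less_mono2 less_le_trans)
      have "{\<one>} \<subseteq> K" using subgroup.one_closed[OF normal_imp_subgroup[OF less.prems]] by simp
      then obtain p where p: "Factorial_Ring.prime p" "card H = p * card K"
        using CF H unfolding prime_chief_factors_above_def by blast
      interpret f: epi_hom G "G Mod K" "\<lambda>x. K #> x" by (rule epi_hom_Mod[OF less.prems fin])
      have ker: "f.ker = K" by (rule kernel_Mod[OF less.prems])
      have "card ((\<lambda>x. K #> x) ` H) = p"
        using f.card_eq_card_image[OF normal_imp_subgroup[OF HG(1)]] ker HG(2) p(2)
          card_subgroup_pos[OF fin normal_imp_subgroup[OF less.prems]] by auto
      then have cyc: "cyclic_group (G\<lparr>carrier := H\<rparr> Mod K)"
        unfolding Mod_subgroup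
        by (rule f.H.cyclic_group_of_prime_order[OF p(1) f.subgroup_image[OF normal_imp_subgroup[OF HG(1)]]])
      let ?N = "\<lambda>i. case i of 0 \<Rightarrow> K | Suc j \<Rightarrow> N j"
      have "?N 0 = K \<and> ?N (Suc m) = carrier G \<and> (\<forall>i\<le>Suc m. ?N i \<lhd> G) \<and>
         (\<forall>i<Suc m. ?N i \<subseteq> ?N (Suc i) \<and> cyclic_group (G\<lparr>carrier := ?N (Suc i)\<rparr> Mod ?N i))"
      proof (intro conjI allI impI)
        show "?N i \<lhd> G" if "i \<le> Suc m" for i using that N(3) less.prems by (cases i) auto
        show "?N i \<subseteq> ?N (Suc i)" if "i < Suc m" for i using that N HG(2) by (cases i) auto
        show "cyclic_group (G\<lparr>carrier := ?N (Suc i)\<rparr> Mod ?N i)" if "i < Suc m" for i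
          using that N cyc by (cases i) auto
      qed (use N(2) in auto)
      then show ?thesis by blast
    qed
  qed
  from this[OF one_is_normal] show ?thesis unfolding supersoluble_def .
qed

lemma subgroup_of_cyclic:
  assumes C: "C = range (\<lambda>n::int. x [^] n)" "x \<in> carrier G" and D: "subgroup D G" "D \<subseteq> C"
  shows "\<exists>d\<in>D. D = range (\<lambda>n::int. d [^] n)"
proof (cases "\<exists>j::int. j \<noteq> 0 \<and> x [^] j \<in> D")
  case False
  have "D \<subseteq> {\<one>}"
  proof
    fix y assume y: "y \<in> D"
    then obtain j :: int where j: "y = x [^] j" using C(1) D(2) by blast
    then have "j = 0" using False y by blast
    then show "y \<in> {\<one>}" using j by simp
  qed
  then have "D = {\<one>}" using subgroup.one_closed[OF D(1)] by blast
  then show ?thesis by (auto simp: int_pow_one)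
next
  case True
  then obtain j :: int where j: "j \<noteq> 0" "x [^] j \<in> D" by blast
  let ?P = "\<lambda>n::nat. n > 0 \<and> x [^] int n \<in> D"
  have "?P (nat \<bar>j\<bar>)"
  proof (cases "j > 0")
    case False
    then have "x [^] (- j) \<in> D" using subgroup.m_inv_closed[OF D(1) j(2)] C(2) by (simp add: int_pow_neg)
    then show ?thesis using False j by simp
  qed (use j in simp)
  define d where "d = (LEAST n. ?P n)"
  have Pd: "?P d" unfolding d_def using \<open>?P (nat \<bar>j\<bar>)\<close> by (rule LeastI)
  have least: "d \<le> n" if "?P n" for n unfolding d_def using that by (rule Least_le)
  have "D \<subseteq> range (\<lambda>n::int. (x [^] int d) [^] n)"
  proof
    fix y assume y: "y \<in> D"
    then obtain i :: int where i: "y = x [^] i" using C(1) D(2) by blast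
    define r where "r = i mod int d"
    have r: "0 \<le> r" "r < int d" using Pd by (auto simp: r_def)
    have eq: "i = int d * (i div int d) + r" by (simp add: r_def)
    have pw: "(x [^] int d) [^] (i div int d) = x [^] (int d * (i div int d))"
      using C(2) by (simp add: int_pow_pow)
    have "(x [^] int d) [^] (i div int d) \<in> D" using subgroup_int_pow_closed[OF D(1)] Pd by blast
    then have "inv (x [^] (int d * (i div int d))) \<otimes> y \<in> D"
      using y D(1) pw by (simp add: subgroup.m_closed subgroup.m_inv_closed)
    moreover have "y = x [^] (int d * (i div int d)) \<otimes> x [^] r"
      using i eq C(2) int_pow_mult by metis
    ultimately have "x [^] r \<in> D" using C(2) by simp
    then have "r = 0" using least[of "nat r"] r by (cases "r = 0") auto
    then have "y = (x [^] int d) [^] (i div int d)" using i eq pw by simp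
    then show "y \<in> range (\<lambda>n::int. (x [^] int d) [^] n)" by blast
  qed
  moreover have "range (\<lambda>n::int. (x [^] int d) [^] n) \<subseteq> D" using subgroup_int_pow_closed[OF D(1)] Pd by blast
  ultimately show ?thesis using Pd by blast
qed

text \<open>The factor \<open>H/K\<close> need not occur in the given series, but it is covered by
  one step of it: at the first \<open>N (Suc i)\<close> whose intersection with \<open>H\<close>
  leaves \<open>K\<close>, that intersection generates \<open>H\<close> together with
  \<open>K\<close>. This makes \<open>H/K\<close> a cyclic minimal normal subgroup of
  \<open>G Mod K\<close>.\<close>

lemma prime_chief_factors_if_supersoluble:
  assumes fin: "finite (carrier G)" and ss: "supersoluble G"
  shows "prime_chief_factors_above G {\<one>}"
  unfolding prime_chief_factors_above_def
proof (intro allI impI)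
  fix H K assume "chief_factor G H K \<and> {\<one>} \<subseteq> K"
  then have HK: "chief_factor G H K" by simp
  then have HG: "H \<lhd> G" and KG: "K \<lhd> G" and KH: "K \<subset> H" by (auto simp: chief_factor_def)
  interpret H: normal H G by fact
  interpret K: normal K G by fact
  obtain N m where N: "N 0 = {\<one>}" "N m = carrier G" "\<forall>i\<le>m. N i \<lhd> G"
    "\<forall>i<m. N i \<subseteq> N (Suc i) \<and> cyclic_group (G\<lparr>carrier := N (Suc i)\<rparr> Mod N i)"
    using ss unfolding supersoluble_def by blast
  have "\<not> H \<inter> N m \<subseteq> K" using KH N(2) H.subset by blast
  moreover have "H \<inter> N 0 \<subseteq> K" using N(1) K.one_closed by simp
  ultimately obtain i where i: "i < m" "H \<inter> N i \<subseteq> K" "\<not> H \<inter> N (Suc i) \<subseteq> K"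
    using ex_least_nat_less[of "\<lambda>i. \<not> H \<inter> N i \<subseteq> K" m] by auto
  have NG: "N i \<lhd> G" "N (Suc i) \<lhd> G" "N i \<subseteq> N (Suc i)" using N i(1) by auto
  define D where "D = H \<inter> N (Suc i)"
  have DG: "D \<lhd> G" unfolding D_def by (rule normal_subgroup_intersect[OF HG NG(2)])
  interpret D: normal D G by fact
  have KD: "K <#> D = H" using chief_factor_mult_eq[OF HK DG] i(3) by (simp add: D_def)
  interpret g: epi_hom G "G Mod N i" "\<lambda>x. N i #> x" by (rule epi_hom_Mod[OF NG(1) fin])
  have cyc: "cyclic_group ((G Mod N i)\<lparr>carrier := (\<lambda>x. N i #> x) ` N (Suc i)\<rparr>)"
    using N(4) i(1) unfolding Mod_subgroup by blast
  obtain C where C: "C \<in> (\<lambda>x. N i #> x) ` N (Suc i)"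
    "(\<lambda>x. N i #> x) ` N (Suc i) = range (\<lambda>n::int. C [^]\<^bsub>G Mod N i\<^esub> n)"
    using cyc g.H.cyclic_subgroup_iff[OF g.subgroup_image[OF normal_imp_subgroup[OF NG(2)]]] by blast
  have CQ: "C \<in> carrier (G Mod N i)" using C(1) subgroup.mem_carrier[OF normal_imp_subgroup[OF NG(2)]] g.hom_closed by blast
  have "\<exists>E\<in>(\<lambda>x. N i #> x) ` D. (\<lambda>x. N i #> x) ` D = range (\<lambda>n::int. E [^]\<^bsub>G Mod N i\<^esub> n)"
    by (rule g.H.subgroup_of_cyclic[OF C(2) CQ g.subgroup_image[OF D.subgroup_axioms]]) (auto simp: D_def)
  then obtain d where d: "d \<in> D" "(\<lambda>x. N i #> x) ` D = range (\<lambda>n::int. (N i #> d) [^]\<^bsub>G Mod N i\<^esub> n)" by blast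
  interpret Ni: normal "N i" G by (rule NG(1))
  \<comment> \<open>An error term lies in \<open>N i\<close> and in \<open>H\<close>, and
    \<open>H \<inter> N i\<close> is inside \<open>K\<close>; so powers of \<open>d\<close>
    represent \<open>D\<close> modulo \<open>K\<close> as well.\<close>
  have D_pow: "\<exists>n::int. y \<otimes> inv (d [^] n) \<in> K" if y: "y \<in> D" for y
  proof -
    obtain n :: int where "N i #> y = (N i #> d) [^]\<^bsub>G Mod N i\<^esub> n" using d(2) y by blast
    then have "N i #> y = N i #> (d [^] n)" using Ni.FactGroup_int_pow d(1) by simp
    then have "y \<otimes> inv (d [^] n) \<in> N i" using rcos_eq_iff[OF Ni.subgroup_axioms] y d(1) by simp
    moreover have "y \<otimes> inv (d [^] n) \<in> D" using y subgroup_int_pow_closed[OF D.subgroup_axioms d(1)] by simp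
    then have "y \<otimes> inv (d [^] n) \<in> H" by (simp add: D_def)
    ultimately show ?thesis using i(2) by blast
  qed
  interpret f: epi_hom G "G Mod K" "\<lambda>x. K #> x" by (rule epi_hom_Mod[OF KG fin])
  have ker: "f.ker = K" by (rule kernel_Mod[OF KG])
  let ?W = "(\<lambda>x. K #> x) ` H"
  have "(\<lambda>x. K #> x) ` K = {\<one>\<^bsub>G Mod K\<^esub>}"
    using f.image_pre[of "{\<one>\<^bsub>G Mod K\<^esub>}"] f.pre_one ker by (simp del: one_FactGroup)
  then have W: "chief_factor (G Mod K) ?W {\<one>\<^bsub>G Mod K\<^esub>}" using f.chief_factor_image[OF HK] ker by simp
  have "?W \<subseteq> range (\<lambda>n::int. (K #> d) [^]\<^bsub>G Mod K\<^esub> n)"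
  proof
    fix y assume "y \<in> ?W"
    then obtain z where z: "z \<in> H" "y = K #> z" by blast
    then have "z \<in> K <#> D" using KD by simp
    then obtain k e where ke: "k \<in> K" "e \<in> D" "z = k \<otimes> e" by (rule set_multE)
    obtain n :: int where n: "e \<otimes> inv (d [^] n) \<in> K" using D_pow[OF ke(2)] by blast
    have "z \<otimes> inv (d [^] n) = k \<otimes> (e \<otimes> inv (d [^] n))" using ke d(1) by (simp add: m_assoc)
    then have "z \<otimes> inv (d [^] n) \<in> K" using ke(1) n by simp
    then have "K #> z = K #> (d [^] n)" using rcos_eq_iff[OF K.subgroup_axioms] z(1) d(1) by simp
    then have "y = (K #> d) [^]\<^bsub>G Mod K\<^esub> n" using z(2) K.FactGroup_int_pow d(1) by simp
    then show "y \<in> range (\<lambda>n::int. (K #> d) [^]\<^bsub>G Mod K\<^esub> n)" by blast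
  qed
  moreover have dW: "K #> d \<in> ?W" using d(1) by (auto simp: D_def)
  then have "range (\<lambda>n::int. (K #> d) [^]\<^bsub>G Mod K\<^esub> n) \<subseteq> ?W"
    using f.H.subgroup_int_pow_closed[OF f.subgroup_image[OF H.subgroup_axioms]] by blast
  moreover have dQ: "K #> d \<in> carrier (G Mod K)" using d(1) f.hom_closed by simp
  moreover have "generate (G Mod K) {K #> d} = range (\<lambda>n::int. (K #> d) [^]\<^bsub>G Mod K\<^esub> n)"
    unfolding f.H.generate_pow[OF dQ] by blast
  ultimately have "?W = generate (G Mod K) {K #> d}" by simp
  then have "Factorial_Ring.prime (card ?W)"
    by (rule f.H.minimal_normal_cyclic_prime_card[OF f.finite_H W _ dQ])
  moreover have "card H = card ?W * card K"
    using f.card_eq_card_image[OF H.subgroup_axioms] ker KH by auto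
  ultimately show "\<exists>p. Factorial_Ring.prime p \<and> card H = p * card K" by blast
qed

lemma supersoluble_imp_solvable:
  assumes "supersoluble G" shows "solvable G"
proof -
  obtain N m where N: "N 0 = {\<one>}" "N m = carrier G" "\<forall>i\<le>m. N i \<lhd> G"
    "\<forall>i<m. N i \<subseteq> N (Suc i) \<and> cyclic_group (G\<lparr>carrier := N (Suc i)\<rparr> Mod N i)"
    using assms unfolding supersoluble_def by blast
  have "solvable_seq G (N i)" if "i \<le> m" for i
    using that
  proof (induction i)
    case 0
    then show ?case using N(1) by (simp add: solvable_seq.unity)
  next
    case (Suc i)
    have NG: "N i \<lhd> G" "subgroup (N (Suc i)) G" "N i \<subseteq> N (Suc i)"
      using N(3,4) Suc.prems normal_imp_subgroup[of "N (Suc i)" G] by auto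
    have n: "N i \<lhd> G\<lparr>carrier := N (Suc i)\<rparr>" using normal_restrict_supergroup[OF NG(2,1,3)] .
    have "comm_group (G\<lparr>carrier := N (Suc i)\<rparr> Mod N i)"
      using group.cyclic_imp_abelian_group[OF normal.factorgroup_is_group[OF n]] N(4) Suc.prems by simp
    then show ?case using solvable_seq.extension[OF _ n NG(2)] Suc by simp
  qed
  from this[of m] show ?thesis using N(2) by (simp add: solvable_def)
qed

text \<open>The derived series is intersected with \<open>H\<close>. At the last term not swallowed
  by \<open>K\<close>, the intersection \<open>E\<close> generates \<open>H\<close> together with
  \<open>K\<close>, while commutators of \<open>E\<close> fall into the next term and hence into
  \<open>K\<close>.\<close>

lemma solvable_chief_factor_abelian:
  assumes solv: "solvable G" and HK: "chief_factor G H K" and xy: "x \<in> H" "y \<in> H"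
  shows "x \<otimes> y \<otimes> inv x \<otimes> inv y \<in> K"
proof -
  have HG: "H \<lhd> G" and KG: "K \<lhd> G" and KH: "K \<subset> H" using HK by (auto simp: chief_factor_def)
  interpret H: normal H G by fact
  interpret K: normal K G by fact
  let ?D = "\<lambda>n. (derived G ^^ n) (carrier G)"
  obtain m where m: "?D m = {\<one>}" using solv solvable_iff_trivial_derived_seq by blast
  have DG: "?D n \<lhd> G" for n
    by (induction n) (auto simp: normal_self derived_is_normal)
  have "H \<inter> ?D m \<subseteq> K" using m K.one_closed by simp
  moreover have "\<not> H \<inter> ?D 0 \<subseteq> K" using KH H.subset by auto
  ultimately obtain i where i: "i < m" "\<not> H \<inter> ?D i \<subseteq> K" "H \<inter> ?D (Suc i) \<subseteq> K"
    using ex_least_nat_less[of "\<lambda>i. H \<inter> ?D i \<subseteq> K" m] by blast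
  define E where "E = H \<inter> ?D i"
  have EG: "E \<lhd> G" unfolding E_def by (rule normal_subgroup_intersect[OF HG DG])
  interpret E: normal E G by fact
  have KE: "K <#> E = H" using chief_factor_mult_eq[OF HK EG] i(2) by (simp add: E_def)
  have E_comm: "a \<otimes> b \<otimes> inv a \<otimes> inv b \<in> K" if ab: "a \<in> E" "b \<in> E" for a b
  proof -
    have "a \<otimes> b \<otimes> inv a \<otimes> inv b \<in> derived_set G (?D i)" using ab by (auto simp: E_def)
    then have "a \<otimes> b \<otimes> inv a \<otimes> inv b \<in> ?D (Suc i)" by (simp add: derived_def generate.incl)
    moreover have "a \<otimes> b \<otimes> inv a \<otimes> inv b \<in> H" using ab by (simp add: E_def)
    ultimately show ?thesis using i(3) by blast
  qed
  have "x \<in> K <#> E" "y \<in> K <#> E" using xy KE by auto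
  then obtain k a l b where ka: "k \<in> K" "a \<in> E" "x = k \<otimes> a" and lb: "l \<in> K" "b \<in> E" "y = l \<otimes> b"
    by (metis set_multE)
  have eq: "K #> x = K #> a" "K #> y = K #> b"
    using rcos_eq_iff[OF K.subgroup_axioms] ka lb by (simp_all add: m_assoc)
  have hom: "K #> (g \<otimes> h \<otimes> inv g \<otimes> inv h) = (K #> g) <#> (K #> h) <#> (K #> inv g) <#> (K #> inv h)"
    if "g \<in> carrier G" "h \<in> carrier G" for g h
    using that by (simp add: K.rcos_sum)
  have inv_eq: "K #> inv x = K #> inv a" "K #> inv y = K #> inv b"
    using K.rcos_inv[of x] K.rcos_inv[of a] K.rcos_inv[of y] K.rcos_inv[of b] eq xy ka(2) lb(2) by auto
  have "K #> (x \<otimes> y \<otimes> inv x \<otimes> inv y) = K #> (a \<otimes> b \<otimes> inv a \<otimes> inv b)"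
    using hom[of x y] hom[of a b] eq inv_eq xy ka(2) lb(2) by simp
  also have "\<dots> = K" using E_comm[OF ka(2) lb(2)] ka(2) lb(2) K.rcos_const[OF is_group] by simp
  finally show ?thesis using coset_join1[OF _ _ K.subgroup_axioms] xy by simp
qed

section \<open>Maximal subgroups\<close>

lemma subgroup_index_mult:
  assumes "subgroup H G" "subgroup D G" "D \<subseteq> H"
  shows "subgroup_index (G\<lparr>carrier := H\<rparr>) D * card D = card H"
  using group.lagrange[OF subgroup_imp_group[OF assms(1)] subgroup_incl[OF assms(2,1,3)]]
  by (simp add: subgroup_index_def order_def)

lemma subgroup_index_eq_iff:
  assumes "finite (carrier G)" "subgroup H G" "subgroup D G" "D \<subseteq> H"
  shows "subgroup_index (G\<lparr>carrier := H\<rparr>) D = n \<longleftrightarrow> card H = n * card D"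
  using subgroup_index_mult[OF assms(2-4)] card_subgroup_pos[OF assms(1,3)] by (metis mult_cancel2 less_numeral_extra(3))

lemma subgroup_index_carrier_eq_iff:
  assumes "finite (carrier G)" "subgroup D G"
  shows "subgroup_index G D = n \<longleftrightarrow> card (carrier G) = n * card D"
  using subgroup_index_eq_iff[OF assms(1) subgroup_self assms(2) subgroup.subset[OF assms(2)]] by simp

lemma order_Mod:
  assumes "finite (carrier G)" "N \<lhd> G"
  shows "Coset.order (G Mod N) = n \<longleftrightarrow> card (carrier G) = n * card N"
proof -
  have "Coset.order (G Mod N) * card N = card (carrier G)"
    using lagrange[OF normal_imp_subgroup[OF assms(2)]] by (simp add: order_def FactGroup_def)
  then show ?thesis
    using card_subgroup_pos[OF assms(1) normal_imp_subgroup[OF assms(2)]] by (metis mult_cancel2 less_numeral_extra(3))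
qed

lemma subgroup_of_prime_index:
  assumes fin: "finite (carrier G)" and p: "Factorial_Ring.prime p"
    and D: "subgroup D G" "subgroup L G" "D \<subseteq> L" and H: "subgroup H G" "L \<subseteq> H" "card H = p * card D"
  shows "L = D \<or> L = H"
proof -
  obtain a where a: "card L = a * card D" using card_subgroup_dvd[OF D] by (metis dvd_div_mult_self)
  have Dpos: "card D > 0" by (rule card_subgroup_pos[OF fin D(1)])
  have "a * card D dvd p * card D" using card_subgroup_dvd[OF D(2) H(1,2)] a H(3) by simp
  then have "a dvd p" using Dpos by simp
  then consider "a = 1" | "a = p" using p by (auto simp: prime_nat_iff)
  then show ?thesis
  proof cases
    case 1
    then show ?thesis using subgroup_eqI_card[OF fin D(2,3)] a by simp
  next
    case 2
    then show ?thesis using subgroup_eqI_card[OF fin H(1,2)] a H(3) by simp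
  qed
qed

lemma maximal_of_prime_index:
  assumes fin: "finite (carrier G)" and p: "Factorial_Ring.prime p"
    and H: "subgroup H G" and D: "subgroup D G" "D \<subseteq> H" "card H = p * card D"
  shows "maximal_subgroup D (G\<lparr>carrier := H\<rparr>)"
  unfolding maximal_subgroup_def
proof (intro conjI allI impI)
  show "subgroup D (G\<lparr>carrier := H\<rparr>)" by (rule subgroup_incl[OF D(1) H D(2)])
  have "card D \<noteq> card H" using D(3) card_subgroup_pos[OF fin D(1)] prime_gt_1_nat[OF p] by simp
  then show "D \<noteq> carrier (G\<lparr>carrier := H\<rparr>)" by auto
  fix L assume L: "subgroup L (G\<lparr>carrier := H\<rparr>) \<and> D \<subseteq> L"
  then have "subgroup L G" "L \<subseteq> H" using incl_subgroup[OF H] subgroup.subset by fastforce+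
  then show "L = D \<or> L = carrier (G\<lparr>carrier := H\<rparr>)"
    using subgroup_of_prime_index[OF fin p D(1) _ _ H _ D(3)] L by simp
qed

lemma maximal_mult_normal:
  assumes M: "maximal_subgroup M G" and N: "N \<lhd> G" "\<not> N \<subseteq> M"
  shows "N <#> M = carrier G"
proof -
  have MG: "subgroup M G" using M by (simp add: maximal_subgroup_def)
  have "subgroup (N <#> M) G" by (rule mult_norm_subgroup[OF N(1) MG])
  then show ?thesis
    using M N(2) subset_set_mult[OF normal_imp_subgroup[OF N(1)] MG] by (auto simp: maximal_subgroup_def)
qed

text \<open>\<open>M\<close> normalizes \<open>C \<inter> M\<close> since \<open>C\<close> is
  normal, and the commutator condition keeps conjugates by elements of \<open>H\<close> inside
  \<open>M\<close>. It is applied with \<open>C\<close> a factor centralizer and with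
  \<open>C = H\<close>.\<close>

lemma normal_Int_supplement:
  assumes C: "C \<lhd> G" and M: "subgroup M G" and mult: "H <#> M = carrier G" and H: "H \<subseteq> carrier G"
    and comm: "\<And>h y. h \<in> H \<Longrightarrow> y \<in> C \<Longrightarrow> y \<in> M \<Longrightarrow> h \<otimes> y \<otimes> inv h \<otimes> inv y \<in> M"
  shows "C \<inter> M \<lhd> G"
proof (rule normal_invI)
  interpret C: normal C G by fact
  interpret M: subgroup M G by fact
  show "subgroup (C \<inter> M) G" using subgroups_Inter_pair[OF C.subgroup_axioms M] .
  fix g x assume g: "g \<in> carrier G" and x: "x \<in> C \<inter> M"
  then have xG: "x \<in> carrier G" by simp
  have "g \<in> H <#> M" using g mult by simp
  then obtain h m where hm: "h \<in> H" "m \<in> M" "g = h \<otimes> m" by (rule set_multE)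
  have hG: "h \<in> carrier G" using hm(1) H by blast
  let ?y = "m \<otimes> x \<otimes> inv m"
  have y: "?y \<in> C" "?y \<in> M" using x hm(2) C.inv_op_closed2[of m x] by auto
  have "(h \<otimes> ?y \<otimes> inv h \<otimes> inv ?y) \<otimes> ?y \<in> M" using comm[OF hm(1) y] y(2) by (rule M.m_closed)
  then have "h \<otimes> ?y \<otimes> inv h \<in> M" using hm(2) hG xG by (simp add: m_assoc)
  moreover have "h \<otimes> ?y \<otimes> inv h = g \<otimes> x \<otimes> inv g" using hm hG xG by (simp add: conj_conj)
  ultimately show "g \<otimes> x \<otimes> inv g \<in> C \<inter> M" using C.inv_op_closed2[OF g] x by auto
qed

lemma submodular_maximal_iff:
  assumes M: "maximal_subgroup M G"
  shows "submodular k M G \<longleftrightarrow> (\<exists>n. 1 \<le> n \<and> n \<le> k \<and> modularly_embedded n M G)"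
proof
  assume "submodular k M G"
  then obtain C and m :: nat where C: "C 0 = M" "C m = carrier G" "\<forall>i\<le>m. subgroup (C i) G"
    "\<forall>i<m. C i \<subseteq> C (Suc i) \<and> (\<exists>n. 1 \<le> n \<and> n \<le> k \<and> modularly_embedded n (C i) (G\<lparr>carrier := C (Suc i)\<rparr>))"
    unfolding submodular_def by blast
  have "C m \<noteq> M" using M C(2) by (auto simp: maximal_subgroup_def)
  \<comment> \<open>The chain leaves \<open>M\<close> at a single step, and by maximality this step
    arrives at \<open>G\<close>.\<close>
  then obtain i where i: "i < m" "C i = M" "C (Suc i) \<noteq> M"
    using ex_least_nat_less[of "\<lambda>i. C i \<noteq> M" m] C(1) by auto
  have "subgroup (C (Suc i)) G" "M \<subseteq> C (Suc i)" using C(3,4) i by auto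
  then have "C (Suc i) = carrier G" using M i(3) by (auto simp: maximal_subgroup_def)
  then show "\<exists>n. 1 \<le> n \<and> n \<le> k \<and> modularly_embedded n M G" using C(4) i(1,2) by force
next
  assume *: "\<exists>n. 1 \<le> n \<and> n \<le> k \<and> modularly_embedded n M G"
  have MG: "subgroup M G" using M by (simp add: maximal_subgroup_def)
  let ?C = "\<lambda>i::nat. if i = 0 then M else carrier G"
  show "submodular k M G"
    unfolding submodular_def
  proof (rule exI[of _ ?C], rule exI[of _ "1::nat"], intro conjI allI impI)
    show "subgroup (?C i) G" for i using MG subgroup_self by simp
    show "?C i \<subseteq> ?C (Suc i)" for i using subgroup.subset[OF MG] by simp
    show "\<exists>n. 1 \<le> n \<and> n \<le> k \<and> modularly_embedded n (?C i) (G\<lparr>carrier := ?C (Suc i)\<rparr>)" if "i < 1" for i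
    proof -
      have e: "?C i = M" "G\<lparr>carrier := ?C (Suc i)\<rparr> = G" using that by simp_all
      show ?thesis unfolding e by (rule *)
    qed
  qed simp_all
qed

lemma modularly_embedded_iff:
  assumes fin: "finite (carrier G)" and M: "subgroup M G"
  shows "modularly_embedded n M G \<longleftrightarrow> M \<lhd> G \<or> \<not> nilpotent_group (G Mod core G M) \<and>
    (\<exists>p q. Factorial_Ring.prime p \<and> Factorial_Ring.prime q \<and>
      card (carrier G) = p * q ^ n * card (core G M) \<and> card (carrier G) = p * card M)"
  unfolding modularly_embedded_def using M
  by (simp add: order_Mod[OF fin normal_core[OF M]] subgroup_index_carrier_eq_iff[OF fin M])

lemma good_maximal_if_modularly_embedded:
  assumes fin: "finite (carrier G)" and M: "subgroup M G" and me: "modularly_embedded n M G"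
  shows "good_maximal M"
proof (cases "M \<lhd> G")
  case False
  then obtain p q where "Factorial_Ring.prime p" "Factorial_Ring.prime q"
      "card (carrier G) = p * q ^ n * card (core G M)" "card (carrier G) = p * card M"
    using me unfolding modularly_embedded_iff[OF fin M] by blast
  then have "core_quotient M (core G M) p q n"
    unfolding core_quotient_def using normal_core[OF M] core_subset[OF M] core_greatest[OF M] by blast
  then show ?thesis by (auto simp: good_maximal_def)
qed (simp add: good_maximal_def)

text \<open>Take the last term of the lower central series not contained in \<open>M\<close>.
  Commutators of its elements with \<open>M\<close> lie in the next term, hence in \<open>M\<close>,
  so an element of it outside \<open>M\<close> normalizes \<open>M\<close>.\<close>

lemma nilpotent_maximal_normal:
  assumes fin: "finite (carrier G)" and nil: "nilpotent_group G" and M: "maximal_subgroup M G"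
  shows "M \<lhd> G"
proof -
  have MG: "subgroup M G" and MG': "M \<noteq> carrier G" using M by (auto simp: maximal_subgroup_def)
  interpret M: subgroup M G by fact
  obtain n where n: "lower_central G n = {\<one>}" using nil by (auto simp: nilpotent_group_def)
  have carr: "lower_central G i \<subseteq> carrier G" for i
  proof (induction i)
    case (Suc i)
    then have "(\<Union>x\<in>lower_central G i. \<Union>g\<in>carrier G. {x \<otimes> g \<otimes> inv x \<otimes> inv g}) \<subseteq> carrier G" by auto
    then show ?case using generate_incl by simp
  qed simp
  have "\<not> lower_central G 0 \<subseteq> M" using MG' M.subset by auto
  moreover have "lower_central G n \<subseteq> M" using n M.one_closed by simp
  ultimately obtain i where i: "\<not> lower_central G i \<subseteq> M" "lower_central G (Suc i) \<subseteq> M"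
    using ex_least_nat_less[of "\<lambda>i. lower_central G i \<subseteq> M" n] by blast
  then obtain y where y: "y \<in> lower_central G i" "y \<notin> M" by blast
  have yG: "y \<in> carrier G" using y(1) carr by blast
  have "y \<otimes> x \<otimes> inv y \<in> M" if x: "x \<in> M" for x
  proof -
    have "y \<otimes> x \<otimes> inv y \<otimes> inv x \<in> (\<Union>x\<in>lower_central G i. \<Union>g\<in>carrier G. {x \<otimes> g \<otimes> inv x \<otimes> inv g})"
      using y(1) x M.mem_carrier by blast
    then have "y \<otimes> x \<otimes> inv y \<otimes> inv x \<in> lower_central G (Suc i)" by (simp add: generate.incl)
    then have "y \<otimes> x \<otimes> inv y \<otimes> inv x \<in> M" using i(2) by blast
    then have "(y \<otimes> x \<otimes> inv y \<otimes> inv x) \<otimes> x \<in> M" using x by simp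
    then show ?thesis using x yG by (simp add: m_assoc)
  qed
  then show ?thesis using maximal_normalI[OF fin M yG y(2)] by blast
qed

lemma nilpotent_Mod_maximal_normal:
  assumes fin: "finite (carrier G)" and K: "K \<lhd> G" "K \<subseteq> M" and nil: "nilpotent_group (G Mod K)"
    and M: "maximal_subgroup M G"
  shows "M \<lhd> G"
proof -
  have MG: "subgroup M G" using M by (simp add: maximal_subgroup_def)
  interpret f: epi_hom G "G Mod K" "\<lambda>x. K #> x" by (rule epi_hom_Mod[OF K(1) fin])
  have ker: "f.ker = K" by (rule kernel_Mod[OF K(1)])
  have "(\<lambda>x. K #> x) ` M \<lhd> G Mod K"
    using f.H.nilpotent_maximal_normal[OF f.finite_H nil f.maximal_image[OF M]] ker K(2) by simp
  then have "f.pre ((\<lambda>x. K #> x) ` M) \<lhd> G" by (rule f.normal_pre)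
  then show ?thesis using f.pre_image[OF MG] ker K(2) by simp
qed

text \<open>Non-nilpotence follows from non-normality, as a nilpotent quotient would make the
  maximal subgroup \<open>M\<close> normal; what is left are the two orders.\<close>

lemma modularly_embeddedI:
  assumes fin: "finite (carrier G)" and M: "maximal_subgroup M G" "\<not> M \<lhd> G"
    and p: "Factorial_Ring.prime p" "card (carrier G) = p * card M"
    and q: "Factorial_Ring.prime q" "card M = q ^ n * card (core G M)"
  shows "modularly_embedded n M G"
proof -
  have MG: "subgroup M G" using M(1) by (simp add: maximal_subgroup_def)
  have "\<not> nilpotent_group (G Mod core G M)"
    using nilpotent_Mod_maximal_normal[OF fin normal_core[OF MG] core_subset[OF MG] _ M(1)] M(2) by blast
  moreover have "card (carrier G) = p * q ^ n * card (core G M)" using p(2) q(2) by simp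
  ultimately show ?thesis unfolding modularly_embedded_iff[OF fin MG] using p q(1) by blast
qed

text \<open>The core is the largest normal subgroup in \<open>M\<close>, so \<open>H\<close> is not
  inside \<open>M\<close> and supplements it; primality leaves only the core for
  \<open>H \<inter> M\<close>. The centralizer meets \<open>M\<close> in a normal subgroup, hence
  within the core, and as it contains \<open>H\<close>, it is \<open>H\<close>.\<close>

lemma
  assumes fin: "finite (carrier G)" and M: "maximal_subgroup M G"
    and H: "H \<lhd> G" "core G M \<subset> H" and p: "Factorial_Ring.prime p" "card H = p * card (core G M)"
  shows core_factor_mult: "H <#> M = carrier G"
    and core_factor_Int: "H \<inter> M = core G M"
    and core_factor_card: "card (carrier G) = p * card M"
    and core_factor_centralizer: "factor_centralizer G H (core G M) = H"
proof -
  let ?L = "core G M"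
  have MG: "subgroup M G" using M by (simp add: maximal_subgroup_def)
  interpret M: subgroup M G by fact
  interpret H: normal H G by (rule H(1))
  have LG: "?L \<lhd> G" by (rule normal_core[OF MG])
  interpret L: normal ?L G by (rule LG)
  have LM: "?L \<subseteq> M" by (rule core_subset[OF MG])
  have LH: "?L \<subseteq> H" using H(2) by blast
  have Lpos: "card ?L > 0" by (rule card_subgroup_pos[OF fin L.subgroup_axioms])
  have HM: "\<not> H \<subseteq> M" using core_greatest[OF MG H(1)] H(2) by blast
  show mult: "H <#> M = carrier G" by (rule maximal_mult_normal[OF M H(1) HM])
  have "subgroup (H \<inter> M) G" using subgroups_Inter_pair[OF H.subgroup_axioms MG] .
  then show int: "H \<inter> M = ?L"
    using subgroup_of_prime_index[OF fin p(1) L.subgroup_axioms, of "H \<inter> M" H] H.subgroup_axioms p(2) LM LH HM by blast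
  have "card (carrier G) * card ?L = card H * card M"
    using card_set_mult[OF fin H.subgroup_axioms MG] mult int by simp
  then show "card (carrier G) = p * card M" using p(2) Lpos by simp
  let ?C = "factor_centralizer G H ?L"
  have HC: "H \<subseteq> ?C" by (rule factor_subset_factor_centralizer[OF fin H(1) LG LH p])
  have C: "?C \<lhd> G" by (rule normal_factor_centralizer[OF fin H(1) LG LH p])
  interpret C: normal ?C G by (rule C)
  have "?C \<inter> M \<lhd> G"
  proof (rule normal_Int_supplement[OF C MG mult H.subset])
    fix h y assume hy: "h \<in> H" "y \<in> ?C" "y \<in> M"
    have "y \<otimes> h \<otimes> inv y \<otimes> inv h \<in> ?L"
      using hy mem_factor_centralizer_iff[OF H(1) LG] by blast
    then have "inv (y \<otimes> h \<otimes> inv y \<otimes> inv h) \<in> M" using LM by auto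
    then show "h \<otimes> y \<otimes> inv h \<otimes> inv y \<in> M" using hy by (simp add: inv_mult_group m_assoc)
  qed
  then have CML: "?C \<inter> M \<subseteq> ?L" using core_greatest[OF MG] by blast
  show "?C = H"
  proof
    show "?C \<subseteq> H"
    proof
      fix c assume c: "c \<in> ?C"
      then have "c \<in> H <#> M" using mult by simp
      then obtain h m where hm: "h \<in> H" "m \<in> M" "c = h \<otimes> m" by (rule set_multE)
      have "inv h \<otimes> c \<in> ?C" using c hm(1) HC by blast
      then have "m \<in> ?C" using hm by simp
      then have "m \<in> H" using CML LH hm(2) by blast
      then show "c \<in> H" using hm by simp
    qed
  qed (rule HC)
qed

lemma core_factor_complemented:
  assumes fin: "finite (carrier G)" and M: "maximal_subgroup M G"
    and H: "H \<lhd> G" "core G M \<subset> H" and p: "Factorial_Ring.prime p" "card H = p * card (core G M)"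
  shows "complemented_factor G H (core G M)"
  using core_factor_mult[OF assms] core_factor_Int[OF assms] M
  by (auto simp: complemented_factor_def maximal_subgroup_def)

lemma core_chief_factor:
  assumes fin: "finite (carrier G)" and CF: "prime_chief_factors_above G {\<one>}" and M: "maximal_subgroup M G"
  obtains H p where "chief_factor G H (core G M)" "H \<lhd> G" "core G M \<subset> H"
    "Factorial_Ring.prime p" "card H = p * card (core G M)"
proof -
  have MG: "subgroup M G" and MG': "M \<noteq> carrier G" using M by (auto simp: maximal_subgroup_def)
  have LG: "core G M \<lhd> G" by (rule normal_core[OF MG])
  have "core G M \<subset> carrier G" using core_subset[OF MG] subgroup.subset[OF MG] MG' by blast
  then obtain H where H: "chief_factor G H (core G M)"
    using chief_factor_above[OF fin LG normal_self] by blast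
  have "{\<one>} \<subseteq> core G M" using subgroup.one_closed[OF normal_imp_subgroup[OF LG]] by simp
  then obtain p where "Factorial_Ring.prime p" "card H = p * card (core G M)"
    using CF H unfolding prime_chief_factors_above_def by blast
  moreover have "H \<lhd> G" "core G M \<subset> H" using H by (auto simp: chief_factor_def)
  ultimately show ?thesis using that H by blast
qed

lemma card_Mod_trivial_iff:
  assumes fin: "finite (carrier G)" and C: "C \<lhd> G"
  shows "trivial_group (G Mod C) \<longleftrightarrow> C = carrier G"
proof -
  interpret C: normal C G by fact
  interpret Q: group "G Mod C" by (rule C.factorgroup_is_group)
  have "trivial_group (G Mod C) \<longleftrightarrow> Coset.order (G Mod C) = 1"
    using Q.order_one_triv_iff by (auto simp: trivial_group_def Q.group_axioms)
  also have "\<dots> \<longleftrightarrow> card (carrier G) = card C" using order_Mod[OF fin C, of 1] by simp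
  also have "\<dots> \<longleftrightarrow> C = carrier G" using subgroup_eqI_card[OF fin subgroup_self C.subset] by auto
  finally show ?thesis .
qed

section \<open>The equivalences\<close>

definition max_condition :: "nat \<Rightarrow> bool"
  where "max_condition k \<longleftrightarrow> (\<forall>M. maximal_subgroup M G \<longrightarrow> (\<exists>n. 1 \<le> n \<and> n \<le> k \<and> modularly_embedded n M G))"

definition chief_condition :: "nat \<Rightarrow> bool"
  where "chief_condition k \<longleftrightarrow> (\<forall>H K. chief_factor G H K \<and> complemented_factor G H K \<longrightarrow>
         trivial_group (G Mod factor_centralizer G H K) \<or>
         cyclic_group (G Mod factor_centralizer G H K) \<and>
         (\<exists>q n. Factorial_Ring.prime q \<and> 1 \<le> n \<and> n \<le> k \<and>
            Coset.order (G Mod factor_centralizer G H K) = q ^ n))"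

lemma max_condition_prime_chief_factors:
  assumes fin: "finite (carrier G)" and mc: "max_condition k"
  shows "prime_chief_factors_above G {\<one>}"
proof (rule prime_chief_factors_if_good_maximals[OF fin _ one_is_normal])
  fix M assume M: "maximal_subgroup M G"
  then obtain n where "modularly_embedded n M G" using mc unfolding max_condition_def by blast
  then show "good_maximal M" using good_maximal_if_modularly_embedded[OF fin] M by (simp add: maximal_subgroup_def)
qed

text \<open>A complement \<open>M\<close> of a factor of order \<open>p\<close> has index
  \<open>p\<close> and is maximal, so (1) applies to it. The centralizer contains \<open>H\<close>
  and the core of \<open>M\<close>, and their product already has index \<open>q ^ n\<close>.
  Cyclicity comes from the character on \<open>H/K\<close>.\<close>

lemma max_condition_imp_chief_condition:
  assumes fin: "finite (carrier G)" and mc: "max_condition k"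
  shows "chief_condition k"
  unfolding chief_condition_def
proof (intro allI impI)
  fix H K assume *: "chief_factor G H K \<and> complemented_factor G H K"
  then have HG: "H \<lhd> G" and KG: "K \<lhd> G" and KH: "K \<subset> H" by (auto simp: chief_factor_def)
  interpret H: normal H G by fact
  interpret K: normal K G by fact
  obtain M where M: "subgroup M G" "carrier G = H <#> M" "H \<inter> M = K"
    using * by (auto simp: complemented_factor_def)
  obtain p where p: "Factorial_Ring.prime p" "card H = p * card K"
    using max_condition_prime_chief_factors[OF fin mc] * K.one_closed
    unfolding prime_chief_factors_above_def by blast
  have KH': "K \<subseteq> H" using KH by blast
  have Kpos: "card K > 0" by (rule card_subgroup_pos[OF fin K.subgroup_axioms])
  have "card (carrier G) * card K = card H * card M"
    using card_set_mult[OF fin H.subgroup_axioms M(1)] M by simp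
  then have cM: "card (carrier G) = p * card M" using p(2) Kpos by simp
  have max: "maximal_subgroup M G"
    using maximal_of_prime_index[OF fin p(1) subgroup_self M(1) subgroup.subset[OF M(1)] cM] by simp
  let ?C = "factor_centralizer G H K"
  have C: "?C \<lhd> G" by (rule normal_factor_centralizer[OF fin HG KG KH' p])
  have HC: "H \<subseteq> ?C" by (rule factor_subset_factor_centralizer[OF fin HG KG KH' p])
  interpret C: normal ?C G by (rule C)
  obtain n where n: "1 \<le> n" "n \<le> k" "modularly_embedded n M G" using mc max unfolding max_condition_def by blast
  have LC: "core G M \<subseteq> ?C"
    using subset_factor_centralizer[OF HG KG normal_core[OF M(1)]] core_subset[OF M(1)] M(3) by blast
  show "trivial_group (G Mod ?C) \<or> cyclic_group (G Mod ?C) \<and>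
    (\<exists>q n. Factorial_Ring.prime q \<and> 1 \<le> n \<and> n \<le> k \<and> Coset.order (G Mod ?C) = q ^ n)"
  proof (cases "M \<lhd> G")
    case True
    then have "M \<subseteq> ?C" using subset_factor_centralizer[OF HG KG True] M(3) by blast
    then have "?C = carrier G" using set_mult_subset[OF C.subgroup_axioms HC] M(2) C.subset by blast
    then show ?thesis using card_Mod_trivial_iff[OF fin C] by blast
  next
    case False
    then obtain p' q where q: "Factorial_Ring.prime q"
      and card: "card (carrier G) = p' * q ^ n * card (core G M)" "card (carrier G) = p' * card M"
      using n(3) unfolding modularly_embedded_iff[OF fin M(1)] by blast
    have "p' = p" using card(2) cM card_subgroup_pos[OF fin M(1)] by simp
    \<comment> \<open>This intersection fixes the order of \<open>H <#> core G M\<close> as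
      \<open>p * card (core G M)\<close>; the order of the centralizer is a multiple of it.\<close>
    have "H \<inter> core G M = K"
    proof
      show "H \<inter> core G M \<subseteq> K" using core_subset[OF M(1)] M(3) by blast
      show "K \<subseteq> H \<inter> core G M" using core_greatest[OF M(1) KG] M(3) by blast
    qed
    then have "card (H <#> core G M) * card K = p * card K * card (core G M)"
      using card_set_mult[OF fin H.subgroup_axioms normal_imp_subgroup[OF normal_core[OF M(1)]]] p(2) by simp
    then have cHL: "card (H <#> core G M) = p * card (core G M)" using Kpos by simp
    have sub: "H <#> core G M \<subseteq> ?C" by (rule set_mult_subset[OF C.subgroup_axioms HC LC])
    have "subgroup (H <#> core G M) G" using normal_imp_subgroup[OF normal_set_mult[OF HG normal_core[OF M(1)]]] .
    from card_subgroup_dvd[OF this C.subgroup_axioms sub] obtain c where c: "card ?C = p * card (core G M) * c"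
      unfolding cHL by blast
    obtain d where d: "Coset.order (G Mod ?C) = d" by simp
    then have "card (carrier G) = d * card ?C" using order_Mod[OF fin C] by blast
    then have "p * card (core G M) * q ^ n = p * card (core G M) * (d * c)"
      using card(1) \<open>p' = p\<close> c by (simp add: mult_ac)
    then have "q ^ n = d * c"
      using card_subgroup_pos[OF fin normal_imp_subgroup[OF normal_core[OF M(1)]]] prime_gt_0_nat[OF p(1)] by simp
    then obtain j where j: "d = q ^ j" "j \<le> n" using divides_primepow_nat[OF q, of d n] by auto
    show ?thesis
    proof (cases "j = 0")
      case True
      then have "card (carrier G) = card ?C" using order_Mod[OF fin C, of 1] d j(1) by simp
      then have "?C = carrier G" using subgroup_eqI_card[OF fin subgroup_self C.subset] by simp
      then show ?thesis using card_Mod_trivial_iff[OF fin C] by blast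
    next
      case False
      have "cyclic_group (G Mod ?C)" by (rule cyclic_Mod_factor_centralizer[OF fin HG KG KH' p])
      moreover have "1 \<le> j" "j \<le> k" using False j(2) n(2) by auto
      ultimately show ?thesis using q d j(1) by blast
    qed
  qed
qed

text \<open>(2) is applied to the factor directly above the core of \<open>M\<close>. Its
  centralizer is \<open>H\<close>, so \<open>q ^ n\<close> is the index of \<open>H\<close>, which
  is also the index of the core in \<open>M\<close>.\<close>

lemma chief_condition_core:
  assumes fin: "finite (carrier G)" and CF: "prime_chief_factors_above G {\<one>}" and cc: "chief_condition k"
    and M: "maximal_subgroup M G" "\<not> M \<lhd> G"
  obtains H p q n where "H \<lhd> G" "core G M \<subset> H" "Factorial_Ring.prime p" "card H = p * card (core G M)"
    "cyclic_group (G Mod H)" "Factorial_Ring.prime q" "1 \<le> n" "n \<le> k"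
    "card (carrier G) = p * card M" "card M = q ^ n * card (core G M)"
proof -
  have MG: "subgroup M G" using M(1) by (simp add: maximal_subgroup_def)
  obtain H p where H: "chief_factor G H (core G M)" "H \<lhd> G" "core G M \<subset> H"
    and p: "Factorial_Ring.prime p" "card H = p * card (core G M)"
    by (rule core_chief_factor[OF fin CF M(1)])
  note facts = core_factor_Int[OF fin M(1) H(2,3) p] core_factor_card[OF fin M(1) H(2,3) p]
    core_factor_centralizer[OF fin M(1) H(2,3) p]
  have Lpos: "card (core G M) > 0" by (rule card_subgroup_pos[OF fin normal_imp_subgroup[OF normal_core[OF MG]]])
  have "complemented_factor G H (core G M)" by (rule core_factor_complemented[OF fin M(1) H(2,3) p])
  then have *: "trivial_group (G Mod H) \<or> cyclic_group (G Mod H) \<and>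
    (\<exists>q n. Factorial_Ring.prime q \<and> 1 \<le> n \<and> n \<le> k \<and> Coset.order (G Mod H) = q ^ n)"
    using cc[unfolded chief_condition_def, rule_format, OF conjI[OF H(1)]] unfolding facts(3) by blast
  \<comment> \<open>If \<open>H\<close> were the whole group, \<open>M\<close> would coincide with
    its core and be normal.\<close>
  have "\<not> trivial_group (G Mod H)"
  proof
    assume "trivial_group (G Mod H)"
    then have "H = carrier G" using card_Mod_trivial_iff[OF fin H(2)] by blast
    then have "core G M = M" using facts(1) subgroup.subset[OF MG] by blast
    then show False using M(2) normal_core[OF MG] by simp
  qed
  then obtain q n where q: "Factorial_Ring.prime q" "1 \<le> n" "n \<le> k" "Coset.order (G Mod H) = q ^ n"
    and cyc: "cyclic_group (G Mod H)" using * by blast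
  have "card (carrier G) = q ^ n * card H" using q(4) order_Mod[OF fin H(2)] by blast
  then have "p * card M = p * (q ^ n * card (core G M))" using facts(2) p(2) by auto
  then have "card M = q ^ n * card (core G M)" using prime_gt_0_nat[OF p(1)] by simp
  then show ?thesis using that[OF H(2,3) p cyc q(1-3) facts(2)] by blast
qed

lemma chief_condition_imp_max_condition:
  assumes fin: "finite (carrier G)" and CF: "prime_chief_factors_above G {\<one>}" and cc: "chief_condition k"
    and k: "k \<ge> 1"
  shows "max_condition k"
  unfolding max_condition_def
proof (intro allI impI)
  fix M assume M: "maximal_subgroup M G"
  show "\<exists>n. 1 \<le> n \<and> n \<le> k \<and> modularly_embedded n M G"
  proof (cases "M \<lhd> G")
    case True
    then have "modularly_embedded 1 M G" using normal_imp_subgroup by (auto simp: modularly_embedded_def)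
    then show ?thesis using k by blast
  next
    case False
    obtain H p q n where *: "Factorial_Ring.prime p" "Factorial_Ring.prime q" "1 \<le> n" "n \<le> k"
      "card (carrier G) = p * card M" "card M = q ^ n * card (core G M)"
      by (rule chief_condition_core[OF fin CF cc M False]) blast
    then show ?thesis using modularly_embeddedI[OF fin M False *(1,5,2,6)] by blast
  qed
qed

section \<open>Intersections of maximal subgroups\<close>

lemma n_maximal_of_prime_power_index:
  assumes fin: "finite (carrier G)" and L: "L \<lhd> G" and M: "subgroup M G" "L \<subseteq> M"
    and q: "Factorial_Ring.prime q" "card M = q ^ n * card L"
  shows "n_maximal_subgroup n L (G\<lparr>carrier := M\<rparr>)"
proof -
  interpret L: normal L G by fact
  have Lpos: "card L > 0" by (rule card_subgroup_pos[OF fin L.subgroup_axioms])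
  have "\<exists>Y. subgroup Y G \<and> L \<subseteq> Y \<and> Y \<subseteq> M \<and> card Y = q ^ (n - j) * card L \<and>
      n_maximal_subgroup j Y (G\<lparr>carrier := M\<rparr>)" if "j \<le> n" for j
    using that
  proof (induction j)
    case 0
    then show ?case using M q(2) by auto
  next
    case (Suc j)
    then obtain Y where Y: "subgroup Y G" "L \<subseteq> Y" "Y \<subseteq> M" "card Y = q ^ (n - j) * card L"
      "n_maximal_subgroup j Y (G\<lparr>carrier := M\<rparr>)" by auto
    interpret f: epi_hom G "G Mod L" "\<lambda>x. L #> x" by (rule epi_hom_Mod[OF L fin])
    have ker: "f.ker = L" by (rule kernel_Mod[OF L])
    let ?Y = "(\<lambda>x. L #> x) ` Y"
    have Y': "subgroup ?Y (G Mod L)" by (rule f.subgroup_image[OF Y(1)])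
    have nj: "n - j = Suc (n - Suc j)" using Suc.prems by simp
    have "card ?Y = q ^ (n - j)" using f.card_eq_card_image[OF Y(1)] ker Y(2,4) Lpos by simp
    \<comment> \<open>Written with the last factor \<open>q\<close> split off, so that Sylow's
      theorem returns a subgroup of index \<open>q\<close>; its preimage is the next member of the
      descending chain from \<open>M\<close> to \<open>L\<close>.\<close>
    then have ord: "order ((G Mod L)\<lparr>carrier := ?Y\<rparr>) = q ^ (n - Suc j) * q"
      using nj by (simp add: order_def)
    interpret Y: group "(G Mod L)\<lparr>carrier := ?Y\<rparr>" by (rule f.H.subgroup_imp_group[OF Y'])
    have "finite (carrier ((G Mod L)\<lparr>carrier := ?Y\<rparr>))" using f.H.finite_subgroup[OF f.finite_H Y'] by simp
    then obtain Z where Z: "subgroup Z ((G Mod L)\<lparr>carrier := ?Y\<rparr>)" "card Z = q ^ (n - Suc j)"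
      using sylow_thm[OF q(1) Y.group_axioms ord] by blast
    have ZG: "subgroup Z (G Mod L)" by (rule f.H.incl_subgroup[OF Y' Z(1)])
    have ZY: "Z \<subseteq> ?Y" using subgroup.subset[OF Z(1)] by simp
    let ?Z = "f.pre Z"
    have Z': "subgroup ?Z G" "L \<subseteq> ?Z" "card ?Z = q ^ (n - Suc j) * card L"
      using f.subgroup_pre[OF ZG] f.ker_subset_pre[OF ZG] f.card_pre[OF ZG] ker Z(2) by auto
    have "?Z \<subseteq> Y" using f.pre_mono[OF ZY] f.pre_image[OF Y(1)] ker Y(2) by simp
    moreover have "card Y = q * card ?Z" using Y(4) Z'(3) nj by simp
    ultimately have "maximal_subgroup ?Z (G\<lparr>carrier := Y\<rparr>)"
      using maximal_of_prime_index[OF fin q(1) Y(1) Z'(1)] by blast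
    then have "n_maximal_subgroup (Suc j) ?Z (G\<lparr>carrier := M\<rparr>)" using Y(5) by auto
    then show ?case using Z' \<open>?Z \<subseteq> Y\<close> Y(3) by blast
  qed
  from this[of n] obtain Y where Y: "subgroup Y G" "L \<subseteq> Y" "card Y = card L"
    "n_maximal_subgroup n Y (G\<lparr>carrier := M\<rparr>)" by auto
  then have "L = Y" using subgroup_eqI_card[OF fin Y(1,2)] by simp
  then show ?thesis using Y(4) by simp
qed

lemma maximal_prime_index:
  assumes fin: "finite (carrier G)" and CF: "prime_chief_factors_above G {\<one>}" and M: "maximal_subgroup M G"
  shows "\<exists>p. Factorial_Ring.prime p \<and> card (carrier G) = p * card M"
  using core_chief_factor[OF fin CF M] core_factor_card[OF fin M] by metis

definition intersection_condition :: "nat \<Rightarrow> bool"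
  where "intersection_condition k \<longleftrightarrow> (\<forall>M\<^sub>1 M\<^sub>2. maximal_subgroup M\<^sub>1 G \<and> maximal_subgroup M\<^sub>2 G \<longrightarrow>
         M\<^sub>1 = M\<^sub>2 \<or>
         (\<exists>n q\<^sub>1 q\<^sub>2. 1 \<le> n \<and> n \<le> k \<and>
            Factorial_Ring.prime q\<^sub>1 \<and> Factorial_Ring.prime q\<^sub>2 \<and>
            n_maximal_subgroup n (M\<^sub>1 \<inter> M\<^sub>2) (G\<lparr>carrier := M\<^sub>1\<rparr>) \<and>
            subgroup_index (G\<lparr>carrier := M\<^sub>1\<rparr>) (M\<^sub>1 \<inter> M\<^sub>2) = q\<^sub>1 ^ n \<and>
            n_maximal_subgroup n (M\<^sub>1 \<inter> M\<^sub>2) (G\<lparr>carrier := M\<^sub>2\<rparr>) \<and>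
            subgroup_index (G\<lparr>carrier := M\<^sub>2\<rparr>) (M\<^sub>1 \<inter> M\<^sub>2) = q\<^sub>2 ^ n))"

text \<open>When \<open>M1\<close> and \<open>M2\<close> do not permute, a normal subgroup inside
  one of them lies in the other, since it would supplement it otherwise. Hence the cores agree, one
  \<open>H\<close> serves both, and the commutativity of \<open>G Mod H\<close> forces the
  intersection down to the core.\<close>

lemma chief_condition_imp_intersection_condition:
  assumes fin: "finite (carrier G)" and CF: "prime_chief_factors_above G {\<one>}" and cc: "chief_condition k"
    and k: "k \<ge> 1"
  shows "intersection_condition k"
  unfolding intersection_condition_def
proof (intro allI impI, rule disjCI)
  fix M1 M2 assume "maximal_subgroup M1 G \<and> maximal_subgroup M2 G" and ne: "\<not> (\<exists>n q\<^sub>1 q\<^sub>2. 1 \<le> n \<and> n \<le> k \<and>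
            Factorial_Ring.prime q\<^sub>1 \<and> Factorial_Ring.prime q\<^sub>2 \<and>
            n_maximal_subgroup n (M1 \<inter> M2) (G\<lparr>carrier := M1\<rparr>) \<and>
            subgroup_index (G\<lparr>carrier := M1\<rparr>) (M1 \<inter> M2) = q\<^sub>1 ^ n \<and>
            n_maximal_subgroup n (M1 \<inter> M2) (G\<lparr>carrier := M2\<rparr>) \<and>
            subgroup_index (G\<lparr>carrier := M2\<rparr>) (M1 \<inter> M2) = q\<^sub>2 ^ n)"
  then have max: "maximal_subgroup M1 G" "maximal_subgroup M2 G" by auto
  then have sg: "subgroup M1 G" "subgroup M2 G" and pr: "M1 \<noteq> carrier G" "M2 \<noteq> carrier G"
    by (auto simp: maximal_subgroup_def)
  let ?D = "M1 \<inter> M2"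
  have D: "subgroup ?D G" using subgroups_Inter_pair[OF sg] .
  have Dpos: "card ?D > 0" by (rule card_subgroup_pos[OF fin D])
  show "M1 = M2"
  proof (rule ccontr)
    assume neq: "M1 \<noteq> M2"
    have nsub: "\<not> M1 \<subseteq> M2" "\<not> M2 \<subseteq> M1" using max neq sg pr by (auto simp: maximal_subgroup_def)
    \<comment> \<open>If the product were \<open>G\<close>, the index of the intersection in each
      subgroup would be the prime index of the other one in \<open>G\<close>, and
      \<open>n = 1\<close> would satisfy the condition.\<close>
    have prod: "M1 <#> M2 \<noteq> carrier G"
    proof
      assume prod: "M1 <#> M2 = carrier G"
      obtain p1 where p1: "Factorial_Ring.prime p1" "card (carrier G) = p1 * card M1"
        using maximal_prime_index[OF fin CF max(1)] by blast
      obtain p2 where p2: "Factorial_Ring.prime p2" "card (carrier G) = p2 * card M2"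
        using maximal_prime_index[OF fin CF max(2)] by blast
      have c: "card (carrier G) * card ?D = card M1 * card M2"
        using card_set_mult[OF fin sg] prod by simp
      have pos: "card M1 > 0" "card M2 > 0" using card_subgroup_pos[OF fin] sg by auto
      have "card M2 * (p2 * card ?D) = card M2 * card M1" using c p2(2) by (simp add: mult_ac)
      then have c1: "card M1 = p2 * card ?D" using pos by simp
      have "card M1 * (p1 * card ?D) = card M1 * card M2" using c p1(2) by (simp add: mult_ac)
      then have c2: "card M2 = p1 * card ?D" using pos by simp
      have "n_maximal_subgroup 1 ?D (G\<lparr>carrier := M1\<rparr>)"
        using maximal_of_prime_index[OF fin p2(1) sg(1) D _ c1] by simp
      moreover have "n_maximal_subgroup 1 ?D (G\<lparr>carrier := M2\<rparr>)"
        using maximal_of_prime_index[OF fin p1(1) sg(2) D _ c2] by simp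
      moreover have "subgroup_index (G\<lparr>carrier := M1\<rparr>) ?D = p2 ^ 1" "subgroup_index (G\<lparr>carrier := M2\<rparr>) ?D = p1 ^ 1"
        using subgroup_index_eq_iff[OF fin sg(1) D] subgroup_index_eq_iff[OF fin sg(2) D] c1 c2 by auto
      ultimately show False using ne k p1(1) p2(1) by blast
    qed
    have notin: "N \<subseteq> M2" if N: "N \<lhd> G" "N \<subseteq> M1" for N
    proof (rule ccontr)
      assume "\<not> N \<subseteq> M2"
      then have "N <#> M2 = carrier G" by (rule maximal_mult_normal[OF max(2) N(1)])
      moreover have "N <#> M2 \<subseteq> M1 <#> M2" using N(2) by (rule mono_set_mult) simp
      ultimately show False using prod setmult_subset_G subgroup.subset sg by blast
    qed
    have notin': "N \<subseteq> M1" if N: "N \<lhd> G" "N \<subseteq> M2" for N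
    proof (rule ccontr)
      assume "\<not> N \<subseteq> M1"
      then have "N <#> M1 = carrier G" by (rule maximal_mult_normal[OF max(1) N(1)])
      then have "M1 <#> N = carrier G" using commut_normal[OF sg(1) N(1)] by simp
      moreover have "M1 <#> N \<subseteq> M1 <#> M2" using N(2) by (intro mono_set_mult) auto
      ultimately show False using prod setmult_subset_G subgroup.subset sg by blast
    qed
    have nn: "\<not> M1 \<lhd> G" "\<not> M2 \<lhd> G" using notin notin' nsub by blast+
    have core_eq: "core G M1 = core G M2"
    proof
      show "core G M1 \<subseteq> core G M2"
        using core_greatest[OF sg(2) normal_core[OF sg(1)]] notin normal_core core_subset sg by blast
      show "core G M2 \<subseteq> core G M1"
        using core_greatest[OF sg(1) normal_core[OF sg(2)]] notin' normal_core core_subset sg by blast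
    qed
    let ?L = "core G M1"
    obtain H p q n where H: "H \<lhd> G" "?L \<subset> H" and p: "Factorial_Ring.prime p" "card H = p * card ?L"
      and cyc: "cyclic_group (G Mod H)" and q: "Factorial_Ring.prime q" "1 \<le> n" "n \<le> k"
      and card: "card (carrier G) = p * card M1" "card M1 = q ^ n * card ?L"
      by (rule chief_condition_core[OF fin CF cc max(1) nn(1)])
    have H2: "core G M2 \<subset> H" "card H = p * card (core G M2)" using H(2) p(2) core_eq by auto
    have int: "H \<inter> M1 = ?L" "H \<inter> M2 = ?L"
      using core_factor_Int[OF fin max(1) H p] core_factor_Int[OF fin max(2) H(1) H2(1) p(1) H2(2)] core_eq by auto
    have "card (carrier G) = p * card M2" using core_factor_card[OF fin max(2) H(1) H2(1) p(1) H2(2)] .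
    then have cM2: "card M2 = q ^ n * card ?L" using card prime_gt_0_nat[OF p(1)] by simp
    interpret H: normal H G by (rule H(1))
    have LG: "?L \<lhd> G" by (rule normal_core[OF sg(1)])
    have comm: "x \<otimes> y \<otimes> inv x \<otimes> inv y \<in> H" if xy: "x \<in> carrier G" "y \<in> carrier G" for x y
    proof -
      have "comm_group (G Mod H)" using group.cyclic_imp_abelian_group[OF H.factorgroup_is_group cyc] .
      then have "derived G (carrier G) \<subseteq> H" by (rule derived_minimal[OF H(1)])
      moreover have "x \<otimes> y \<otimes> inv x \<otimes> inv y \<in> derived_set G (carrier G)" using xy by blast
      then have "x \<otimes> y \<otimes> inv x \<otimes> inv y \<in> derived G (carrier G)" by (simp add: derived_def generate.incl)
      ultimately show ?thesis by blast
    qed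
    have LD: "?L \<subseteq> ?D" using core_subset[OF sg(1)] core_subset[OF sg(2)] core_eq by blast
    \<comment> \<open>Commutators lie in \<open>H\<close>, and those of elements of
      \<open>Mi\<close> in \<open>H \<inter> Mi\<close>, which is the core and so contained in
      \<open>?D\<close>. Both maximal subgroups thus normalize \<open>?D\<close>, and it is
      normal.\<close>
    have norm: "Mi \<subseteq> normer ?D" if Mi: "subgroup Mi G" "H \<inter> Mi = ?L" "?D \<subseteq> Mi" for Mi
    proof
      interpret Mi: subgroup Mi G by (rule Mi(1))
      fix g assume g: "g \<in> Mi"
      have "g \<otimes> x \<otimes> inv g \<in> ?D" if x: "x \<in> ?D" for x
      proof -
        have xMi: "x \<in> Mi" using x Mi(3) by blast
        have "g \<otimes> x \<otimes> inv g \<otimes> inv x \<in> H" using comm g xMi by simp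
        moreover have "g \<otimes> x \<otimes> inv g \<otimes> inv x \<in> Mi" using g xMi by simp
        ultimately have "g \<otimes> x \<otimes> inv g \<otimes> inv x \<in> ?D" using Mi(2) LD by blast
        then have "(g \<otimes> x \<otimes> inv g \<otimes> inv x) \<otimes> x \<in> ?D" using x by (rule subgroup.m_closed[OF D])
        then show ?thesis using g xMi by (simp add: m_assoc)
      qed
      then show "g \<in> normer ?D" using g by (simp add: normer_def)
    qed
    have N1: "M1 \<subseteq> normer ?D" and N2: "M2 \<subseteq> normer ?D" using norm[OF sg(1) int(1)] norm[OF sg(2) int(2)] by auto
    have "normer ?D = carrier G"
      using max(1) N1 N2 nsub(2) subgroup_normer[OF fin D] by (auto simp: maximal_subgroup_def)
    then have "?D \<lhd> G" by (rule normer_eq_carrier[OF D])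
    then have "?D \<subseteq> ?L" using core_greatest[OF sg(1)] by blast
    then have DL: "?D = ?L" using LD by blast
    have "n_maximal_subgroup n ?D (G\<lparr>carrier := M1\<rparr>)" "n_maximal_subgroup n ?D (G\<lparr>carrier := M2\<rparr>)"
      unfolding DL using n_maximal_of_prime_power_index[OF fin LG _ _ q(1)] sg card(2) cM2 LD by auto
    moreover have "subgroup_index (G\<lparr>carrier := M1\<rparr>) ?D = q ^ n" "subgroup_index (G\<lparr>carrier := M2\<rparr>) ?D = q ^ n"
      using subgroup_index_eq_iff[OF fin sg(1) D] subgroup_index_eq_iff[OF fin sg(2) D] card(2) cM2 DL by auto
    ultimately show False using ne q by blast
  qed
qed

lemma n_maximal_subset: "n_maximal_subgroup n L G \<Longrightarrow> subgroup L G"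
proof (induction n arbitrary: L)
  case 0
  then show ?case by (simp add: subgroup_self)
next
  case (Suc n)
  then obtain Y where Y: "subgroup Y G" "maximal_subgroup L (G\<lparr>carrier := Y\<rparr>)" by auto
  then show ?case using incl_subgroup by (auto simp: maximal_subgroup_def)
qed

text \<open>A chain with two proper steps would put a proper subgroup strictly above
  \<open>D\<close>.\<close>

lemma n_maximal_and_maximal:
  assumes "n_maximal_subgroup n D G" "maximal_subgroup D G" shows "n = 1"
proof (cases n)
  case 0
  then show ?thesis using assms by (simp add: maximal_subgroup_def)
next
  case (Suc m)
  then obtain L where L: "n_maximal_subgroup m L G" "maximal_subgroup D (G\<lparr>carrier := L\<rparr>)" using assms(1) by auto
  have "D \<subset> L" using L(2) subgroup.subset by (fastforce simp: maximal_subgroup_def)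
  then have LG: "L = carrier G" using assms(2) n_maximal_subset[OF L(1)] by (auto simp: maximal_subgroup_def)
  show ?thesis
  proof (cases m)
    case (Suc l)
    then obtain Y where Y: "n_maximal_subgroup l Y G" "maximal_subgroup L (G\<lparr>carrier := Y\<rparr>)" using L(1) by auto
    have "L \<subset> Y" using Y(2) subgroup.subset by (fastforce simp: maximal_subgroup_def)
    then show ?thesis using LG subgroup.subset[OF n_maximal_subset[OF Y(1)]] by blast
  qed (use Suc in simp)
qed

lemma maximal_conjugate:
  assumes fin: "finite (carrier G)" and M: "maximal_subgroup M G" and g: "g \<in> carrier G"
  shows "maximal_subgroup (conjugate g M) G"
  unfolding maximal_subgroup_def
proof (intro conjI allI impI)
  have MG: "subgroup M G" "M \<noteq> carrier G" using M by (auto simp: maximal_subgroup_def)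
  have Mc: "M \<subseteq> carrier G" by (rule subgroup.subset[OF MG(1)])
  show "subgroup (conjugate g M) G" by (rule subgroup_conjugate[OF MG(1) g])
  have "card M \<noteq> card (carrier G)" using subgroup_eqI_card[OF fin subgroup_self Mc] MG(2) by auto
  then show "conjugate g M \<noteq> carrier G" using card_conjugate[OF Mc g] by auto
  fix L assume L: "subgroup L G \<and> conjugate g M \<subseteq> L"
  have Lc: "L \<subseteq> carrier G" using L subgroup.subset by blast
  have "M \<subseteq> conjugate (inv g) L"
  proof
    fix x assume x: "x \<in> M"
    then have "g \<otimes> x \<otimes> inv g \<in> L" using L by (auto simp: conjugate_def)
    then show "x \<in> conjugate (inv g) L" using x Mc g by (auto simp: mem_conjugate_iff[OF Lc])
  qed
  then have "conjugate (inv g) L = M \<or> conjugate (inv g) L = carrier G"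
    using M subgroup_conjugate[of L "inv g"] L g by (auto simp: maximal_subgroup_def)
  then have "card L = card M \<or> card L = card (carrier G)" using card_conjugate[OF Lc, of "inv g"] g by auto
  then show "L = conjugate g M \<or> L = carrier G"
    using subgroup_eqI_card[OF fin, of L "conjugate g M"] subgroup_eqI_card[OF fin subgroup_self Lc] L
      card_conjugate[OF Mc g] by auto
qed

lemma intersection_condition_imp_max_condition:
  assumes fin: "finite (carrier G)" and solv: "solvable G" and ic: "intersection_condition k" and k: "k \<ge> 1"
  shows "max_condition k"
  unfolding max_condition_def
proof (intro allI impI)
  fix M assume M: "maximal_subgroup M G"
  have MG: "subgroup M G" and MG': "M \<noteq> carrier G" using M by (auto simp: maximal_subgroup_def)
  interpret M: subgroup M G by fact
  show "\<exists>n. 1 \<le> n \<and> n \<le> k \<and> modularly_embedded n M G"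
  proof (cases "M \<lhd> G")
    case True
    then have "modularly_embedded 1 M G" using normal_imp_subgroup by (auto simp: modularly_embedded_def)
    then show ?thesis using k by blast
  next
    case False
    let ?L = "core G M"
    have LG: "?L \<lhd> G" by (rule normal_core[OF MG])
    interpret L: normal ?L G by (rule LG)
    have LM: "?L \<subseteq> M" by (rule core_subset[OF MG])
    have Lpos: "card ?L > 0" by (rule card_subgroup_pos[OF fin L.subgroup_axioms])
    have "?L \<subset> carrier G" using LM M.subset MG' by blast
    then obtain H where H: "chief_factor G H ?L" using chief_factor_above[OF fin LG normal_self] by blast
    then have HG: "H \<lhd> G" and LH: "?L \<subset> H" by (auto simp: chief_factor_def)
    interpret H: normal H G by (rule HG)
    have HM: "\<not> H \<subseteq> M" using core_greatest[OF MG HG] LH by blast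
    have mult: "H <#> M = carrier G" by (rule maximal_mult_normal[OF M HG HM])
    \<comment> \<open>Solubility enters here: \<open>H/?L\<close> is abelian, so commutators of
      elements of \<open>H\<close> lie in \<open>?L\<close> and thus in \<open>M\<close>.\<close>
    have "H \<inter> M \<lhd> G"
      using solvable_chief_factor_abelian[OF solv H] LM
      by (intro normal_Int_supplement[OF HG MG mult H.subset]) blast
    then have int: "H \<inter> M = ?L" using core_greatest[OF MG, of "H \<inter> M"] LM LH by blast
    have HnG: "H \<noteq> carrier G"
    proof
      assume "H = carrier G"
      then have "?L = M" using int M.subset by blast
      then show False using False LG by simp
    qed
    obtain T where T: "maximal_subgroup T G" "H \<subseteq> T" using maximal_above[OF fin H.subgroup_axioms HnG] by blast
    have TG: "subgroup T G" using T(1) by (simp add: maximal_subgroup_def)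
    interpret T: subgroup T G by (rule TG)
    have TM: "T \<noteq> M" using HM T(2) by blast
    have TMs: "subgroup (T \<inter> M) G" using subgroups_Inter_pair[OF TG MG] .
    \<comment> \<open>A subgroup \<open>Y\<close> of \<open>M\<close> above
      \<open>T \<inter> M\<close> is recovered from \<open>H <#> Y\<close>, and there is no room for
      this product between \<open>T\<close> and \<open>G\<close>.\<close>
    have maxTM: "maximal_subgroup (T \<inter> M) (G\<lparr>carrier := M\<rparr>)"
      unfolding maximal_subgroup_def
    proof (intro conjI allI impI)
      show "subgroup (T \<inter> M) (G\<lparr>carrier := M\<rparr>)" by (rule subgroup_incl[OF TMs MG]) simp
      have "\<not> M \<subseteq> T" using M T(1) TM by (auto simp: maximal_subgroup_def)
      then show "T \<inter> M \<noteq> carrier (G\<lparr>carrier := M\<rparr>)" by auto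
      fix Y assume Y: "subgroup Y (G\<lparr>carrier := M\<rparr>) \<and> T \<inter> M \<subseteq> Y"
      have YG: "subgroup Y G" using incl_subgroup[OF MG] Y by blast
      have YM: "Y \<subseteq> M" using Y subgroup.subset by fastforce
      interpret Y: subgroup Y G by (rule YG)
      have HY: "subgroup (H <#> Y) G" by (rule mult_norm_subgroup[OF HG YG])
      have "T \<subseteq> H <#> Y"
      proof
        fix t assume t: "t \<in> T"
        then have "t \<in> H <#> M" using mult by simp
        then obtain h m where hm: "h \<in> H" "m \<in> M" "t = h \<otimes> m" by (rule set_multE)
        have "inv h \<otimes> t \<in> T" using t hm(1) T(2) by auto
        then have "m \<in> Y" using hm Y by auto
        then show "t \<in> H <#> Y" unfolding hm(3) by (rule set_multI[OF hm(1)])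
      qed
      then consider "H <#> Y = T" | "H <#> Y = carrier G" using T(1) HY by (auto simp: maximal_subgroup_def)
      then show "Y = T \<inter> M \<or> Y = carrier (G\<lparr>carrier := M\<rparr>)"
      proof cases
        case 1
        then have "Y \<subseteq> T" using subset_set_mult(2)[OF H.subgroup_axioms YG] by blast
        then show ?thesis using Y YM by blast
      next
        case 2
        have "M \<subseteq> Y"
        proof
          fix m assume m: "m \<in> M"
          then have "m \<in> H <#> Y" using 2 by simp
          then obtain h y where hy: "h \<in> H" "y \<in> Y" "m = h \<otimes> y" by (rule set_multE)
          have "m \<otimes> inv y \<in> M" using m hy(2) YM by blast
          then have "h \<in> M" using hy by (simp add: m_assoc)
          then have "h \<in> ?L" using hy(1) int by blast
          then have "h \<in> Y" using LH T(2) LM Y by blast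
          then show "m \<in> Y" using hy by simp
        qed
        then show ?thesis using YM by auto
      qed
    qed
    obtain n q1 q2 where *: "Factorial_Ring.prime q1" "n_maximal_subgroup n (T \<inter> M) (G\<lparr>carrier := M\<rparr>)"
      "subgroup_index (G\<lparr>carrier := T\<rparr>) (T \<inter> M) = q1 ^ n"
      using ic T(1) M TM unfolding intersection_condition_def by blast
    interpret GM: group "G\<lparr>carrier := M\<rparr>" by (rule subgroup_imp_group[OF MG])
    \<comment> \<open>So the index of \<open>T \<inter> M\<close> in \<open>T\<close> is the prime
      \<open>q1\<close>. As \<open>T <#> M\<close> and \<open>H <#> M\<close> are both
      \<open>G\<close>, it is also the index of \<open>M\<close> in \<open>G\<close> and of
      \<open>?L\<close> in \<open>H\<close>.\<close>
    have "n = 1" by (rule GM.n_maximal_and_maximal[OF *(2) maxTM])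
    then have cT: "card T = q1 * card (T \<inter> M)" using *(3) subgroup_index_eq_iff[OF fin TG TMs] by simp
    have "H <#> M \<subseteq> T <#> M" using T(2) by (rule mono_set_mult) simp
    then have "T <#> M = carrier G" using mult setmult_subset_G[OF T.subset M.subset] by blast
    then have "card (carrier G) * card (T \<inter> M) = card T * card M" using card_set_mult[OF fin TG MG] by simp
    then have cG: "card (carrier G) = q1 * card M" using cT card_subgroup_pos[OF fin TMs] by simp
    have "card (carrier G) * card ?L = card H * card M"
      using card_set_mult[OF fin H.subgroup_axioms MG] mult int by simp
    then have cH: "card H = q1 * card ?L" using cG card_subgroup_pos[OF fin MG] by simp
    note cent = core_factor_centralizer[OF fin M HG LH *(1) cH]
    \<comment> \<open>A conjugate by an element of \<open>H\<close> is chosen because its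
      intersection with \<open>M\<close> can be controlled through the centralizer of
      \<open>H/?L\<close>.\<close>
    obtain x where x: "x \<in> H" "x \<notin> ?L" using LH by blast
    have xM: "x \<notin> M" using x int by blast
    have xG: "x \<in> carrier G" using x(1) by simp
    let ?M = "conjugate x M"
    have max2: "maximal_subgroup ?M G" by (rule maximal_conjugate[OF fin M xG])
    have sg2: "subgroup ?M G" using max2 by (simp add: maximal_subgroup_def)
    have "?M \<noteq> M"
    proof
      assume "?M = M"
      then have "\<forall>y\<in>M. x \<otimes> y \<otimes> inv x \<in> M" by (auto simp: conjugate_def)
      then show False using maximal_normalI[OF fin M xG xM] False by blast
    qed
    then obtain n q where n: "1 \<le> n" "n \<le> k" "Factorial_Ring.prime q"
      "subgroup_index (G\<lparr>carrier := M\<rparr>) (M \<inter> ?M) = q ^ n"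
      using ic M max2 unfolding intersection_condition_def by metis
    have MM: "subgroup (M \<inter> ?M) G" using subgroups_Inter_pair[OF MG sg2] .
    \<comment> \<open>For \<open>y\<close> in both subgroups,
      \<open>inv y \<otimes> (inv x \<otimes> y \<otimes> x)\<close> lies in \<open>M\<close> and in
      \<open>H\<close>, hence in \<open>?L\<close>. So \<open>y\<close> fixes the coset of
      \<open>x\<close>, centralizes \<open>H/?L\<close>, and lies in
      \<open>H \<inter> M\<close>.\<close>
    have "M \<inter> ?M = ?L"
    proof
      show "?L \<subseteq> M \<inter> ?M"
      proof
        fix z assume z: "z \<in> ?L"
        then have "inv x \<otimes> z \<otimes> x \<in> ?L" by (rule L.inv_op_closed1[OF xG])
        then have "z \<in> ?M" using mem_conjugate_iff[OF M.subset xG] L.mem_carrier[OF z] LM by blast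
        then show "z \<in> M \<inter> ?M" using z LM by blast
      qed
      show "M \<inter> ?M \<subseteq> ?L"
      proof
        fix y assume "y \<in> M \<inter> ?M"
        then have y: "y \<in> M" "inv x \<otimes> y \<otimes> x \<in> M" by (auto simp: mem_conjugate_iff[OF M.subset xG])
        have "inv y \<otimes> (inv x \<otimes> y \<otimes> x) \<in> M" using y by simp
        moreover have "inv y \<otimes> inv x \<otimes> y \<in> H" using H.inv_op_closed1[of y "inv x"] y(1) x(1) by simp
        then have "(inv y \<otimes> inv x \<otimes> y) \<otimes> x \<in> H" using x(1) by (rule H.m_closed)
        then have "inv y \<otimes> (inv x \<otimes> y \<otimes> x) \<in> H" using x(1) y(1) by (simp add: m_assoc)
        ultimately have c: "inv y \<otimes> (inv x \<otimes> y \<otimes> x) \<in> ?L" using int by blast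
        have yG: "y \<in> carrier G" using y(1) by simp
        have "x \<otimes> y \<otimes> (inv y \<otimes> (inv x \<otimes> y \<otimes> x)) \<otimes> inv (x \<otimes> y) \<in> ?L"
          using L.inv_op_closed2[OF _ c, of "x \<otimes> y"] xG yG by simp
        then have "y \<otimes> x \<otimes> inv y \<otimes> inv x \<in> ?L" using xG yG by (simp add: m_assoc inv_mult_group)
        then have "y \<in> factor_centralizer G H ?L"
          using mem_factor_centralizerI[OF fin HG LG _ *(1) cH x yG] LH by blast
        then show "y \<in> ?L" using cent int y(1) by blast
      qed
    qed
    then have "subgroup_index (G\<lparr>carrier := M\<rparr>) ?L = q ^ n" using n(4) by simp
    then have "card M = q ^ n * card ?L" using subgroup_index_eq_iff[OF fin MG L.subgroup_axioms LM] by blast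
    then have "modularly_embedded n M G" using modularly_embeddedI[OF fin M False *(1) cG n(3)] by blast
    then show ?thesis using n(1,2) by blast
  qed
qed

end

theorem theorem1:
  fixes G :: "('a, 'b) monoid_scheme" and k :: nat
  assumes "group G" and "finite (carrier G)" and "k \<ge> 1"
  shows
    "((\<forall>M. maximal_subgroup M G \<longrightarrow> submodular k M G)
      \<longleftrightarrow>
      supersoluble G \<and>
      (\<forall>H K. chief_factor G H K \<and> complemented_factor G H K \<longrightarrow>
         trivial_group (G Mod factor_centralizer G H K) \<or>
         cyclic_group (G Mod factor_centralizer G H K) \<and>
         (\<exists>q n. Factorial_Ring.prime q \<and> 1 \<le> n \<and> n \<le> k \<and>
            Coset.order (G Mod factor_centralizer G H K) = q ^ n)))
     \<and>
     ((\<forall>M. maximal_subgroup M G \<longrightarrow> submodular k M G)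
      \<longleftrightarrow>
      solvable G \<and>
      (\<forall>M\<^sub>1 M\<^sub>2. maximal_subgroup M\<^sub>1 G \<and> maximal_subgroup M\<^sub>2 G \<longrightarrow>
         M\<^sub>1 = M\<^sub>2 \<or>
         (\<exists>n q\<^sub>1 q\<^sub>2. 1 \<le> n \<and> n \<le> k \<and>
            Factorial_Ring.prime q\<^sub>1 \<and> Factorial_Ring.prime q\<^sub>2 \<and>
            n_maximal_subgroup n (M\<^sub>1 \<inter> M\<^sub>2) (G\<lparr>carrier := M\<^sub>1\<rparr>) \<and>
            subgroup_index (G\<lparr>carrier := M\<^sub>1\<rparr>) (M\<^sub>1 \<inter> M\<^sub>2) = q\<^sub>1 ^ n \<and>
            n_maximal_subgroup n (M\<^sub>1 \<inter> M\<^sub>2) (G\<lparr>carrier := M\<^sub>2\<rparr>) \<and>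
            subgroup_index (G\<lparr>carrier := M\<^sub>2\<rparr>) (M\<^sub>1 \<inter> M\<^sub>2) = q\<^sub>2 ^ n)))"
proof -
  interpret group G by fact
  note fin = assms(2)
  have "(\<forall>M. maximal_subgroup M G \<longrightarrow> submodular k M G) \<longleftrightarrow> max_condition k"
    unfolding max_condition_def using submodular_maximal_iff by blast
  moreover have "max_condition k \<longleftrightarrow> supersoluble G \<and> chief_condition k"
    using max_condition_prime_chief_factors[OF fin] max_condition_imp_chief_condition[OF fin]
      supersoluble_if_prime_chief_factors[OF fin] prime_chief_factors_if_supersoluble[OF fin]
      chief_condition_imp_max_condition[OF fin _ _ assms(3)] by blast
  \<comment> \<open>Closed as a circle: (1) gives (2), (2) gives (3), and (3) gives (1).\<close>
  moreover have "max_condition k \<longleftrightarrow> solvable G \<and> intersection_condition k"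
    using \<open>max_condition k \<longleftrightarrow> supersoluble G \<and> chief_condition k\<close> supersoluble_imp_solvable
      prime_chief_factors_if_supersoluble[OF fin] chief_condition_imp_intersection_condition[OF fin _ _ assms(3)]
      intersection_condition_imp_max_condition[OF fin _ _ assms(3)] by blast
  ultimately show ?thesis unfolding chief_condition_def intersection_condition_def by blast
qed

end
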